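(* Let $d\in\{2,3\}$, $T>0$, and let $\Omega\subset\mathbb{R}^d$ be a bounded domain of class $C^1$. Let $[\varrho,\mathbf{m}]$ be a dissipative solution of the compressible Euler system in $(0,T)\times\Omega$ (with impermeable boundary and initial data $[\varrho_0,\mathbf{m}_0]$), with associated turbulent defect measures $\mathfrak{R}_v$, $\mathfrak{R}_p$. Suppose that $\varrho$ and $\mathbf{m}$ are continuously differentiable in $[0,T)\times\overline{\Omega}$ and that there is a constant $\underline{\varrho}>0$ with $\varrho\ge\underline{\varrho}$. Then $\mathfrak{R}_v=0$ and $\mathfrak{R}_p=0$, and $[\varrho,\mathbf{m}]$ is a classical solution of the Euler system.
   Context: Constitutive relations: $p(\varrho)=a\varrho^\gamma$, $P(\varrho)=\frac{a}{\gamma-1}\varrho^\gamma$ with constants $a>0$, $\gamma>1$. Euler system: $\partial_t\varrho+\mathrm{div}_x\mathbf{m}=0$, $\partial_t\mathbf{m}+\mathrm{div}_x\left(\frac{\mathbf{m}\otimes\mathbf{m}}{\varrho}\right)+\nabla_x p(\varrho)=0$ in $(0,T)\times\Omega$, with $\mathbf{u}\cdot\mathbf{n}|_{\partial\Omega}=0$ where $\mathbf{m}=\varrho\mathbf{u}$ and $\mathbf{n}$ is the outer normal, and initial conditions $\varrho(0,\cdot)=\varrho_0$, $\mathbf{m}(0,\cdot)=\mathbf{m}_0$. A classical solution is a continuously differentiable one satisfying these relations pointwise. Notation: $\mathcal{M}^+(\overline\Omega)$ is the set of non-negative (finite) Borel measures on $\overline\Omega$; $\mathcal{M}^+(\overline\Omega;\mathbb{R}^{d\times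 d}_{\rm sym})$ is the set of (signed) symmetric-matrix-valued measures $\mathfrak{R}$ on $\overline\Omega$ with $\mathfrak{R}:(\xi\otimes\xi)\in\mathcal{M}^+(\overline\Omega)$ for all $\xi\in\mathbb{R}^d$. $L^\infty(0,T;\mathcal{M}^+)$ denotes weakly-( * ) measurable, essentially bounded families (equality $\mathfrak{R}=0$ means for a.e. $t$). $C_{\rm weak}([0,T];X)$ denotes functions continuous in time with values in $X$ with its weak topology. The kinetic energy $\frac{|\mathbf{m}|^2}{\varrho}$ is understood as $0$ if $\mathbf{m}=0$ and $+\infty$ if $\varrho=0$, $\mathbf{m}\neq0$. $\left[f\right]_{t=\tau_1}^{t=\tau_2}=f(\tau_2)-f(\tau_1)$. Definition (dissipative solution). A pair $\varrho\in C_{\rm weak}([0,T];L^\gamma(\Omega))$, $\varrho\ge0$, $\mathbf{m}\in C_{\rm weak}([0,T];L^{\frac{2\gamma}{\gamma+1}}(\Omega;\mathbb{R}^d))$ with $\varrho(0,\cdot)=\varrho_0$, $\mathbf{m}(0,\cdot)=\mathbf{m}_0$ (data of finite energy) is a dissipative solution if there exist turbulent defect measures $\mathfrak{R}_v\in L^\infty(0,T;\mathcal{M}^+(\overline\Omega;\mathbb{R}^{d\times d}_{\rm sym}))$, $\mathfrak{R}_p\in L^\infty(0,T;\mathcal{M}^+(\overline\Omega))$ such that: (1) $\left[\int_\Omega\varrho\varphi\,dx\right]_{t=0}^{t=\tau}=\int_0^\tau\int_\Omega[\varrho\partial_t\varphi+\mathbf{m}\cdot\nabla_x\varphi]\,dx\,dt$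 for any $0<\tau<T$ and $\varphi\in C^1_c([0,T)\times\overline\Omega)$; (2) $\left[\int_\Omega\mathbf{m}\cdot\boldsymbol{\varphi}\,dx\right]_{t=0}^{t=\tau}=\int_0^\tau\int_\Omega\left[\mathbf{m}\cdot\partial_t\boldsymbol{\varphi}+\frac{\mathbf{m}\otimes\mathbf{m}}{\varrho}:\nabla_x\boldsymbol{\varphi}+p(\varrho)\,\mathrm{div}_x\boldsymbol{\varphi}\right]dx\,dt+\int_0^\tau\int_{\overline\Omega}\nabla_x\boldsymbol{\varphi}:d[\mathfrak{R}_v+\mathfrak{R}_p\mathbb{I}]\,dt$ for any $0<\tau<T$ and $\boldsymbol{\varphi}\in C^1_c([0,T)\times\overline\Omega;\mathbb{R}^d)$ with $\boldsymbol{\varphi}\cdot\mathbf{n}|_{\partial\Omega}=0$; (3) setting $\mathcal{E}(t)=\int_\Omega\left[\frac12\frac{|\mathbf{m}|^2}{\varrho}+P(\varrho)\right]dx+\int_{\overline\Omega}\frac12\,d\,\mathrm{trace}[\mathfrak{R}_v]+\int_{\overline\Omega}\frac{1}{\gamma-1}\,d\mathfrak{R}_p$, one has $\left[\psi\mathcal{E}\right]_{t=\tau_1-}^{t=\tau_2+}\le\int_{\tau_1}^{\tau_2}\partial_t\psi\,\mathcal{E}\,dt$ for any $0\le\tau_1\le\tau_2<T$ and $\psi\in C^1_c[0,T)$, $\psi\ge0$. Here $\tau\pm$ denote one-sided limits ($\mathcal{E}$ being identified with a representative that has them), and $\mathcal{E}(0-)=\int_\Omega\left[\frac12\frac{|\mathbf{m}_0|^2}{\varrho_0}+P(\varrho_0)\right]dx$.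 *)

theory Defs
  imports "HOL-Analysis.Analysis"
begin

section \<open>Continuously differentiable functions up to the boundary\<close>

text \<open>
  \<open>C1_deriv_on S f f'\<close>: \<open>f\<close> is continuously differentiable on \<open>S\<close> with derivative \<open>f'\<close>. It is
  used with \<open>S = {0..<T} \<times> closure \<Omega>\<close>, \<open>S = {0..<T}\<close> and \<open>S = UNIV\<close>; on points of \<open>S\<close> that are
  not interior the derivative is taken within \<open>S\<close>. In all these cases the interior of \<open>S\<close> is
  dense in \<open>S\<close>, so that the continuous \<open>f'\<close> is uniquely determined on \<open>S\<close>.
\<close>

definition C1_deriv_on ::
  "'a::real_normed_vector set \<Rightarrow> ('a \<Rightarrow> 'b::real_normed_vector) \<Rightarrow> ('a \<Rightarrow> 'a \<Rightarrow>\<^sub>L 'b) \<Rightarrow> bool" where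
  "C1_deriv_on S f f' \<longleftrightarrow>
     (\<forall>z\<in>S. (f has_derivative blinfun_apply (f' z)) (at z within S)) \<and> continuous_on S f'"

definition C1_on :: "'a::real_normed_vector set \<Rightarrow> ('a \<Rightarrow> 'b::real_normed_vector) \<Rightarrow> bool" where
  "C1_on S f \<longleftrightarrow> (\<exists>f'. C1_deriv_on S f f')"

definition C1c_deriv_on ::
  "'a::real_normed_vector set \<Rightarrow> ('a \<Rightarrow> 'b::real_normed_vector) \<Rightarrow> ('a \<Rightarrow> 'a \<Rightarrow>\<^sub>L 'b) \<Rightarrow> bool" where
  "C1c_deriv_on S f f' \<longleftrightarrow>
     C1_deriv_on S f f' \<and> (\<exists>K. compact K \<and> K \<subseteq> S \<and> (\<forall>z\<in>S - K. f z = 0))"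

text \<open>
  Differential operators in space-time, as functions of the total derivative \<open>L\<close> at \<open>(t, x)\<close>.
  Conventions: the gradient of a vector field has the entries \<open>(\<nabla>\<phi>)\<^sub>i\<^sub>j = \<partial>\<^sub>j \<phi>\<^sub>i\<close>, and the
  divergence of a matrix field is taken along rows.
\<close>

definition dt :: "(real \<times> (real^'n) \<Rightarrow> 'b) \<Rightarrow> 'b" where
  "dt L = L (1, 0)"

definition grad :: "(real \<times> (real^'n) \<Rightarrow> real) \<Rightarrow> real^'n" where
  "grad L = (\<chi> i. L (0, axis i 1))"

definition vgrad :: "(real \<times> (real^'n) \<Rightarrow> real^'n) \<Rightarrow> real^'n^'n" where
  "vgrad L = (\<chi> i j. L (0, axis j 1) $ i)"

definition vdiv :: "(real \<times> (real^'n) \<Rightarrow> real^'n) \<Rightarrow> real" where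
  "vdiv L = (\<Sum>j\<in>UNIV. L (0, axis j 1) $ j)"

definition mdiv :: "(real \<times> (real^'n) \<Rightarrow> real^'n^'n) \<Rightarrow> real^'n" where
  "mdiv L = (\<chi> i. \<Sum>j\<in>UNIV. L (0, axis j 1) $ i $ j)"

definition tensor :: "real^'n \<Rightarrow> real^'n \<Rightarrow> real^'n^'n" (infixl "\<otimes>\<^sub>t" 75) where
  "v \<otimes>\<^sub>t w = (\<chi> i j. v $ i * w $ j)"

text \<open>The inner product \<open>\<bullet>\<close> on \<^typ>\<open>real^'n^'n\<close> is the Frobenius product \<open>A : B\<close>.\<close>


section \<open>Domains of class \<open>C\<^sup>1\<close>\<close>

text \<open>
  Near \<open>x0\<close> the set \<open>\<Omega>\<close> lies below the graph of a \<open>C\<^sup>1\<close> function over the hyperplane orthogonal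
  to the unit vector \<open>e\<close>. Only the values of \<open>g\<close> on this hyperplane are used.
\<close>

definition graph_chart ::
  "(real^'n) set \<Rightarrow> real^'n \<Rightarrow> real^'n \<Rightarrow> (real^'n \<Rightarrow> real) \<Rightarrow> real \<Rightarrow> bool" where
  "graph_chart \<Omega> x0 e g r \<longleftrightarrow>
     norm e = 1 \<and> r > 0 \<and> C1_on UNIV g \<and>
     \<Omega> \<inter> ball x0 r = {x \<in> ball x0 r. x \<bullet> e < g (x - (x \<bullet> e) *\<^sub>R e)}"

definition bounded_C1_domain :: "(real^'n) set \<Rightarrow> bool" where
  "bounded_C1_domain \<Omega> \<longleftrightarrow>
     open \<Omega> \<and> connected \<Omega> \<and> \<Omega> \<noteq> {} \<and> bounded \<Omega> \<and>
     (\<forall>x0\<in>frontier \<Omega>. \<exists>e g r. graph_chart \<Omega> x0 e g r)"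

text \<open>
  In a chart \<open>\<Omega>\<close> is a sublevel set of \<open>y \<mapsto> y \<bullet> e - g (y - (y \<bullet> e) e)\<close>, whose gradient \<open>h\<close>
  satisfies \<open>h \<bullet> e = 1\<close>. The normalised gradient is the outer normal; it is the same
  for all charts.
\<close>

definition outer_normal :: "(real^'n) set \<Rightarrow> real^'n \<Rightarrow> real^'n \<Rightarrow> bool" where
  "outer_normal \<Omega> x n \<longleftrightarrow>
     (\<exists>e g r h. graph_chart \<Omega> x e g r \<and>
        (GDERIV (\<lambda>y. y \<bullet> e - g (y - (y \<bullet> e) *\<^sub>R e)) x :> h) \<and> n = h /\<^sub>R norm h)"


section \<open>Weakly continuous functions with values in Lebesgue spaces\<close>

definition Lp_on :: "real \<Rightarrow> 'a::euclidean_space set \<Rightarrow> ('a \<Rightarrow> 'b::euclidean_space) \<Rightarrow> bool" where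
  "Lp_on p \<Omega> f \<longleftrightarrow>
     f \<in> borel_measurable (lebesgue_on \<Omega>) \<and> integrable (lebesgue_on \<Omega>) (\<lambda>x. norm (f x) powr p)"

text \<open>
  For \<open>1 < p\<close> the dual of \<open>L\<^sup>p(\<Omega>)\<close> is \<open>L\<^sup>q(\<Omega>)\<close> with \<open>q = p / (p - 1)\<close>, so this is continuity on
  \<open>[0,T]\<close> with values in \<open>L\<^sup>p(\<Omega>)\<close> endowed with the weak topology.
\<close>

definition C_weak_Lp ::
  "real \<Rightarrow> real \<Rightarrow> 'a::euclidean_space set \<Rightarrow> (real \<Rightarrow> 'a \<Rightarrow> 'b::euclidean_space) \<Rightarrow> bool" where
  "C_weak_Lp T p \<Omega> f \<longleftrightarrow>
     (\<forall>t\<in>{0..T}. Lp_on p \<Omega> (f t)) \<and>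
     (\<forall>g. Lp_on (p / (p - 1)) \<Omega> g \<longrightarrow>
        continuous_on {0..T} (\<lambda>t. LINT x|lebesgue_on \<Omega>. f t x \<bullet> g x))"


section \<open>Defect measures\<close>

text \<open>
  Signed and matrix-valued measures on a closed set \<open>K\<close> are represented by their set functions;
  only the values on the Borel subsets of \<open>K\<close> are relevant. The integral with respect to a
  signed measure is defined through its Jordan decomposition.
\<close>

definition pos_variation ::
  "'a::topological_space set \<Rightarrow> ('a set \<Rightarrow> real) \<Rightarrow> 'a measure" where
  "pos_variation K \<nu> =
     measure_of K (sets (restrict_space borel K))
       (\<lambda>A. ennreal (SUP B\<in>{B \<in> sets (restrict_space borel K). B \<subseteq> A}. \<nu> B))"

definition neg_variation ::
  "'a::topological_space set \<Rightarrow> ('a set \<Rightarrow> real) \<Rightarrow> 'a measure" where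
  "neg_variation K \<nu> = pos_variation K (\<lambda>A. - \<nu> A)"

definition signed_integral ::
  "'a::topological_space set \<Rightarrow> ('a set \<Rightarrow> real) \<Rightarrow> ('a \<Rightarrow> real) \<Rightarrow> real" where
  "signed_integral K \<nu> f = (LINT x|pos_variation K \<nu>. f x) - (LINT x|neg_variation K \<nu>. f x)"

definition total_variation :: "'a::topological_space set \<Rightarrow> ('a set \<Rightarrow> real) \<Rightarrow> ennreal" where
  "total_variation K \<nu> = emeasure (pos_variation K \<nu>) K + emeasure (neg_variation K \<nu>) K"

text \<open>\<open>matrix_integral K R F\<close> is the integral of \<open>F : dR\<close> over \<open>K\<close>.\<close>

definition matrix_integral ::
  "'a::topological_space set \<Rightarrow> ('a set \<Rightarrow> real^'n^'n) \<Rightarrow> ('a \<Rightarrow> real^'n^'n) \<Rightarrow> real" where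
  "matrix_integral K R F =
     (\<Sum>i\<in>UNIV. \<Sum>j\<in>UNIV. signed_integral K (\<lambda>A. R A $ i $ j) (\<lambda>x. F x $ i $ j))"

definition nonneg_measure_on :: "'a::topological_space set \<Rightarrow> 'a measure \<Rightarrow> bool" where
  "nonneg_measure_on K \<mu> \<longleftrightarrow> sets \<mu> = sets (restrict_space borel K) \<and> finite_measure \<mu>"

definition nonneg_sym_matrix_measure_on ::
  "'a::topological_space set \<Rightarrow> ('a set \<Rightarrow> real^'n^'n) \<Rightarrow> bool" where
  "nonneg_sym_matrix_measure_on K R \<longleftrightarrow>
     (\<forall>A :: nat \<Rightarrow> 'a set. range A \<subseteq> sets (restrict_space borel K) \<and> disjoint_family A \<longrightarrow>
        (\<lambda>i. R (A i)) sums R (\<Union>i. A i)) \<and>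
     (\<forall>A\<in>sets (restrict_space borel K). transpose (R A) = R A) \<and>
     (\<forall>\<xi>. \<forall>A\<in>sets (restrict_space borel K). 0 \<le> R A \<bullet> (\<xi> \<otimes>\<^sub>t \<xi>))"

definition Linf_measures ::
  "real \<Rightarrow> 'a::topological_space set \<Rightarrow> (real \<Rightarrow> 'a measure) \<Rightarrow> bool" where
  "Linf_measures T K R \<longleftrightarrow>
     (\<forall>t\<in>{0<..<T}. nonneg_measure_on K (R t)) \<and>
     (\<forall>f. continuous_on K f \<longrightarrow>
        (\<lambda>t. LINT x|R t. (f x :: real)) \<in> borel_measurable (lebesgue_on {0<..<T})) \<and>
     (\<exists>C. AE t in lebesgue_on {0<..<T}. measure (R t) K \<le> C)"

definition Linf_matrix_measures ::
  "real \<Rightarrow> 'a::topological_space set \<Rightarrow> (real \<Rightarrow> 'a set \<Rightarrow> real^'n^'n) \<Rightarrow> bool" where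
  "Linf_matrix_measures T K R \<longleftrightarrow>
     (\<forall>t\<in>{0<..<T}. nonneg_sym_matrix_measure_on K (R t)) \<and>
     (\<forall>F. continuous_on K F \<longrightarrow>
        (\<lambda>t. matrix_integral K (R t) F) \<in> borel_measurable (lebesgue_on {0<..<T})) \<and>
     (\<exists>C::real. AE t in lebesgue_on {0<..<T}.
        \<forall>i j. total_variation K (\<lambda>A. R t A $ i $ j) \<le> ennreal C)"


section \<open>The compressible Euler system\<close>

definition pressure :: "real \<Rightarrow> real \<Rightarrow> real \<Rightarrow> real" where
  "pressure a \<gamma> r = a * r powr \<gamma>"

definition pressure_potential :: "real \<Rightarrow> real \<Rightarrow> real \<Rightarrow> real" where
  "pressure_potential a \<gamma> r = a / (\<gamma> - 1) * r powr \<gamma>"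

text \<open>\<open>kinetic r w\<close> is \<open>|w|\<^sup>2 / r\<close>, for \<open>r \<ge> 0\<close>.\<close>

definition kinetic :: "real \<Rightarrow> real^'n \<Rightarrow> ennreal" where
  "kinetic r w = (if w = 0 then 0 else if r = 0 then \<infinity> else ennreal ((norm w)\<^sup>2 / r))"

definition mean_energy ::
  "real \<Rightarrow> real \<Rightarrow> (real^'n) set \<Rightarrow> (real^'n \<Rightarrow> real) \<Rightarrow> (real^'n \<Rightarrow> real^'n) \<Rightarrow> ennreal" where
  "mean_energy a \<gamma> \<Omega> r w =
     (\<integral>\<^sup>+ x. ennreal (1/2) * kinetic (r x) (w x) + ennreal (pressure_potential a \<gamma> (r x))
        \<partial>lebesgue_on \<Omega>)"

definition continuity_equation_weak ::
  "real \<Rightarrow> (real^'n) set \<Rightarrow> (real^'n \<Rightarrow> real) \<Rightarrow>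
   (real \<Rightarrow> real^'n \<Rightarrow> real) \<Rightarrow> (real \<Rightarrow> real^'n \<Rightarrow> real^'n) \<Rightarrow> bool" where
  "continuity_equation_weak T \<Omega> \<rho>\<^sub>0 \<rho> m \<longleftrightarrow>
     (\<forall>\<tau> \<phi> \<phi>'. 0 < \<tau> \<and> \<tau> < T \<and> C1c_deriv_on ({0..<T} \<times> closure \<Omega>) \<phi> \<phi>' \<longrightarrow>
        (LINT x|lebesgue_on \<Omega>. \<rho> \<tau> x * \<phi> (\<tau>, x)) - (LINT x|lebesgue_on \<Omega>. \<rho>\<^sub>0 x * \<phi> (0, x)) =
        (LINT t|lebesgue_on {0..\<tau>}. LINT x|lebesgue_on \<Omega>.
           \<rho> t x * dt (\<phi>' (t, x)) + m t x \<bullet> grad (\<phi>' (t, x))))"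

text \<open>
  Where \<open>\<rho> = 0\<close>, the term \<open>m \<otimes> m / \<rho>\<close> evaluates to \<open>0\<close>; finiteness of the energy forces \<open>m = 0\<close>
  a.e. on this set.
\<close>

definition momentum_equation_weak ::
  "real \<Rightarrow> real \<Rightarrow> real \<Rightarrow> (real^'n) set \<Rightarrow> (real^'n \<Rightarrow> real^'n) \<Rightarrow>
   (real \<Rightarrow> real^'n \<Rightarrow> real) \<Rightarrow> (real \<Rightarrow> real^'n \<Rightarrow> real^'n) \<Rightarrow>
   (real \<Rightarrow> (real^'n) set \<Rightarrow> real^'n^'n) \<Rightarrow> (real \<Rightarrow> (real^'n) measure) \<Rightarrow> bool" where
  "momentum_equation_weak a \<gamma> T \<Omega> m\<^sub>0 \<rho> m Rv Rp \<longleftrightarrow>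
     (\<forall>\<tau> \<phi> \<phi>'. 0 < \<tau> \<and> \<tau> < T \<and> C1c_deriv_on ({0..<T} \<times> closure \<Omega>) \<phi> \<phi>' \<and>
        (\<forall>t\<in>{0..<T}. \<forall>x\<in>frontier \<Omega>. \<forall>n. outer_normal \<Omega> x n \<longrightarrow> \<phi> (t, x) \<bullet> n = 0) \<longrightarrow>
        (LINT x|lebesgue_on \<Omega>. m \<tau> x \<bullet> \<phi> (\<tau>, x)) - (LINT x|lebesgue_on \<Omega>. m\<^sub>0 x \<bullet> \<phi> (0, x)) =
        (LINT t|lebesgue_on {0..\<tau>}. LINT x|lebesgue_on \<Omega>.
           m t x \<bullet> dt (\<phi>' (t, x)) +
           ((m t x \<otimes>\<^sub>t m t x) /\<^sub>R \<rho> t x) \<bullet> vgrad (\<phi>' (t, x)) +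
           pressure a \<gamma> (\<rho> t x) * vdiv (\<phi>' (t, x))) +
        (LINT t|lebesgue_on {0..\<tau>}.
           matrix_integral (closure \<Omega>) (\<lambda>A. Rv t A + measure (Rp t) A *\<^sub>R mat 1)
             (\<lambda>x. vgrad (\<phi>' (t, x)))))"

definition total_energy ::
  "real \<Rightarrow> real \<Rightarrow> (real^'n) set \<Rightarrow> (real \<Rightarrow> real^'n \<Rightarrow> real) \<Rightarrow> (real \<Rightarrow> real^'n \<Rightarrow> real^'n) \<Rightarrow>
   (real \<Rightarrow> (real^'n) set \<Rightarrow> real^'n^'n) \<Rightarrow> (real \<Rightarrow> (real^'n) measure) \<Rightarrow> real \<Rightarrow> ennreal" where
  "total_energy a \<gamma> \<Omega> \<rho> m Rv Rp t =
     mean_energy a \<gamma> \<Omega> (\<rho> t) (m t) +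
     ennreal (1/2 * trace (Rv t (closure \<Omega>))) +
     ennreal (1 / (\<gamma> - 1) * measure (Rp t) (closure \<Omega>))"

text \<open>\<open>E0\<close> plays the role of the left limit of \<open>E\<close> at time \<open>0\<close>.\<close>

definition energy_inequality :: "real \<Rightarrow> real \<Rightarrow> (real \<Rightarrow> real) \<Rightarrow> bool" where
  "energy_inequality T E0 E \<longleftrightarrow>
     (\<forall>t\<in>{0<..<T}. \<exists>l. (E \<longlongrightarrow> l) (at_left t)) \<and>
     (\<forall>t\<in>{0..<T}. \<exists>l. (E \<longlongrightarrow> l) (at_right t)) \<and>
     (\<forall>\<tau>1 \<tau>2 \<psi> \<psi>'. 0 \<le> \<tau>1 \<and> \<tau>1 \<le> \<tau>2 \<and> \<tau>2 < T \<and>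
        C1c_deriv_on {0..<T} \<psi> \<psi>' \<and> (\<forall>t\<in>{0..<T}. 0 \<le> \<psi> t) \<longrightarrow>
        \<psi> \<tau>2 * Lim (at_right \<tau>2) E - \<psi> \<tau>1 * (if \<tau>1 = 0 then E0 else Lim (at_left \<tau>1) E)
          \<le> (LINT t|lebesgue_on {\<tau>1..\<tau>2}. blinfun_apply (\<psi>' t) 1 * E t))"

text \<open>
  \<open>Rv\<close> and \<open>Rp\<close> are the turbulent defect measures associated with the dissipative solution.
  Initial data are functions up to equality a.e.
\<close>

definition dissipative_solution ::
  "real \<Rightarrow> real \<Rightarrow> real \<Rightarrow> (real^'n) set \<Rightarrow> (real^'n \<Rightarrow> real) \<Rightarrow> (real^'n \<Rightarrow> real^'n) \<Rightarrow>
   (real \<Rightarrow> real^'n \<Rightarrow> real) \<Rightarrow> (real \<Rightarrow> real^'n \<Rightarrow> real^'n) \<Rightarrow>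
   (real \<Rightarrow> (real^'n) set \<Rightarrow> real^'n^'n) \<Rightarrow> (real \<Rightarrow> (real^'n) measure) \<Rightarrow> bool" where
  "dissipative_solution a \<gamma> T \<Omega> \<rho>\<^sub>0 m\<^sub>0 \<rho> m Rv Rp \<longleftrightarrow>
     C_weak_Lp T \<gamma> \<Omega> \<rho> \<and>
     C_weak_Lp T (2 * \<gamma> / (\<gamma> + 1)) \<Omega> m \<and>
     (\<forall>t\<in>{0..T}. AE x in lebesgue_on \<Omega>. 0 \<le> \<rho> t x) \<and>
     (AE x in lebesgue_on \<Omega>. \<rho> 0 x = \<rho>\<^sub>0 x) \<and>
     (AE x in lebesgue_on \<Omega>. m 0 x = m\<^sub>0 x) \<and>
     mean_energy a \<gamma> \<Omega> \<rho>\<^sub>0 m\<^sub>0 < \<infinity> \<and>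
     Linf_matrix_measures T (closure \<Omega>) Rv \<and>
     Linf_measures T (closure \<Omega>) Rp \<and>
     continuity_equation_weak T \<Omega> \<rho>\<^sub>0 \<rho> m \<and>
     momentum_equation_weak a \<gamma> T \<Omega> m\<^sub>0 \<rho> m Rv Rp \<and>
     (\<exists>E. (AE t in lebesgue_on {0<..<T}.
             total_energy a \<gamma> \<Omega> \<rho> m Rv Rp t < \<infinity> \<and>
             E t = enn2real (total_energy a \<gamma> \<Omega> \<rho> m Rv Rp t)) \<and>
          energy_inequality T (enn2real (mean_energy a \<gamma> \<Omega> \<rho>\<^sub>0 m\<^sub>0)) E)"

text \<open>
  All quantities that are differentiated below are differentiable at \<open>(t, x)\<close>, since \<open>\<rho>\<close> and \<open>m\<close>
  are of class \<open>C\<^sup>1\<close> and \<open>\<rho> > 0\<close>. The velocity is \<open>u = m / \<rho>\<close>.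
\<close>

definition classical_solution ::
  "real \<Rightarrow> real \<Rightarrow> real \<Rightarrow> (real^'n) set \<Rightarrow> (real^'n \<Rightarrow> real) \<Rightarrow> (real^'n \<Rightarrow> real^'n) \<Rightarrow>
   (real \<Rightarrow> real^'n \<Rightarrow> real) \<Rightarrow> (real \<Rightarrow> real^'n \<Rightarrow> real^'n) \<Rightarrow> bool" where
  "classical_solution a \<gamma> T \<Omega> \<rho>\<^sub>0 m\<^sub>0 \<rho> m \<longleftrightarrow>
     C1_on ({0..<T} \<times> closure \<Omega>) (\<lambda>(t, x). \<rho> t x) \<and>
     C1_on ({0..<T} \<times> closure \<Omega>) (\<lambda>(t, x). m t x) \<and>
     (\<forall>t\<in>{0..<T}. \<forall>x\<in>closure \<Omega>. 0 < \<rho> t x) \<and>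
     (\<forall>t\<in>{0<..<T}. \<forall>x\<in>\<Omega>.
        dt (frechet_derivative (\<lambda>(s, y). \<rho> s y) (at (t, x))) +
        vdiv (frechet_derivative (\<lambda>(s, y). m s y) (at (t, x))) = 0) \<and>
     (\<forall>t\<in>{0<..<T}. \<forall>x\<in>\<Omega>.
        dt (frechet_derivative (\<lambda>(s, y). m s y) (at (t, x))) +
        mdiv (frechet_derivative (\<lambda>(s, y). (m s y \<otimes>\<^sub>t m s y) /\<^sub>R \<rho> s y) (at (t, x))) +
        grad (frechet_derivative (\<lambda>(s, y). pressure a \<gamma> (\<rho> s y)) (at (t, x))) = 0) \<and>
     (\<forall>t\<in>{0..<T}. \<forall>x\<in>frontier \<Omega>. \<forall>n. outer_normal \<Omega> x n \<longrightarrow> (m t x /\<^sub>R \<rho> t x) \<bullet> n = 0) \<and>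
     (\<forall>x\<in>\<Omega>. \<rho> 0 x = \<rho>\<^sub>0 x) \<and>
     (\<forall>x\<in>\<Omega>. m 0 x = m\<^sub>0 x)"

end

theory Submission
  imports Defs
begin

text \<open>
  A dissipative solution satisfies the Euler equations up to the defect measures, while its total
  energy, which includes the energy of the defect, does not exceed the initial energy. If \<open>\<rho>\<close> and \<open>m\<close> are
  continuously differentiable and \<open>\<rho>\<close> is bounded away from zero, then the velocity \<open>u = m / \<rho>\<close> can be
  used as a test function in the momentum equation. Together with the continuity equation this gives
  an exact balance (lemma \<open>energy_balance\<close>): the mean energy changes only by the work
  \<open>\<integral>\<integral> \<nabla>u : d(Rv + Rp I) dt\<close> of the defect. Since the initial energy has no defect part, the defect
  energy \<open>D \<tau>\<close> is bounded by this work, which in turn is bounded by a constant times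
  \<open>\<integral>\<^sub>0\<^sup>\<tau> D t dt\<close>, because a positive semidefinite matrix is controlled by its trace. Gronwall's
  argument (lemma \<open>gronwall_AE\<close>) gives \<open>D = 0\<close> almost everywhere (lemma \<open>defects_vanish\<close>).
  Without defect, the weak equations can be localised in time by differentiation
  (lemma \<open>weak_identity_differentiated\<close>) and in space by bump functions
  (lemma \<open>weak_divergence_pointwise\<close>), and become the pointwise Euler system.

  The test function \<open>u\<close> is admissible only if \<open>u \<bullet> n = 0\<close> on the boundary. This condition is hidden in
  the weak continuity equation, whose test functions do not vanish on the boundary. At a fixed
  time it reads \<open>\<integral> (\<partial>\<^sub>t \<rho> \<phi> - m \<bullet> \<nabla>\<phi>) = 0\<close> for all \<open>\<phi>\<close> that are smooth up to the boundary
  (lemma \<open>continuity_equation_instant\<close>). If \<open>m \<bullet> n\<close> were nonzero at a boundary point, a test function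
  concentrated at this point would make the integrand one-signed (lemma \<open>normal_trace_zero\<close>). The same
  identity, with \<open>\<phi> = |u|\<^sup>2 / 2 - P(\<rho>) / \<rho>\<close>, performs all integrations by parts in the energy
  balance, so that the divergence theorem on \<open>C\<^sup>1\<close> domains is not invoked.
\<close>

section \<open>Functions of class C1 up to the boundary\<close>

text \<open>
  In finite dimension, continuity of an operator-valued derivative can be tested on each fixed
  direction, so that derivatives may be given as plain functions with explicit formulas.
\<close>

lemma C1_deriv_on_Blinfun:
  fixes f :: "'a::euclidean_space \<Rightarrow> 'b::real_normed_vector"
  assumes D: "\<And>z. z \<in> S \<Longrightarrow> (f has_derivative D z) (at z within S)"
    and c: "\<And>v. continuous_on S (\<lambda>z. D z v)"
  shows "C1_deriv_on S f (\<lambda>z. Blinfun (D z))"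
    and "z \<in> S \<Longrightarrow> blinfun_apply (Blinfun (D z)) = D z"
proof -
  have ap: "blinfun_apply (Blinfun (D z)) = D z" if "z \<in> S" for z
    using D[OF that] by (intro bounded_linear_Blinfun_apply has_derivative_bounded_linear)
  have "continuous_on S (\<lambda>z. Blinfun (D z))"
  proof (rule continuous_on_blinfun_componentwise)
    fix i :: 'a
    show "continuous_on S (\<lambda>z. blinfun_apply (Blinfun (D z)) i)"
      using c[of i] by (rule continuous_on_eq) (simp add: ap)
  qed
  then show "C1_deriv_on S f (\<lambda>z. Blinfun (D z))"
    unfolding C1_deriv_on_def using D ap by simp
  show "z \<in> S \<Longrightarrow> blinfun_apply (Blinfun (D z)) = D z" by (rule ap)
qed

lemma C1_deriv_onD:
  assumes "C1_deriv_on S f f'"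
  shows "z \<in> S \<Longrightarrow> (f has_derivative blinfun_apply (f' z)) (at z within S)"
    and "continuous_on S f'"
    and "continuous_on S f"
proof -
  have 1: "(f has_derivative blinfun_apply (f' z)) (at z within S)" if "z \<in> S" for z
    using assms that unfolding C1_deriv_on_def by blast
  then show "z \<in> S \<Longrightarrow> (f has_derivative blinfun_apply (f' z)) (at z within S)" .
  show "continuous_on S f'"
    using assms unfolding C1_deriv_on_def by blast
  show "continuous_on S f" by (rule has_derivative_continuous_on[OF 1])
qed

lemma C1_deriv_on_bilinear:
  fixes f :: "'a::euclidean_space \<Rightarrow> 'b::real_normed_vector"
  assumes "bounded_bilinear prd"
    and f: "C1_deriv_on S f f'" and g: "C1_deriv_on S g g'"
  shows "\<exists>h'. C1_deriv_on S (\<lambda>z. prd (f z) (g z)) h' \<and>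
     (\<forall>z\<in>S. \<forall>v. h' z v = prd (f z) (g' z v) + prd (f' z v) (g z))"
proof -
  interpret bounded_bilinear prd by fact
  let ?D = "\<lambda>z v. prd (f z) (g' z v) + prd (f' z v) (g z)"
  have 1: "((\<lambda>z. prd (f z) (g z)) has_derivative ?D z) (at z within S)" if "z \<in> S" for z
    by (rule FDERIV[OF C1_deriv_onD(1)[OF f that] C1_deriv_onD(1)[OF g that]])
  have 2: "continuous_on S (\<lambda>z. ?D z v)" for v
    by (rule continuous_on_add; rule continuous_on;
        intro continuous_intros C1_deriv_onD(2,3)[OF f] C1_deriv_onD(2,3)[OF g])
  show ?thesis using C1_deriv_on_Blinfun[of S _ ?D, OF 1 2] by (intro exI[of _ "\<lambda>z. Blinfun (?D z)"]) simp
qed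

lemma C1_deriv_on_add:
  fixes f :: "'a::euclidean_space \<Rightarrow> 'b::real_normed_vector"
  assumes f: "C1_deriv_on S f f'" and g: "C1_deriv_on S g g'"
  shows "C1_deriv_on S (\<lambda>z. f z + g z) (\<lambda>z. f' z + g' z)"
  using f g unfolding C1_deriv_on_def
  by (auto intro!: continuous_intros derivative_eq_intros simp: blinfun.add_left)

lemma C1_deriv_on_compose_real:
  fixes f :: "'a::euclidean_space \<Rightarrow> real" and q q' :: "real \<Rightarrow> real"
  assumes f: "C1_deriv_on S f f'" and q: "\<And>z. z \<in> S \<Longrightarrow> (q has_real_derivative q' (f z)) (at (f z))"
    and q': "continuous_on (f ` S) q'"
  shows "\<exists>h'. C1_deriv_on S (\<lambda>z. q (f z)) h' \<and> (\<forall>z\<in>S. \<forall>v. h' z v = q' (f z) * f' z v)"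
proof -
  let ?D = "\<lambda>z v. q' (f z) * f' z v"
  have 1: "((\<lambda>z. q (f z)) has_derivative ?D z) (at z within S)" if "z \<in> S" for z
    using has_derivative_compose[OF C1_deriv_onD(1)[OF f that] q[OF that, unfolded has_field_derivative_def]]
    by simp
  have 2: "continuous_on S (\<lambda>z. ?D z v)" for v
    by (rule continuous_on_mult, rule continuous_on_compose2[OF q' C1_deriv_onD(3)[OF f]], blast,
        intro continuous_intros C1_deriv_onD(2)[OF f])
  show ?thesis using C1_deriv_on_Blinfun[of S _ ?D, OF 1 2] by (intro exI[of _ "\<lambda>z. Blinfun (?D z)"]) simp
qed

lemma C1_deriv_on_cong:
  assumes "C1_deriv_on S f f'" "\<And>z. z \<in> S \<Longrightarrow> f z = g z"
  shows "C1_deriv_on S g f'"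
  using assms unfolding C1_deriv_on_def
  by (auto intro: has_derivative_transform[rotated 2])

lemma C1_deriv_on_scaleR:
  assumes "C1_deriv_on S f f'"
  shows "C1_deriv_on S (\<lambda>z. c *\<^sub>R f z) (\<lambda>z. c *\<^sub>R f' z)"
  using assms unfolding C1_deriv_on_def
  by (auto intro!: continuous_intros derivative_eq_intros simp: blinfun.scaleR_left)

lemma C1_deriv_on_powr:
  fixes r :: "'a::euclidean_space \<Rightarrow> real"
  assumes r: "C1_deriv_on S r r'" and pos: "\<And>z. z \<in> S \<Longrightarrow> r z > 0"
  shows "\<exists>h'. C1_deriv_on S (\<lambda>z. c * r z powr s) h' \<and>
    (\<forall>z\<in>S. \<forall>v. h' z v = c * (s * r z powr (s - 1)) * r' z v)"
proof (rule C1_deriv_on_compose_real[OF r])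
  show "((\<lambda>x. c * x powr s) has_real_derivative c * (s * r z powr (s - 1))) (at (r z))" if "z \<in> S" for z
    by (intro DERIV_cmult has_real_derivative_powr pos that)
  have "r ` S \<subseteq> {0<..}" using pos by auto
  moreover have "continuous_on {0<..} (\<lambda>x::real. c * (s * x powr (s - 1)))"
    by (intro continuous_intros) auto
  ultimately show "continuous_on (r ` S) (\<lambda>x. c * (s * x powr (s - 1)))"
    by (rule continuous_on_subset[rotated])
qed

lemma C1_deriv_on_space_function:
  fixes \<phi> :: "'a::euclidean_space \<Rightarrow> 'b::real_normed_vector"
  assumes \<phi>: "C1_deriv_on K \<phi> \<phi>'"
  shows "\<exists>\<psi>'. C1_deriv_on (I \<times> K) (\<lambda>z. \<phi> (snd z)) \<psi>' \<and>
    (\<forall>z\<in>I \<times> K. \<forall>v. \<psi>' z v = \<phi>' (snd z) (snd (v :: real \<times> 'a)))"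
proof -
  let ?D = "\<lambda>z v. \<phi>' (snd z) (snd (v :: real \<times> 'a))"
  have 1: "((\<lambda>z. \<phi> (snd z)) has_derivative ?D z) (at z within I \<times> K)" if "z \<in> I \<times> K" for z
  proof (rule has_derivative_in_compose[of snd snd z _ \<phi>])
    show "(snd has_derivative snd) (at z within I \<times> K)"
      by (auto intro!: derivative_eq_intros)
    show "(\<phi> has_derivative blinfun_apply (\<phi>' (snd z))) (at (snd z) within snd ` (I \<times> K))"
      by (rule has_derivative_subset[OF C1_deriv_onD(1)[OF \<phi>]]) (use that in auto)
  qed
  have 2: "continuous_on (I \<times> K) (\<lambda>z. ?D z v)" for v
  proof (rule blinfun.continuous_on)
    show "continuous_on (I \<times> K) (\<lambda>z. \<phi>' (snd z))"
      by (rule continuous_on_compose2[OF C1_deriv_onD(2)[OF \<phi>] continuous_on_snd[OF continuous_on_id]]) auto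
  qed (rule continuous_on_const)
  show ?thesis
    using C1_deriv_on_Blinfun[of "I \<times> K" _ ?D, OF 1 2] by (intro exI[of _ "\<lambda>z. Blinfun (?D z)"]) simp
qed

text \<open>
  The simplest \<open>C\<^sup>1\<close> function that vanishes exactly on a half-line. All cutoffs, bumps and
  boundary test functions below are obtained by composing with it.
\<close>

definition pos_sq :: "real \<Rightarrow> real" where "pos_sq x = (max 0 x)\<^sup>2"

lemma pos_sq_has_derivative:
  "(pos_sq has_real_derivative 2 * max 0 x) (at x)"
proof -
  consider "x < 0" | "x = 0" | "x > 0" by linarith
  then show ?thesis
  proof cases
    case 1
    have "((\<lambda>x. 0) has_real_derivative 2 * max 0 x) (at x)" using 1 by simp
    then show ?thesis
      by (rule has_field_derivative_transform_within_open[of _ _ _ "{..<0}"]) (use 1 in \<open>auto simp: pos_sq_def\<close>)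
  next
    case 2
    have "((\<lambda>h. pos_sq h / h) \<longlongrightarrow> 0) (at 0)"
    proof (rule Lim_null_comparison)
      show "\<forall>\<^sub>F h in at 0. norm (pos_sq h / h) \<le> \<bar>h\<bar>"
        by (auto simp: eventually_at_filter pos_sq_def max_def power2_eq_square)
    qed (auto intro!: tendsto_eq_intros)
    then show ?thesis using 2 by (simp add: DERIV_def pos_sq_def)
  next
    case 3
    have "((\<lambda>x. x\<^sup>2) has_real_derivative 2 * max 0 x) (at x)"
      using 3 by (auto intro!: derivative_eq_intros)
    then show ?thesis
      by (rule has_field_derivative_transform_within_open[of _ _ _ "{0<..}"]) (use 3 in \<open>auto simp: pos_sq_def\<close>)
  qed
qed

lemma pos_sq_nonneg [simp]: "0 \<le> pos_sq x" by (simp add: pos_sq_def)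

text \<open>
  The function is \<open>pos_sq (1 - pos_sq (t - a) / (b - a)\<^sup>2)\<close>: the inner square is \<open>0\<close> before \<open>a\<close> and at
  least \<open>(b - a)\<^sup>2\<close> after \<open>b\<close>.
\<close>

lemma time_cutoff_exists:
  fixes a b :: real
  assumes "a < b"
  obtains \<eta> \<eta>' where "\<And>t. (\<eta> has_real_derivative \<eta>' t) (at t)" "continuous_on UNIV \<eta>'"
    "\<And>t. 0 \<le> \<eta> t" "\<And>t. t \<le> a \<Longrightarrow> \<eta> t = 1 \<and> \<eta>' t = 0" "\<And>t. b \<le> t \<Longrightarrow> \<eta> t = 0"
proof -
  define c where "c = (b - a)\<^sup>2"
  have c: "c > 0" using assms by (simp add: c_def)
  define \<eta> where "\<eta> t = pos_sq (1 - pos_sq (t - a) / c)" for t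
  define \<eta>' where "\<eta>' t = 2 * max 0 (1 - pos_sq (t - a) / c) * (- (2 * max 0 (t - a)) / c)" for t
  have d: "(\<eta> has_real_derivative \<eta>' t) (at t)" for t
  proof -
    have "((\<lambda>t. pos_sq (t - a)) has_real_derivative 2 * max 0 (t - a) * 1) (at t)"
      by (rule DERIV_chain2[OF pos_sq_has_derivative]) (auto intro!: derivative_eq_intros)
    then have "((\<lambda>t. 1 - pos_sq (t - a) / c) has_real_derivative - (2 * max 0 (t - a)) / c) (at t)"
      using c by (auto intro!: derivative_eq_intros)
    then show ?thesis
      unfolding \<eta>_def \<eta>'_def by (rule DERIV_chain2[OF pos_sq_has_derivative])
  qed
  have cp: "continuous_on UNIV pos_sq" unfolding pos_sq_def by (intro continuous_intros)
  have "continuous_on UNIV \<eta>'" unfolding \<eta>'_def pos_sq_def using c by (intro continuous_intros) auto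
  moreover have "\<eta> t = 1 \<and> \<eta>' t = 0" if "t \<le> a" for t
    using that by (simp add: \<eta>_def \<eta>'_def pos_sq_def)
  moreover have "\<eta> t = 0" if "b \<le> t" for t
  proof -
    have "(t - a)\<^sup>2 \<ge> c" unfolding c_def using that assms by (intro power_mono) auto
    then have "1 - pos_sq (t - a) / c \<le> 0" using c that assms by (simp add: pos_sq_def field_simps)
    then show ?thesis by (simp add: \<eta>_def pos_sq_def)
  qed
  ultimately show ?thesis using d that[of \<eta> \<eta>'] by (simp add: \<eta>_def)
qed

text \<open>
  The weak equations up to time \<open>\<tau>\<close> only see the test function on \<open>[0,\<tau>]\<close>. Switching it off
  after \<open>\<tau>\<close> therefore removes the requirement of compact support in \<open>[0,T)\<close>. Multiplication by a
  scalar preserves the condition of vanishing normal component.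
\<close>

lemma C1_time_cutoff:
  fixes \<phi> :: "real \<times> 'a::euclidean_space \<Rightarrow> 'b::real_normed_vector"
  assumes K: "compact K" and \<phi>: "C1_deriv_on ({0..<T} \<times> K) \<phi> \<phi>'" and \<tau>: "0 < \<tau>" "\<tau> < T"
  obtains \<psi> \<psi>' where "C1c_deriv_on ({0..<T} \<times> K) \<psi> \<psi>'"
    "\<And>t x. t \<in> {0..\<tau>} \<Longrightarrow> x \<in> K \<Longrightarrow> \<psi> (t, x) = \<phi> (t, x) \<and> \<psi>' (t, x) = \<phi>' (t, x)"
    "\<And>z. \<exists>c::real. \<psi> z = c *\<^sub>R \<phi> z"
proof -
  let ?S = "{0..<T} \<times> K"
  obtain \<eta> \<eta>' where \<eta>: "\<And>t. (\<eta> has_real_derivative \<eta>' t) (at t)" "continuous_on UNIV \<eta>'"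
    "\<And>t. 0 \<le> \<eta> t" "\<And>t. t \<le> \<tau> \<Longrightarrow> \<eta> t = 1 \<and> \<eta>' t = 0" "\<And>t. (\<tau> + T) / 2 \<le> t \<Longrightarrow> \<eta> t = 0"
    using time_cutoff_exists[of \<tau> "(\<tau> + T) / 2"] \<tau> by auto
  have \<eta>c: "continuous_on UNIV \<eta>" using \<eta>(1) DERIV_continuous_on has_field_derivative_at_within by blast
  let ?\<psi> = "\<lambda>z. \<eta> (fst z) *\<^sub>R \<phi> z"
  let ?D = "\<lambda>z v. \<eta> (fst z) *\<^sub>R \<phi>' z v + (\<eta>' (fst z) * fst v) *\<^sub>R \<phi> z"
  have 1: "(?\<psi> has_derivative ?D z) (at z within ?S)" if "z \<in> ?S" for z
  proof -
    have "((\<lambda>z. \<eta> (fst z)) has_derivative (\<lambda>v. \<eta>' (fst z) * fst v)) (at z within ?S)"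
      by (rule has_derivative_compose[OF _ \<eta>(1)[unfolded has_field_derivative_def]])
        (auto intro!: derivative_eq_intros)
    from has_derivative_scaleR[OF this C1_deriv_onD(1)[OF \<phi> that]]
    show ?thesis .
  qed
  have 2: "continuous_on ?S (\<lambda>z. ?D z v)" for v
    by (intro continuous_on_add continuous_on_scaleR continuous_on_mult
        continuous_on_compose2[OF \<eta>(2)] continuous_on_compose2[OF \<eta>c] continuous_on_fst
        continuous_on_id continuous_on_const blinfun.continuous_on C1_deriv_onD(2,3)[OF \<phi>]) auto
  have C: "C1_deriv_on ?S ?\<psi> (\<lambda>z. Blinfun (?D z))"
    and B: "\<And>z. z \<in> ?S \<Longrightarrow> blinfun_apply (Blinfun (?D z)) = ?D z"
    using C1_deriv_on_Blinfun[of ?S ?\<psi> ?D] 1 2 by auto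
  show ?thesis
  proof (rule that)
    show "C1c_deriv_on ?S ?\<psi> (\<lambda>z. Blinfun (?D z))"
      unfolding C1c_deriv_on_def
    proof (intro conjI C exI[of _ "{0..(\<tau> + T) / 2} \<times> K"])
      show "compact ({0..(\<tau> + T) / 2} \<times> K)" using K by (intro compact_Times) auto
      show "\<forall>z\<in>?S - {0..(\<tau> + T) / 2} \<times> K. \<eta> (fst z) *\<^sub>R \<phi> z = 0"
        by (auto intro!: \<eta>(5))
    qed (use \<tau> in auto)
    fix t x assume tx: "t \<in> {0..\<tau>}" "x \<in> K"
    then have "(t, x) \<in> ?S" using \<tau> by auto
    then have "blinfun_apply (Blinfun (?D (t, x))) = blinfun_apply (\<phi>' (t, x))"
      using B[of "(t, x)"] \<eta>(4)[of t] tx by simp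
    then show "?\<psi> (t, x) = \<phi> (t, x) \<and> Blinfun (?D (t, x)) = \<phi>' (t, x)"
      using \<eta>(4)[of t] tx by (simp add: blinfun_apply_inject)
  qed blast
qed

section \<open>Integrals depending on time\<close>

lemma bounded_on_compact:
  fixes f :: "'a::topological_space \<Rightarrow> 'b::real_normed_vector"
  assumes "compact K" "continuous_on K f"
  obtains B where "B > 0" "\<And>x. x \<in> K \<Longrightarrow> norm (f x) \<le> B"
  using compact_imp_bounded[OF compact_continuous_image[OF assms(2,1)]]
  by (auto simp: bounded_pos)

lemma integrable_up_to_boundary:
  fixes f :: "'a::euclidean_space \<Rightarrow> 'b::euclidean_space"
  assumes "open \<Omega>" "bounded \<Omega>" "continuous_on (closure \<Omega>) f"
  shows "integrable (lebesgue_on \<Omega>) f"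
proof -
  interpret finite_measure "lebesgue_on \<Omega>"
    using assms by (intro finite_measure_lebesgue_on lmeasurable_open)
  obtain B where "\<And>x. x \<in> closure \<Omega> \<Longrightarrow> norm (f x) \<le> B"
    using bounded_on_compact[of "closure \<Omega>" f] assms by (auto simp: compact_closure)
  then have "AE x in lebesgue_on \<Omega>. norm (f x) \<le> B"
    using closure_subset by (intro AE_I2) (auto simp: space_restrict_space)
  moreover have "f \<in> borel_measurable (lebesgue_on \<Omega>)"
    using assms closure_subset
    by (intro continuous_imp_measurable_on_sets_lebesgue continuous_on_subset[OF assms(3)]) auto
  ultimately show ?thesis by (rule integrable_const_bound)
qed

lemma continuous_on_slice:
  assumes "continuous_on (I \<times> K) f" "t \<in> I"
  shows "continuous_on K (\<lambda>x. f (t, x))"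
  by (rule continuous_on_compose2[OF assms(1)]) (auto intro!: continuous_intros simp: assms(2))

lemma integrable_slice:
  fixes f :: "real \<times> 'a::euclidean_space \<Rightarrow> 'b::euclidean_space"
  assumes "open \<Omega>" "bounded \<Omega>" "continuous_on (I \<times> closure \<Omega>) f" "t \<in> I"
  shows "integrable (lebesgue_on \<Omega>) (\<lambda>x. f (t, x))"
  by (rule integrable_up_to_boundary[OF assms(1,2) continuous_on_slice[OF assms(3,4)]])

text \<open>
  Dominated convergence along a convergent sequence of times: together with its limit the
  sequence is compact, which gives a uniform bound for \<open>f\<close>.
\<close>

lemma continuous_on_parameter_integral:
  fixes f :: "real \<times> 'a::euclidean_space \<Rightarrow> 'b::euclidean_space"
  assumes \<Omega>: "open \<Omega>" "bounded \<Omega>" and f: "continuous_on (I \<times> closure \<Omega>) f"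
  shows "continuous_on I (\<lambda>t. LINT x|lebesgue_on \<Omega>. f (t, x))"
  unfolding continuous_on_sequentially
proof (intro allI impI ballI, elim conjE)
  fix X t assume t: "t \<in> I" and X: "\<forall>n. X n \<in> I" "X \<longlonglongrightarrow> t"
  interpret finite_measure "lebesgue_on \<Omega>"
    using \<Omega> by (intro finite_measure_lebesgue_on lmeasurable_open)
  have "compact (insert t (range X) \<times> closure \<Omega>)"
    using \<Omega> compact_sequence_with_limit[OF X(2)] by (intro compact_Times) (auto simp: compact_closure)
  moreover have "continuous_on (insert t (range X) \<times> closure \<Omega>) f"
    using X t by (intro continuous_on_subset[OF f]) auto
  ultimately obtain B where B: "\<And>z. z \<in> insert t (range X) \<times> closure \<Omega> \<Longrightarrow> norm (f z) \<le> B"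
    by (rule bounded_on_compact) blast
  have sp: "x \<in> closure \<Omega>" if "x \<in> space (lebesgue_on \<Omega>)" for x
    using that closure_subset by (auto simp: space_restrict_space)
  have "(\<lambda>n. LINT x|lebesgue_on \<Omega>. f (X n, x)) \<longlonglongrightarrow> (LINT x|lebesgue_on \<Omega>. f (t, x))"
  proof (rule integral_dominated_convergence[where w = "\<lambda>_. B"])
    show "AE x in lebesgue_on \<Omega>. (\<lambda>n. f (X n, x)) \<longlonglongrightarrow> f (t, x)"
    proof (rule AE_I2)
      fix x assume "x \<in> space (lebesgue_on \<Omega>)"
      then have x: "x \<in> closure \<Omega>" by (rule sp)
      have "continuous_on I (\<lambda>s. f (s, x))"
        by (rule continuous_on_compose2[OF f]) (auto intro!: continuous_intros simp: x)
      then show "(\<lambda>n. f (X n, x)) \<longlonglongrightarrow> f (t, x)"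
        using X t unfolding continuous_on_sequentially comp_def by blast
    qed
    show "AE x in lebesgue_on \<Omega>. norm (f (X n, x)) \<le> B" for n
      using B sp by (intro AE_I2) auto
  qed (use X t in \<open>auto intro!: borel_measurable_integrable integrable_slice[OF \<Omega> f]\<close>)
  then show "((\<lambda>t. LINT x|lebesgue_on \<Omega>. f (t, x)) \<circ> X) \<longlonglongrightarrow> (LINT x|lebesgue_on \<Omega>. f (t, x))"
    by (simp add: comp_def)
qed

lemma C1_deriv_on_time_derivative:
  fixes f :: "real \<times> 'a::euclidean_space \<Rightarrow> real"
  assumes "C1_deriv_on (I \<times> K) f f'" "t \<in> I" "x \<in> K"
  shows "((\<lambda>s. f (s, x)) has_real_derivative f' (t, x) (1, 0)) (at t within I)"
proof -
  have "((\<lambda>s. (s, x)) has_derivative (\<lambda>h. (h, 0))) (at t within I)"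
    by (auto intro!: derivative_eq_intros)
  moreover have "(f has_derivative f' (t, x)) (at (t, x) within (\<lambda>s. (s, x)) ` I)"
    using assms by (intro has_derivative_subset[OF C1_deriv_onD(1)[OF assms(1)]]) auto
  ultimately have "((\<lambda>s. f (s, x)) has_derivative (\<lambda>h. f' (t, x) (h, 0))) (at t within I)"
    by (rule has_derivative_in_compose)
  moreover have "(\<lambda>h. blinfun_apply (f' (t, x)) (h, 0)) = (*) (f' (t, x) (1, 0))"
  proof
    fix h show "blinfun_apply (f' (t, x)) (h, 0) = f' (t, x) (1, 0) * h"
      using blinfun.scaleR_right[of "f' (t, x)" h "(1, 0)"] by simp
  qed
  ultimately show ?thesis unfolding has_field_derivative_def by simp
qed

text \<open>
  Differentiation under the integral sign. On a compact time interval around \<open>t\<close> the difference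
  quotients are bounded by the supremum of \<open>\<partial>\<^sub>t f\<close>, by the mean value theorem.
\<close>

lemma integral_has_time_derivative:
  fixes f :: "real \<times> 'a::euclidean_space \<Rightarrow> real"
  assumes \<Omega>: "open \<Omega>" "bounded \<Omega>" and f: "C1_deriv_on ({0..<T} \<times> closure \<Omega>) f f'"
    and t: "0 < t" "t < T"
  shows "((\<lambda>s. LINT x|lebesgue_on \<Omega>. f (s, x)) has_real_derivative
           (LINT x|lebesgue_on \<Omega>. f' (t, x) (1, 0))) (at t)"
proof -
  define a b where "a = t / 2" and "b = (t + T) / 2"
  have ab: "0 < a" "a < t" "t < b" "b < T" using t by (auto simp: a_def b_def)
  interpret finite_measure "lebesgue_on \<Omega>"
    using \<Omega> by (intro finite_measure_lebesgue_on lmeasurable_open)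
  let ?F = "\<lambda>s. LINT x|lebesgue_on \<Omega>. f (s, x)"
  let ?D = "LINT x|lebesgue_on \<Omega>. f' (t, x) (1, 0)"
  have atab: "at t within {a..b} = at t" using ab by (intro at_within_interior) auto
  have f'c: "continuous_on ({0..<T} \<times> closure \<Omega>) (\<lambda>z. f' z (1, 0))"
    by (intro continuous_intros C1_deriv_onD(2)[OF f])
  have "compact ({a..b} \<times> closure \<Omega>)"
    using \<Omega> by (intro compact_Times) (auto simp: compact_closure)
  moreover have "continuous_on ({a..b} \<times> closure \<Omega>) (\<lambda>z. f' z (1, 0))"
    using ab by (intro continuous_on_subset[OF f'c]) auto
  ultimately obtain B where B: "\<And>z. z \<in> {a..b} \<times> closure \<Omega> \<Longrightarrow> norm (f' z (1, 0)) \<le> B"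
    by (rule bounded_on_compact) blast
  have pd: "((\<lambda>s. f (s, x)) has_real_derivative f' (s, x) (1, 0)) (at s within {a..b})"
    if "s \<in> {a..b}" "x \<in> closure \<Omega>" for s x
    by (rule has_field_derivative_subset[OF C1_deriv_on_time_derivative[OF f, of s x]]) (use that ab in auto)
  have sp: "x \<in> closure \<Omega>" if "x \<in> space (lebesgue_on \<Omega>)" for x
    using that closure_subset by (auto simp: space_restrict_space)
  have "((\<lambda>s. (?F s - ?F t) / (s - t)) \<longlongrightarrow> ?D) (at t within {a..b})"
    unfolding tendsto_at_iff_sequentially
  proof (intro allI impI)
    fix X assume X: "\<forall>i. X i \<in> {a..b} - {t}" "X \<longlonglongrightarrow> t"
    have int: "integrable (lebesgue_on \<Omega>) (\<lambda>x. f (s, x))" if "s \<in> {a..b}" for s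
      by (rule integrable_slice[OF \<Omega> C1_deriv_onD(3)[OF f]]) (use ab that in auto)
    have "(\<lambda>i. LINT x|lebesgue_on \<Omega>. (f (X i, x) - f (t, x)) / (X i - t)) \<longlonglongrightarrow> ?D"
    proof (rule integral_dominated_convergence[where w = "\<lambda>_. B"])
      show "(\<lambda>x. f' (t, x) (1, 0)) \<in> borel_measurable (lebesgue_on \<Omega>)"
        using t by (intro borel_measurable_integrable integrable_slice[OF \<Omega> f'c]) auto
      show "(\<lambda>x. (f (X i, x) - f (t, x)) / (X i - t)) \<in> borel_measurable (lebesgue_on \<Omega>)" for i
        using X ab by (intro borel_measurable_integrable integrable_divide_zero
            Bochner_Integration.integrable_diff int) auto
      show "AE x in lebesgue_on \<Omega>. (\<lambda>i. (f (X i, x) - f (t, x)) / (X i - t)) \<longlonglongrightarrow> f' (t, x) (1, 0)"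
      proof (rule AE_I2)
        fix x assume "x \<in> space (lebesgue_on \<Omega>)"
        then have "((\<lambda>s. (f (s, x) - f (t, x)) / (s - t)) \<longlongrightarrow> f' (t, x) (1, 0)) (at t within {a..b})"
          using pd[of t x] sp ab by (simp add: has_field_derivative_iff)
        then show "(\<lambda>i. (f (X i, x) - f (t, x)) / (X i - t)) \<longlonglongrightarrow> f' (t, x) (1, 0)"
          using X unfolding tendsto_at_iff_sequentially comp_def by blast
      qed
      show "AE x in lebesgue_on \<Omega>. norm ((f (X i, x) - f (t, x)) / (X i - t)) \<le> B" for i
      proof (rule AE_I2)
        fix x assume "x \<in> space (lebesgue_on \<Omega>)"
        then have x: "x \<in> closure \<Omega>" by (rule sp)
        have "norm (f (X i, x) - f (t, x)) \<le> B * norm (X i - t)"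
        proof (rule field_differentiable_bound[of "{a..b}" "\<lambda>s. f (s, x)" "\<lambda>s. f' (s, x) (1, 0)"])
          show "norm (blinfun_apply (f' (s, x)) (1, 0)) \<le> B" if "s \<in> {a..b}" for s
            using B[of "(s, x)"] that x by simp
        qed (use X ab pd x in auto)
        moreover have "X i \<noteq> t" using X by auto
        ultimately show "norm ((f (X i, x) - f (t, x)) / (X i - t)) \<le> B"
          by (simp add: field_simps)
      qed
    qed simp
    moreover have "(LINT x|lebesgue_on \<Omega>. (f (X i, x) - f (t, x)) / (X i - t)) = (?F (X i) - ?F t) / (X i - t)" for i
      using X ab by (subst integral_divide_zero, subst Bochner_Integration.integral_diff) (auto intro!: int)
    ultimately show "((\<lambda>s. (?F s - ?F t) / (s - t)) \<circ> X) \<longlonglongrightarrow> ?D"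
      unfolding comp_def by (simp only:)
  qed
  then show ?thesis unfolding atab has_field_derivative_iff .
qed

lemma LINT_eq_integral_interval:
  fixes G :: "real \<Rightarrow> real"
  assumes "continuous_on {a..b} G"
  shows "(LINT t|lebesgue_on {a..b}. G t) = integral {a..b} G"
  using assms by (intro lebesgue_integral_eq_integral continuous_imp_integrable_real) auto

lemma LINT_has_upper_limit_derivative:
  fixes G :: "real \<Rightarrow> real"
  assumes G: "continuous_on {0..<T} G" and \<tau>: "0 < \<tau>" "\<tau> < T"
  shows "((\<lambda>s. LINT t|lebesgue_on {0..s}. G t) has_real_derivative G \<tau>) (at \<tau>)"
proof -
  define b where "b = (\<tau> + T) / 2"
  have b: "\<tau> < b" "b < T" using \<tau> by (auto simp: b_def)
  have c: "continuous_on {0..s} G" if "s \<le> b" for s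
    using that b by (intro continuous_on_subset[OF G]) auto
  have "((\<lambda>s. integral {0..s} G) has_real_derivative G \<tau>) (at \<tau> within {0..b})"
    using b \<tau> by (intro integral_has_real_derivative c) auto
  moreover have "at \<tau> within {0..b} = at \<tau>" using \<tau> b by (intro at_within_interior) auto
  ultimately have "((\<lambda>s. integral {0..s} G) has_real_derivative G \<tau>) (at \<tau>)" by simp
  then show ?thesis
    by (rule has_field_derivative_transform_within_open[of _ _ _ "{0<..<b}"])
      (use \<tau> b in \<open>auto simp: LINT_eq_integral_interval c\<close>)
qed

section \<open>Integration by parts for compactly supported functions\<close>

text \<open>
  The fundamental lemma of the calculus of variations in the form used below: where the
  integrand of a vanishing integral has a sign, it vanishes pointwise.
\<close>

lemma continuous_nonneg_integral_0:
  fixes f :: "'a::euclidean_space \<Rightarrow> real"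
  assumes \<Omega>: "open \<Omega>" and f: "continuous_on \<Omega> f" "integrable (lebesgue_on \<Omega>) f"
    and nn: "\<And>x. x \<in> \<Omega> \<Longrightarrow> 0 \<le> f x" and 0: "(LINT x|lebesgue_on \<Omega>. f x) = 0"
    and x: "x \<in> \<Omega>"
  shows "f x = 0"
proof (rule ccontr)
  assume nz: "f x \<noteq> 0"
  have "AE x in lebesgue_on \<Omega>. f x = 0"
    using 0 by (subst (asm) integral_nonneg_eq_0_iff_AE[OF f(2)]) (auto simp: space_restrict_space nn)
  then have "AE x in lebesgue. x \<in> \<Omega> \<longrightarrow> f x = 0"
    using \<Omega> by (subst (asm) AE_restrict_space_iff) auto
  then obtain N where N: "{x. \<not> (x \<in> \<Omega> \<longrightarrow> f x = 0)} \<subseteq> N" "N \<in> null_sets lebesgue"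
    unfolding eventually_ae_filter by auto
  let ?U = "\<Omega> \<inter> f -` (- {0})"
  have "negligible ?U"
  proof (rule negligible_subset)
    show "negligible N" using N(2) by (simp add: negligible_iff_null_sets)
    show "?U \<subseteq> N" by (rule subset_trans[OF _ N(1)]) auto
  qed
  moreover have "open ?U"
    using continuous_open_preimage[OF f(1) \<Omega>, of "- {0}"] by (auto simp: open_closed)
  moreover have "x \<in> ?U" using x nz by auto
  ultimately show False using open_not_negligible by blast
qed

text \<open>
  The integral of \<open>h (x + s v) - h x\<close> is zero by translation invariance of Lebesgue
  measure; divide by \<open>s\<close> and let \<open>s\<close> tend to \<open>0\<close>.
\<close>

lemma integral_derivative_compact_support:
  fixes h :: "'a::euclidean_space \<Rightarrow> real"
  assumes h: "\<And>x. (h has_derivative h' x) (at x)" and c: "continuous_on UNIV (\<lambda>x. h' x v)"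
    and supp: "\<And>x. x \<notin> cball p r \<Longrightarrow> h x = 0"
  shows "(LINT x|lborel. h' x v) = 0"
proof -
  have hc: "continuous_on UNIV h" by (rule has_derivative_continuous_on[OF h])
  have hm: "h \<in> borel_measurable borel" by (rule borel_measurable_continuous_onI[OF hc])
  have h'm: "(\<lambda>x. h' x v) \<in> borel_measurable borel" by (rule borel_measurable_continuous_onI[OF c])
  have h'0: "h' x v = 0" if "x \<notin> cball p r" for x
  proof -
    have "((\<lambda>x. 0) has_derivative (\<lambda>_. 0)) (at x)" by simp
    then have "(h has_derivative (\<lambda>_. 0)) (at x)"
      by (rule has_derivative_transform_within_open[of _ _ _ _ "- cball p r"]) (use that supp in auto)
    from has_derivative_unique[OF h this] show ?thesis by simp
  qed
  obtain B where B: "B > 0" "\<And>x. x \<in> cball p r \<Longrightarrow> norm (h' x v) \<le> B"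
    using bounded_on_compact[of "cball p r" "\<lambda>x. h' x v"] continuous_on_subset[OF c] by auto
  have B': "norm (h' x v) \<le> B" for x
    using B h'0[of x] by (cases "x \<in> cball p r") auto
  have ih: "integrable lborel h"
  proof -
    have "integrable lborel (\<lambda>x. indicator (cball p r) x *\<^sub>R h x)"
      by (rule borel_integrable_compact[OF compact_cball continuous_on_subset[OF hc]]) simp
    moreover have "(\<lambda>x. indicator (cball p r) x *\<^sub>R h x) = h"
      using supp by (auto simp: indicator_def fun_eq_iff)
    ultimately show ?thesis by simp
  qed
  have ihs: "integrable lborel (\<lambda>x. h (w + x))" and Lhs: "(LINT x|lborel. h (w + x)) = (LINT x|lborel. h x)" for w
  proof -
    have "integrable (distr lborel borel ((+) w)) h" using ih by (simp add: lborel_distr_plus)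
    then show "integrable lborel (\<lambda>x. h (w + x))"
      by (subst (asm) integrable_distr_eq) (use hm in auto)
    have "(LINT x|lborel. h x) = (LINT x|distr lborel borel ((+) w). h x)" by (simp add: lborel_distr_plus)
    also have "\<dots> = (LINT x|lborel. h (w + x))" by (rule integral_distr) (use hm in auto)
    finally show "(LINT x|lborel. h (w + x)) = (LINT x|lborel. h x)" by simp
  qed
  define s :: "nat \<Rightarrow> real" where "s n = 1 / real (Suc n)" for n
  have s: "s n > 0" "s n \<le> 1" for n by (auto simp: s_def)
  have s0: "s \<longlonglongrightarrow> 0" unfolding s_def by (rule LIMSEQ_Suc[OF lim_1_over_n])
  have line: "((\<lambda>\<sigma>. h (\<sigma> *\<^sub>R v + x)) has_real_derivative h' (\<sigma> *\<^sub>R v + x) v) (at \<sigma>)" for \<sigma> x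
  proof -
    have "((\<lambda>\<sigma>. \<sigma> *\<^sub>R v + x) has_derivative (\<lambda>k. k *\<^sub>R v)) (at \<sigma>)"
      by (auto intro!: derivative_eq_intros)
    from has_derivative_compose[OF this h]
    have "((\<lambda>\<sigma>. h (\<sigma> *\<^sub>R v + x)) has_derivative (\<lambda>k. h' (\<sigma> *\<^sub>R v + x) (k *\<^sub>R v))) (at \<sigma>)" .
    moreover have "(\<lambda>k. h' y (k *\<^sub>R v)) = (*) (h' y v)" for y
      using linear_cmul[OF has_derivative_linear[OF h[of y]]] by (simp add: fun_eq_iff)
    ultimately show ?thesis unfolding has_field_derivative_def by simp
  qed
  have "(\<lambda>n. LINT x|lborel. (h (s n *\<^sub>R v + x) - h x) / s n) \<longlonglongrightarrow> (LINT x|lborel. h' x v)"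
  proof (rule integral_dominated_convergence[where w = "\<lambda>x. indicator (cball p (r + norm v)) x *\<^sub>R B"])
    show "integrable lborel (\<lambda>x. indicator (cball p (r + norm v)) x *\<^sub>R B)"
      by (rule borel_integrable_compact) auto
    show "AE x in lborel. (\<lambda>n. (h (s n *\<^sub>R v + x) - h x) / s n) \<longlonglongrightarrow> h' x v"
    proof (rule AE_I2)
      fix x
      have "((\<lambda>k. (h (k *\<^sub>R v + x) - h x) / k) \<longlongrightarrow> h' x v) (at 0)"
        using line[of x 0] by (simp add: has_field_derivative_iff)
      moreover have "\<forall>i. s i \<in> UNIV - {0}" using s by (simp add: less_imp_neq[symmetric])
      ultimately show "(\<lambda>n. (h (s n *\<^sub>R v + x) - h x) / s n) \<longlonglongrightarrow> h' x v"
        using s0 unfolding tendsto_at_iff_sequentially comp_def by blast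
    qed
    show "AE x in lborel. norm ((h (s n *\<^sub>R v + x) - h x) / s n) \<le> indicator (cball p (r + norm v)) x *\<^sub>R B" for n
    proof (rule AE_I2)
      fix x
      show "norm ((h (s n *\<^sub>R v + x) - h x) / s n) \<le> indicator (cball p (r + norm v)) x *\<^sub>R B"
      proof (cases "x \<in> cball p (r + norm v)")
        case True
        obtain z where "h (s n *\<^sub>R v + x) - h (0 *\<^sub>R v + x) = (s n - 0) * h' (z *\<^sub>R v + x) v"
          using MVT2[of 0 "s n" "\<lambda>\<sigma>. h (\<sigma> *\<^sub>R v + x)" "\<lambda>\<sigma>. h' (\<sigma> *\<^sub>R v + x) v"] s line by blast
        then have "(h (s n *\<^sub>R v + x) - h x) / s n = h' (z *\<^sub>R v + x) v" using s(1)[of n] by simp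
        then show ?thesis using B' True by simp
      next
        case False
        then have far: "dist p x > r + norm v" by simp
        have "norm (s n *\<^sub>R v) \<le> norm v" using s[of n] by (simp add: mult_left_le_one_le)
        moreover have "dist p x \<le> dist p (s n *\<^sub>R v + x) + dist (s n *\<^sub>R v + x) x" by (rule dist_triangle)
        ultimately have "dist p (s n *\<^sub>R v + x) > r" using far by (simp add: dist_norm)
        moreover have "dist p x > r" using far norm_ge_zero[of v] by linarith
        ultimately show ?thesis using supp[of x] supp[of "s n *\<^sub>R v + x"] False by simp
      qed
    qed
  qed (use hm h'm in auto)
  moreover have "(LINT x|lborel. (h (s n *\<^sub>R v + x) - h x) / s n) = 0" for n
    by (subst integral_divide_zero, subst Bochner_Integration.integral_diff) (auto simp: ih ihs Lhs)
  ultimately have "(\<lambda>n. 0) \<longlonglongrightarrow> (LINT x|lborel. h' x v)" by (simp only:)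
  then show ?thesis by (simp add: LIMSEQ_const_iff)
qed

lemma linear_vec_expansion:
  fixes f :: "real^'n \<Rightarrow> 'b::real_vector"
  assumes "linear f"
  shows "f w = (\<Sum>i\<in>UNIV. w $ i *\<^sub>R f (axis i 1))"
proof -
  have "f w = f (\<Sum>i\<in>UNIV. w $ i *\<^sub>R axis i 1)"
    using basis_expansion[of w] by (simp add: scalar_mult_eq_scaleR)
  also have "\<dots> = (\<Sum>i\<in>UNIV. w $ i *\<^sub>R f (axis i 1))"
    by (simp add: linear_sum[OF assms] linear_scale[OF assms])
  finally show ?thesis .
qed

lemma linear_spatial:
  assumes "bounded_linear L"
  shows "linear (\<lambda>w. L (0 :: real, w))"
proof -
  interpret bounded_linear L by fact
  show ?thesis
  proof
    show "L (0, v + w) = L (0, v) + L (0, w)" for v w using add[of "(0, v)" "(0, w)"] by simp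
    show "L (0, r *\<^sub>R v) = r *\<^sub>R L (0, v)" for r v using scaleR[of r "(0, v)"] by simp
  qed
qed

lemma inner_grad:
  fixes L :: "real \<times> (real^'n) \<Rightarrow> real"
  assumes "bounded_linear L"
  shows "w \<bullet> grad L = L (0, w)"
  using linear_vec_expansion[OF linear_spatial[OF assms], of w]
  by (simp add: inner_vec_def grad_def)

text \<open>
  Extension by zero moves integrals over \<open>\<Omega>\<close> to the whole space.
\<close>

lemma integral_compact_support:
  fixes k :: "'a::euclidean_space \<Rightarrow> real"
  assumes \<Omega>: "open \<Omega>" and k: "continuous_on \<Omega> k" and sub: "cball p r \<subseteq> \<Omega>"
    and supp: "\<And>x. x \<in> \<Omega> \<Longrightarrow> x \<notin> cball p r \<Longrightarrow> k x = 0"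
  shows "integrable lborel (\<lambda>x. if x \<in> \<Omega> then k x else 0)"
    and "integrable (lebesgue_on \<Omega>) k"
    and "(LINT x|lebesgue_on \<Omega>. k x) = (LINT x|lborel. (if x \<in> \<Omega> then k x else 0))"
proof -
  let ?k = "\<lambda>x. if x \<in> \<Omega> then k x else 0"
  have "integrable lborel (\<lambda>x. indicator (cball p r) x *\<^sub>R k x)"
    by (rule borel_integrable_compact[OF compact_cball continuous_on_subset[OF k sub]])
  moreover have "(\<lambda>x. indicator (cball p r) x *\<^sub>R k x) = ?k"
    using sub supp by (auto simp: indicator_def fun_eq_iff)
  ultimately show 1: "integrable lborel ?k" by simp
  have ind: "(\<lambda>x. indicator \<Omega> x *\<^sub>R k x) = ?k" by (auto simp: indicator_def)
  show "integrable (lebesgue_on \<Omega>) k"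
  proof (subst integrable_restrict_space)
    show "integrable lebesgue (\<lambda>x. indicator \<Omega> x *\<^sub>R k x)"
      unfolding ind using 1 by (subst integrable_completion) auto
  qed (use \<Omega> in auto)
  have "(LINT x|lebesgue_on \<Omega>. k x) = (LINT x|lebesgue. ?k x)"
    using \<Omega> unfolding ind[symmetric] by (intro integral_restrict_space) auto
  also have "\<dots> = (LINT x|lborel. ?k x)"
    using 1 by (intro integral_completion) auto
  finally show "(LINT x|lebesgue_on \<Omega>. k x) = (LINT x|lborel. ?k x)" .
qed

definition bump :: "'a::real_inner \<Rightarrow> real \<Rightarrow> 'a \<Rightarrow> real" where
  "bump p r x = pos_sq (r\<^sup>2 - (x - p) \<bullet> (x - p))"

definition bump_deriv :: "'a::real_inner \<Rightarrow> real \<Rightarrow> 'a \<Rightarrow> 'a \<Rightarrow> real" where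
  "bump_deriv p r x v = 2 * max 0 (r\<^sup>2 - (x - p) \<bullet> (x - p)) * (- (2 * ((x - p) \<bullet> v)))"

lemma bump_has_derivative: "(bump p r has_derivative bump_deriv p r x) (at x)"
proof -
  have "((\<lambda>x. r\<^sup>2 - (x - p) \<bullet> (x - p)) has_derivative (\<lambda>v. - (2 * ((x - p) \<bullet> v)))) (at x)"
    by (auto intro!: derivative_eq_intros simp: inner_commute)
  from has_derivative_compose[OF this pos_sq_has_derivative[unfolded has_field_derivative_def]]
  show ?thesis by (simp add: bump_def[abs_def] bump_deriv_def[abs_def])
qed

lemma continuous_on_bump_deriv:
  "continuous_on S F \<Longrightarrow> continuous_on S (\<lambda>x. bump_deriv p r x (F x))"
  unfolding bump_deriv_def by (intro continuous_intros)

lemma bump_nonneg: "0 \<le> bump p r x"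
  by (simp add: bump_def)

lemma bump_outside:
  assumes "x \<notin> cball p r" "r > 0"
  shows "bump p r x = 0" "bump_deriv p r x v = 0"
proof -
  have "r\<^sup>2 \<le> (norm (x - p))\<^sup>2" using assms by (intro power_mono) (auto simp: dist_norm norm_minus_commute)
  then have "r\<^sup>2 - (x - p) \<bullet> (x - p) \<le> 0" by (simp add: power2_norm_eq_inner)
  then show "bump p r x = 0" "bump_deriv p r x v = 0" by (simp_all add: bump_def bump_deriv_def pos_sq_def)
qed

text \<open>
  If \<open>g + div F\<close> were nonzero at \<open>p\<close>, it would keep its sign on a small ball around \<open>p\<close>.
  Integrating the partial derivatives of the components of \<open>bump \<cdot> F\<close> turns the hypothesis into
  \<open>\<integral> bump \<cdot> (g + div F) = 0\<close> for the bump supported in this ball, a contradiction.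
\<close>

lemma weak_divergence_pointwise:
  fixes F :: "real^'n \<Rightarrow> real^'n" and g :: "real^'n \<Rightarrow> real"
  assumes \<Omega>: "open \<Omega>" and p: "p \<in> \<Omega>" and g: "continuous_on \<Omega> g"
    and F: "\<And>x. x \<in> \<Omega> \<Longrightarrow> (F has_derivative F' x) (at x)"
    and F': "\<And>v. continuous_on \<Omega> (\<lambda>x. F' x v)"
    and weak: "\<And>r. r > 0 \<Longrightarrow> cball p r \<subseteq> \<Omega> \<Longrightarrow>
      (LINT x|lebesgue_on \<Omega>. g x * bump p r x) = (LINT x|lebesgue_on \<Omega>. bump_deriv p r x (F x))"
  shows "g p + (\<Sum>j\<in>UNIV. F' p (axis j 1) $ j) = 0"
proof (rule ccontr)
  define G where "G x = g x + (\<Sum>j\<in>UNIV. F' x (axis j 1) $ j)" for x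
  assume "g p + (\<Sum>j\<in>UNIV. F' p (axis j 1) $ j) \<noteq> 0"
  then have Gp: "sgn (G p) * G p > 0" by (simp add: G_def sgn_if)
  have Fc: "continuous_on \<Omega> F"
    by (rule has_derivative_continuous_on[OF has_derivative_at_withinI[OF F]])
  have Gc: "continuous_on \<Omega> G" unfolding G_def by (intro continuous_intros g F')
  have sGc: "continuous_on \<Omega> (\<lambda>x. sgn (G p) * G x)" by (intro continuous_intros Gc)
  have "open (\<Omega> \<inter> (\<lambda>x. sgn (G p) * G x) -` {0<..})"
    by (rule continuous_open_preimage[OF sGc \<Omega>]) simp
  then obtain r where r: "r > 0" and rsub: "cball p r \<subseteq> \<Omega> \<inter> (\<lambda>x. sgn (G p) * G x) -` {0<..}"
    unfolding open_contains_cball using p Gp by (meson IntI greaterThan_iff vimageI)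
  have sub: "cball p r \<subseteq> \<Omega>" using rsub by blast
  let ?b = "bump p r" and ?b' = "bump_deriv p r"
  have bc: "continuous_on S ?b" for S
    by (rule has_derivative_continuous_on[OF has_derivative_at_withinI[OF bump_has_derivative]])
  note out = bump_outside[OF _ r]
  define D where "D j x v = ?b x * F' x v $ j + ?b' x v * F x $ j" for j x v
  have Dc: "continuous_on \<Omega> (\<lambda>x. D j x v)" for j v
    unfolding D_def by (intro continuous_intros bc F' Fc continuous_on_bump_deriv)
  have D0: "D j x v = 0" if "x \<notin> cball p r" for j x v using out[OF that] by (simp add: D_def)
  have Dint: "(LINT x|lebesgue_on \<Omega>. D j x v) = 0" for j v
  proof -
    let ?h = "\<lambda>x. if x \<in> \<Omega> then ?b x * F x $ j else 0"
    let ?h' = "\<lambda>x v. if x \<in> \<Omega> then D j x v else 0"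
    have cov: "UNIV = \<Omega> \<union> - cball p r" using sub by auto
    have "(LINT x|lborel. ?h' x v) = 0"
    proof (rule integral_derivative_compact_support)
      show "(?h has_derivative ?h' x) (at x)" for x
      proof (cases "x \<in> \<Omega>")
        case True
        have "((\<lambda>x. F x $ j) has_derivative (\<lambda>v. F' x v $ j)) (at x)"
          using bounded_linear.has_derivative[OF bounded_linear_vec_nth F[OF True]] .
        from has_derivative_mult[OF bump_has_derivative this]
        have "((\<lambda>x. ?b x * F x $ j) has_derivative ?h' x) (at x)"
          using True by (simp add: D_def)
        then show ?thesis
          by (rule has_derivative_transform_within_open[OF _ \<Omega> True]) simp
      next
        case False
        then have x: "x \<in> - cball p r" using sub by auto
        have "((\<lambda>x. 0) has_derivative ?h' x) (at x)" using False by simp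
        then show ?thesis
          by (rule has_derivative_transform_within_open[OF _ _ x]) (use out in auto)
      qed
      have "continuous_on \<Omega> (\<lambda>x. ?h' x v)" by (rule continuous_on_eq[OF Dc[of j v]]) simp
      moreover have "continuous_on (- cball p r) (\<lambda>x. ?h' x v)"
        by (rule continuous_on_eq[OF continuous_on_const[of _ 0]]) (use D0 in auto)
      ultimately show "continuous_on UNIV (\<lambda>x. ?h' x v)"
        unfolding cov using \<Omega> by (intro continuous_on_open_Un) auto
      show "?h x = 0" if "x \<notin> cball p r" for x using out[OF that] by simp
    qed
    then show ?thesis
      by (subst integral_compact_support(3)[OF \<Omega> Dc sub]) (use D0 in auto)
  qed
  have supp_int: "integrable (lebesgue_on \<Omega>) k" if "continuous_on \<Omega> k" "\<And>x. x \<notin> cball p r \<Longrightarrow> k x = 0"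
    for k :: "real^'n \<Rightarrow> real"
    by (rule integral_compact_support(2)[OF \<Omega> that(1) sub]) (use that in auto)
  have div: "(\<Sum>j\<in>UNIV. D j x (axis j 1)) = ?b x * (G x - g x) + ?b' x (F x)" if "x \<in> \<Omega>" for x
    using linear_vec_expansion[OF has_derivative_linear[OF bump_has_derivative], of p r x "F x"]
    by (simp add: D_def G_def sum.distrib sum_distrib_left mult.commute)
  have "(LINT x|lebesgue_on \<Omega>. ?b x * (G x - g x) + ?b' x (F x))
      = (LINT x|lebesgue_on \<Omega>. (\<Sum>j\<in>UNIV. D j x (axis j 1)))"
    by (rule Bochner_Integration.integral_cong) (auto simp: space_restrict_space div)
  also have "\<dots> = (\<Sum>j\<in>UNIV. (LINT x|lebesgue_on \<Omega>. D j x (axis j 1)))"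
    by (intro Bochner_Integration.integral_sum supp_int Dc D0)
  finally have "(LINT x|lebesgue_on \<Omega>. ?b x * (G x - g x) + ?b' x (F x)) = 0" by (simp add: Dint)
  moreover have i1: "integrable (lebesgue_on \<Omega>) (\<lambda>x. ?b x * (G x - g x))"
    by (rule supp_int) (auto intro!: continuous_intros bc Gc g simp: out)
  moreover have i2: "integrable (lebesgue_on \<Omega>) (\<lambda>x. ?b' x (F x))"
    by (rule supp_int) (auto intro!: continuous_on_bump_deriv Fc simp: out)
  ultimately have "(LINT x|lebesgue_on \<Omega>. ?b x * (G x - g x)) + (LINT x|lebesgue_on \<Omega>. g x * ?b x) = 0"
    using weak[OF r sub] by simp
  moreover have i3: "integrable (lebesgue_on \<Omega>) (\<lambda>x. g x * ?b x)"
    by (rule supp_int) (auto intro!: continuous_intros bc g simp: out)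
  ultimately have "(LINT x|lebesgue_on \<Omega>. ?b x * (G x - g x) + g x * ?b x) = 0"
    using i1 by simp
  then have "(LINT x|lebesgue_on \<Omega>. ?b x * G x) = 0" by (simp add: algebra_simps)
  then have z: "(LINT x|lebesgue_on \<Omega>. sgn (G p) * (?b x * G x)) = 0" by simp
  have i4: "integrable (lebesgue_on \<Omega>) (\<lambda>x. sgn (G p) * (?b x * G x))"
    by (rule supp_int) (auto intro!: continuous_intros bc Gc simp: out)
  have "sgn (G p) * (?b p * G p) = 0"
  proof (rule continuous_nonneg_integral_0[OF \<Omega> _ i4 _ z p])
    show "continuous_on \<Omega> (\<lambda>x. sgn (G p) * (?b x * G x))" by (intro continuous_intros bc Gc)
    show "0 \<le> sgn (G p) * (?b x * G x)" if "x \<in> \<Omega>" for x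
    proof (cases "x \<in> cball p r")
      case True
      then have "0 < sgn (G p) * G x" using rsub by auto
      then have "0 \<le> ?b x * (sgn (G p) * G x)"
        by (rule mult_nonneg_nonneg[OF bump_nonneg less_imp_le])
      then show ?thesis by (simp add: mult.left_commute)
    qed (simp add: out)
  qed
  moreover have "?b p > 0" using r by (simp add: bump_def pos_sq_def)
  ultimately show False using Gp by auto
qed

section \<open>Vanishing normal trace at the boundary\<close>

text \<open>
  The function \<open>d\<close> measures the height below the graph. It is positive in \<open>\<Omega>\<close> near \<open>p\<close>, hence
  nonnegative on the closure, and it is not positive at \<open>p\<close> since \<open>p\<close> is not in the open set \<open>\<Omega>\<close>.
\<close>

lemma frontier_point_of_chart:
  assumes \<Omega>: "open \<Omega>" and p: "p \<in> frontier \<Omega>" and ch: "graph_chart \<Omega> p e g r"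
  defines "d \<equiv> \<lambda>x. g (x - (x \<bullet> e) *\<^sub>R e) - x \<bullet> e"
  assumes dc: "continuous_on UNIV d"
  shows "d p = 0" and "x \<in> closure \<Omega> \<Longrightarrow> x \<in> ball p r \<Longrightarrow> 0 \<le> d x"
proof -
  have r: "r > 0" and eq: "\<Omega> \<inter> ball p r = {x \<in> ball p r. 0 < d x}"
    using ch by (auto simp: graph_chart_def d_def)
  show ge: "0 \<le> d x" if "x \<in> closure \<Omega>" "x \<in> ball p r" for x
  proof (rule ccontr)
    assume "\<not> 0 \<le> d x"
    moreover have "open (UNIV \<inter> d -` {..<0})" by (rule continuous_open_preimage[OF dc]) auto
    ultimately have "open (ball p r \<inter> d -` {..<0})" "x \<in> ball p r \<inter> d -` {..<0}" using that by auto
    with open_Int_closure_eq_empty[of "ball p r \<inter> d -` {..<0}" \<Omega>] that(1)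
    obtain y where "y \<in> \<Omega>" "y \<in> ball p r" "d y < 0" by auto
    then show False using eq by force
  qed
  have "p \<notin> \<Omega>" "p \<in> closure \<Omega>" using p \<Omega> by (auto simp: frontier_def interior_open)
  then show "d p = 0" using eq ge[of p] r by force
qed

text \<open>
  The hypothesis expresses that the divergence theorem holds for \<open>w\<close> without boundary term, where \<open>q\<close>
  plays the role of \<open>- div w\<close>. The boundary term is detected by a single test function instead of the
  surface measure: let \<open>\<phi>\<close> be the square of the positive part of
  \<open>f x = \<delta>\<^sup>2 - d x - |x - p|\<^sup>2\<close>, where \<open>d\<close> is the height below the graph. Since \<open>d \<ge> 0\<close> on the closure
  of \<open>\<Omega>\<close>, the support of \<open>\<phi>\<close> shrinks to \<open>p\<close> as \<open>\<delta>\<close> tends to \<open>0\<close>. The gradient of \<open>f\<close> is close to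
  \<open>- \<nabla>d p = h\<close> there, so if \<open>w p \<bullet> h \<noteq> 0\<close> then
  \<open>w \<bullet> \<nabla>\<phi> - q \<phi> = f\<^sup>+ (2 w \<bullet> \<nabla>f - q f\<^sup>+)\<close> has a strict sign where \<open>f > 0\<close> and is zero elsewhere. Its
  integral over \<open>\<Omega>\<close> cannot vanish, because \<open>f p > 0\<close> and \<open>p\<close> is a limit of points of \<open>\<Omega>\<close>.
\<close>

lemma normal_trace_zero:
  fixes w :: "real^'n \<Rightarrow> real^'n" and q :: "real^'n \<Rightarrow> real"
  assumes \<Omega>: "open \<Omega>" "bounded \<Omega>" and p: "p \<in> frontier \<Omega>" and ch: "graph_chart \<Omega> p e g r"
    and h: "GDERIV (\<lambda>y. y \<bullet> e - g (y - (y \<bullet> e) *\<^sub>R e)) p :> h"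
    and w: "continuous_on (closure \<Omega>) w" and q: "continuous_on (closure \<Omega>) q"
    and weak: "\<And>\<phi> \<phi>'. C1_deriv_on (closure \<Omega>) \<phi> \<phi>' \<Longrightarrow>
      (LINT x|lebesgue_on \<Omega>. q x * \<phi> x - \<phi>' x (w x)) = 0"
  shows "w p \<bullet> h = 0"
proof (rule ccontr)
  assume nz: "w p \<bullet> h \<noteq> 0"
  \<comment> \<open>The sign makes one argument serve for inflow and outflow.\<close>
  define \<sigma> where "\<sigma> = sgn (w p \<bullet> h)"
  have \<sigma>: "\<sigma> * (w p \<bullet> h) > 0" "\<bar>\<sigma>\<bar> = 1" using nz by (auto simp: \<sigma>_def sgn_if)
  let ?C = "closure \<Omega>"
  have r: "r > 0" and gC: "C1_on UNIV g"
    using ch by (auto simp: graph_chart_def)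
  obtain g' where g': "C1_deriv_on UNIV g g'" using gC by (auto simp: C1_on_def)
  \<comment> \<open>The height of \<open>x\<close> below the graph.\<close>
  define d where "d x = g (x - (x \<bullet> e) *\<^sub>R e) - x \<bullet> e" for x
  define d' where "d' x v = g' (x - (x \<bullet> e) *\<^sub>R e) (v - (v \<bullet> e) *\<^sub>R e) - v \<bullet> e" for x v
  have d: "(d has_derivative d' x) (at x)" for x
  proof -
    have "((\<lambda>x. x - (x \<bullet> e) *\<^sub>R e) has_derivative (\<lambda>v. v - (v \<bullet> e) *\<^sub>R e)) (at x)"
      by (auto intro!: derivative_eq_intros)
    from has_derivative_compose[OF this C1_deriv_onD(1)[OF g']]
    have 1: "((\<lambda>x. g (x - (x \<bullet> e) *\<^sub>R e)) has_derivative (\<lambda>v. g' (x - (x \<bullet> e) *\<^sub>R e) (v - (v \<bullet> e) *\<^sub>R e))) (at x)"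
      by simp
    have 2: "((\<lambda>x. x \<bullet> e) has_derivative (\<lambda>v. v \<bullet> e)) (at x)" by (auto intro!: derivative_eq_intros)
    from has_derivative_diff[OF 1 2] show ?thesis by (simp add: d_def[abs_def] d'_def[abs_def])
  qed
  have dc: "continuous_on S d" for S
    by (rule has_derivative_continuous_on[OF has_derivative_at_withinI[OF d]])
  have d'c: "continuous_on S (\<lambda>x. d' x (V x))" if "continuous_on S V" for S V
    unfolding d'_def
    by (intro continuous_intros that continuous_on_compose2[OF C1_deriv_onD(2)[OF g']]) auto
  have d'p: "d' p v = - (h \<bullet> v)" for v
  proof -
    have "((\<lambda>y. y \<bullet> e - g (y - (y \<bullet> e) *\<^sub>R e)) has_derivative (\<lambda>v. - d' p v)) (at p)"
      using has_derivative_minus[OF d[of p]] by (simp add: d_def)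
    moreover have "((\<lambda>y. y \<bullet> e - g (y - (y \<bullet> e) *\<^sub>R e)) has_derivative (\<lambda>v. h \<bullet> v)) (at p)"
      using h by (simp add: gderiv_def inner_commute)
    ultimately have "(\<lambda>v. - d' p v) = (\<lambda>v. h \<bullet> v)" by (rule has_derivative_unique)
    then show ?thesis by (metis minus_minus)
  qed
  have dp: "d p = 0" and dge: "\<And>x. x \<in> ?C \<Longrightarrow> x \<in> ball p r \<Longrightarrow> 0 \<le> d x"
    using frontier_point_of_chart[OF \<Omega>(1) p ch] dc[of UNIV] by (auto simp: d_def[abs_def])
  have pC: "p \<in> ?C" using p by (auto simp: frontier_def)
  define \<Theta> where "\<Theta> x = \<sigma> * (2 * (- d' x (w x) - 2 * ((x - p) \<bullet> w x)))" for x
  have \<Theta>c: "continuous_on ?C \<Theta>"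
    unfolding \<Theta>_def by (intro continuous_intros d'c w)
  have \<Theta>p: "\<Theta> p > 0" using \<sigma> by (simp add: \<Theta>_def d'p inner_commute)
  define c where "c = \<Theta> p / 2"
  have c: "c > 0" "\<Theta> p > c" using \<Theta>p by (auto simp: c_def)
  obtain \<eta> where \<eta>: "\<eta> > 0" "\<And>x. x \<in> ?C \<Longrightarrow> dist x p < \<eta> \<Longrightarrow> \<Theta> x > c"
  proof -
    have "\<forall>e>0. \<exists>d>0. \<forall>x\<in>?C. dist x p < d \<longrightarrow> dist (\<Theta> x) (\<Theta> p) < e"
      using \<Theta>c pC unfolding continuous_on_iff by blast
    from this[rule_format, of c] c obtain \<eta> where "\<eta> > 0" "\<forall>x\<in>?C. dist x p < \<eta> \<longrightarrow> dist (\<Theta> x) (\<Theta> p) < c"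
      by auto
    then show ?thesis by (intro that[of \<eta>]) (auto simp: dist_real_def c_def abs_if field_simps split: if_splits)
  qed
  obtain B where B: "B > 0" "\<And>x. x \<in> ?C \<Longrightarrow> norm (q x) \<le> B"
    using bounded_on_compact[of ?C q] q \<Omega> by (auto simp: compact_closure)
  \<comment> \<open>Small enough for the first-order term \<open>2 w \<bullet> \<nabla>f\<close> to dominate \<open>q f\<^sup>+\<close>, as \<open>f \<le> \<delta>\<^sup>2\<close>.\<close>
  define \<delta> where "\<delta> = min (min (\<eta> / 2) (r / 2)) (min 1 (c / B))"
  have \<delta>: "\<delta> > 0" "\<delta> < \<eta>" "\<delta> < r" "\<delta> \<le> 1" "\<delta> * B \<le> c"
  proof -
    have "\<delta> \<le> c / B" by (simp add: \<delta>_def)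
    then show "\<delta> * B \<le> c" using B by (simp add: pos_le_divide_eq)
  qed (use \<eta> r c B in \<open>auto simp: \<delta>_def\<close>)
  have \<delta>2: "\<delta>\<^sup>2 * B \<le> c"
  proof -
    have "\<delta>\<^sup>2 \<le> \<delta>" using \<delta> by (simp add: power2_eq_square mult_left_le)
    then have "\<delta>\<^sup>2 * B \<le> \<delta> * B" using B by (intro mult_right_mono) auto
    then show ?thesis using \<delta> by linarith
  qed
  define f where "f x = \<delta>\<^sup>2 - d x - (x - p) \<bullet> (x - p)" for x
  define f' where "f' x v = - d' x v - 2 * ((x - p) \<bullet> v)" for x v
  have f: "(f has_derivative f' x) (at x)" for x
    unfolding f_def[abs_def] f'_def
    by (auto intro!: derivative_eq_intros d simp: inner_commute)
  have fc: "continuous_on S f" for S unfolding f_def by (intro continuous_intros dc)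
  have fle: "f x \<le> \<delta>\<^sup>2" if "x \<in> ?C" "x \<in> ball p r" for x
    using dge[OF that] inner_ge_zero[of "x - p"] unfolding f_def by linarith
  \<comment> \<open>Outside the small ball \<open>f\<close> is nonpositive, so extending \<open>\<phi>\<close> by zero beyond the chart keeps it \<open>C\<^sup>1\<close>.\<close>
  have f0: "max 0 (f x) = 0" if "x \<in> ?C" "x \<in> ball p r" "x \<notin> ball p \<delta>" for x
  proof -
    have "\<delta>\<^sup>2 \<le> (norm (x - p))\<^sup>2" using that(3) \<delta> by (intro power_mono) (auto simp: dist_norm norm_minus_commute)
    then show ?thesis using dge[OF that(1,2)] by (simp add: f_def power2_norm_eq_inner)
  qed
  define \<phi> where "\<phi> x = (if x \<in> ball p r then pos_sq (f x) else 0)" for x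
  define \<phi>' where "\<phi>' x v = (if x \<in> ball p r then 2 * max 0 (f x) * f' x v else 0)" for x v
  have \<phi>0: "\<phi> x = 0" "\<phi>' x v = 0" if "x \<in> ?C" "x \<notin> ball p \<delta>" for x v
    using f0[of x] that by (auto simp: \<phi>_def \<phi>'_def pos_sq_def)
  have \<phi>d: "(\<phi> has_derivative \<phi>' x) (at x within ?C)" if x: "x \<in> ?C" for x
  proof (cases "x \<in> ball p r")
    case True
    have "((\<lambda>x. pos_sq (f x)) has_derivative \<phi>' x) (at x)"
      using has_derivative_compose[OF f pos_sq_has_derivative[unfolded has_field_derivative_def], of x] True
      by (simp add: \<phi>'_def[abs_def])
    then have "(\<phi> has_derivative \<phi>' x) (at x)"
      by (rule has_derivative_transform_within_open[of _ _ _ _ "ball p r"]) (use True in \<open>auto simp: \<phi>_def\<close>)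
    then show ?thesis by (rule has_derivative_at_withinI)
  next
    case False
    have "((\<lambda>x. 0) has_derivative \<phi>' x) (at x within ?C)" using False by (simp add: \<phi>'_def[abs_def])
    then show ?thesis
    proof (rule has_derivative_transform_within[where d = "r - \<delta>"])
      fix y assume y: "y \<in> ?C" "dist y x < r - \<delta>"
      have "dist p x \<le> dist p y + dist y x" by (rule dist_triangle)
      then have "y \<notin> ball p \<delta>" using y False by auto
      then show "0 = \<phi> y" using \<phi>0 y by simp
    qed (use \<delta> x in auto)
  qed
  have \<phi>'c: "continuous_on ?C (\<lambda>x. \<phi>' x v)" for v
  proof -
    let ?S = "?C \<inter> ball p r" and ?T = "?C \<inter> - cball p \<delta>"
    have cov: "?C = ?S \<union> ?T" using \<delta> by auto
    have "continuous_on ?S (\<lambda>x. 2 * max 0 (f x) * f' x v)"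
      unfolding f'_def by (intro continuous_intros fc d'c)
    then have 1: "continuous_on ?S (\<lambda>x. \<phi>' x v)" by (rule continuous_on_eq) (simp add: \<phi>'_def)
    have 2: "continuous_on ?T (\<lambda>x. \<phi>' x v)"
      by (rule continuous_on_eq[OF continuous_on_const[of _ 0]]) (use \<phi>0 in auto)
    have "continuous_on (?S \<union> ?T) (\<lambda>x. \<phi>' x v)"
    proof (rule continuous_on_Un_local_open[OF _ _ 1 2])
      show "openin (top_of_set (?S \<union> ?T)) ?S"
        unfolding cov[symmetric] by (intro openin_open_Int) auto
      show "openin (top_of_set (?S \<union> ?T)) ?T"
        unfolding cov[symmetric] by (intro openin_open_Int) auto
    qed
    then show ?thesis using cov by simp
  qed
  let ?I = "\<lambda>x. \<sigma> * (\<phi>' x (w x) - q x * \<phi> x)"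
  have Ic: "continuous_on ?C (\<lambda>x. blinfun_apply (Blinfun (\<phi>' x)) (w x))" "continuous_on ?C \<phi>"
    using C1_deriv_onD(2,3)[OF C1_deriv_on_Blinfun(1)[OF \<phi>d \<phi>'c]] w
    by (auto intro: blinfun.continuous_on)
  have ap: "blinfun_apply (Blinfun (\<phi>' x)) = \<phi>' x" if "x \<in> ?C" for x
    using C1_deriv_on_Blinfun(2)[of ?C \<phi> \<phi>', OF \<phi>d \<phi>'c that] .
  have Ic': "continuous_on ?C ?I"
  proof (intro continuous_intros q Ic)
    show "continuous_on ?C (\<lambda>x. \<phi>' x (w x))" by (rule continuous_on_eq[OF Ic(1)]) (simp add: ap)
  qed
  have sp: "x \<in> ?C" if "x \<in> \<Omega>" for x using that closure_subset by auto
  have "(LINT x|lebesgue_on \<Omega>. q x * \<phi> x - blinfun_apply (Blinfun (\<phi>' x)) (w x)) = 0"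
    by (rule weak[OF C1_deriv_on_Blinfun(1)[OF \<phi>d \<phi>'c]])
  then have "(LINT x|lebesgue_on \<Omega>. - \<sigma> * (q x * \<phi> x - blinfun_apply (Blinfun (\<phi>' x)) (w x))) = 0" by simp
  moreover have "(LINT x|lebesgue_on \<Omega>. - \<sigma> * (q x * \<phi> x - blinfun_apply (Blinfun (\<phi>' x)) (w x))) = (LINT x|lebesgue_on \<Omega>. ?I x)"
    by (rule Bochner_Integration.integral_cong) (auto simp: space_restrict_space ap sp algebra_simps)
  ultimately have z: "(LINT x|lebesgue_on \<Omega>. ?I x) = 0" by (simp only:)
  have Ieq: "?I x = max 0 (f x) * (\<Theta> x - \<sigma> * q x * max 0 (f x))" if "x \<in> ball p r" for x
    using that by (simp add: \<phi>_def \<phi>'_def \<Theta>_def f'_def pos_sq_def power2_eq_square algebra_simps)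
  have pos: "\<Theta> x - \<sigma> * q x * max 0 (f x) > 0" if "x \<in> ?C" "x \<in> ball p \<delta>" for x
  proof -
    have xr: "x \<in> ball p r" using that \<delta> by auto
    have "\<bar>\<sigma> * q x * max 0 (f x)\<bar> \<le> B * \<delta>\<^sup>2"
      unfolding abs_mult \<sigma>(2) using B(2)[OF that(1)] fle[OF that(1) xr] B(1)
      by (intro mult_mono) auto
    moreover have "\<Theta> x > c" using \<eta>(2)[of x] that \<delta> by (auto simp: dist_commute)
    ultimately show ?thesis using \<delta>2 by (simp add: mult.commute)
  qed
  have I0: "?I x = 0" if "x \<in> \<Omega>" for x
  proof (rule continuous_nonneg_integral_0[OF \<Omega>(1) _ _ _ z that])
    show "continuous_on \<Omega> ?I" by (rule continuous_on_subset[OF Ic' closure_subset])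
    show "integrable (lebesgue_on \<Omega>) ?I" by (rule integrable_up_to_boundary[OF \<Omega> Ic'])
    show "0 \<le> ?I x" if "x \<in> \<Omega>" for x
    proof (cases "x \<in> ball p \<delta>")
      case True
      then have "x \<in> ball p r" using \<delta> by auto
      then show ?thesis unfolding Ieq[OF \<open>x \<in> ball p r\<close>]
        using pos[OF sp[OF that] True] by (intro mult_nonneg_nonneg) auto
    qed (simp add: \<phi>0 sp[OF that])
  qed
  have "open (UNIV \<inter> f -` {0<..})" by (rule continuous_open_preimage[OF fc]) auto
  then have "open (ball p \<delta> \<inter> f -` {0<..})" by auto
  moreover have "p \<in> ball p \<delta> \<inter> f -` {0<..}" using \<delta> by (simp add: f_def dp)
  ultimately have "ball p \<delta> \<inter> f -` {0<..} \<inter> \<Omega> \<noteq> {}"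
    using pC open_Int_closure_eq_empty[of "ball p \<delta> \<inter> f -` {0<..}" \<Omega>] by blast
  then obtain x where x: "x \<in> \<Omega>" "x \<in> ball p \<delta>" "f x > 0" by auto
  then have "x \<in> ball p r" using \<delta> by auto
  then show False
    using I0[OF x(1)] Ieq[of x] pos[OF sp[OF x(1)] x(2)] x(3) by simp
qed

section \<open>Estimates for the defect measures\<close>

text \<open>
  The supremum in the definition of the positive variation is bounded by \<open>c\<close>. The bound holds
  whether or not this supremum defines a measure, because a set function that is not a measure is
  replaced by the zero measure; hence no Jordan decomposition theorem is involved.
\<close>

lemma LINT_pos_variation_bound:
  assumes c: "0 \<le> c" "\<And>B. B \<in> sets (restrict_space borel K) \<Longrightarrow> \<nu> B \<le> c"
    and f: "\<And>x. x \<in> K \<Longrightarrow> \<bar>f x\<bar> \<le> F" and F: "0 \<le> F"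
  shows "\<bar>LINT x|pos_variation K \<nu>. f x\<bar> \<le> F * c"
proof (cases "integrable (pos_variation K \<nu>) f")
  case True
  let ?M = "pos_variation K \<nu>"
  have sp: "space ?M = K" by (simp add: pos_variation_def space_measure_of_conv)
  have "(SUP B\<in>{B \<in> sets (restrict_space borel K). B \<subseteq> K}. \<nu> B) \<le> c"
  proof (rule cSUP_least)
    have "{} \<in> {B \<in> sets (restrict_space borel K). B \<subseteq> K}" by simp
    then show "{B \<in> sets (restrict_space borel K). B \<subseteq> K} \<noteq> {}" by blast
  qed (use c in auto)
  then have em: "emeasure ?M K \<le> ennreal c"
    by (simp add: pos_variation_def emeasure_measure_of_conv ennreal_leI)
  interpret finite_measure ?M
    by (rule finite_measureI) (use em sp in \<open>auto simp: top_unique\<close>)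
  have "\<bar>LINT x|?M. f x\<bar> \<le> (LINT x|?M. \<bar>f x\<bar>)" using integral_norm_bound[of ?M f] by simp
  also have "\<dots> \<le> (LINT x|?M. F)"
    using True f sp by (intro integral_mono) auto
  also have "\<dots> = F * measure ?M K" using sp by simp
  also have "\<dots> \<le> F * c"
    using em c F by (intro mult_left_mono) (auto simp: emeasure_eq_measure)
  finally show ?thesis .
next
  case False
  then show ?thesis using c F by (simp add: not_integrable_integral_eq)
qed

lemma matrix_integral_bound:
  fixes R :: "'a::topological_space set \<Rightarrow> real^'n^'n"
  assumes c: "0 \<le> c" "\<And>B i j. B \<in> sets (restrict_space borel K) \<Longrightarrow> \<bar>R B $ i $ j\<bar> \<le> c"
    and f: "\<And>x i j. x \<in> K \<Longrightarrow> \<bar>G x $ i $ j\<bar> \<le> F" and F: "0 \<le> F"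
  shows "\<bar>matrix_integral K R G\<bar> \<le> 2 * F * (real CARD('n))\<^sup>2 * c"
proof -
  have s: "\<bar>signed_integral K (\<lambda>A. R A $ i $ j) (\<lambda>x. G x $ i $ j)\<bar> \<le> 2 * F * c" for i j
  proof -
    have "\<bar>LINT x|pos_variation K (\<lambda>A. R A $ i $ j). G x $ i $ j\<bar> \<le> F * c"
      by (rule LINT_pos_variation_bound[OF c(1) _ f F]) (use c(2)[of _ i j] in \<open>auto simp: abs_le_iff\<close>)
    moreover have "\<bar>LINT x|neg_variation K (\<lambda>A. R A $ i $ j). G x $ i $ j\<bar> \<le> F * c"
      unfolding neg_variation_def
      by (rule LINT_pos_variation_bound[OF c(1) _ f F]) (use c(2)[of _ i j] in \<open>auto simp: abs_le_iff\<close>)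
    ultimately show ?thesis unfolding signed_integral_def by linarith
  qed
  have "\<bar>matrix_integral K R G\<bar> \<le> (\<Sum>i\<in>UNIV. \<Sum>j\<in>UNIV. \<bar>signed_integral K (\<lambda>A. R A $ i $ j) (\<lambda>x. G x $ i $ j)\<bar>)"
    unfolding matrix_integral_def by (intro order.trans[OF sum_abs] sum_mono sum_abs)
  also have "\<dots> \<le> (\<Sum>i\<in>(UNIV :: 'n set). \<Sum>j\<in>(UNIV :: 'n set). 2 * F * c)"
    by (intro sum_mono s)
  also have "\<dots> = 2 * F * (real CARD('n))\<^sup>2 * c" by (simp add: power2_eq_square)
  finally show ?thesis .
qed

lemma inner_tensor: "A \<bullet> (v \<otimes>\<^sub>t w) = v \<bullet> (A *v w)"
  by (simp add: inner_vec_def tensor_def matrix_vector_mult_def sum_distrib_left mult_ac)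

text \<open>
  Test with \<open>e\<^sub>i + e\<^sub>j\<close> and \<open>e\<^sub>i - e\<^sub>j\<close>.
\<close>

lemma nonneg_sym_matrix_entries:
  fixes R :: "real^'n^'n"
  assumes sym: "transpose R = R" and nn: "\<And>\<xi>. 0 \<le> R \<bullet> (\<xi> \<otimes>\<^sub>t \<xi>)"
  shows "\<bar>R $ i $ j\<bar> \<le> trace R"
proof -
  have e: "axis k 1 \<bullet> (R *v axis l 1) = R $ k $ l" for k l
    by (simp add: matrix_vector_mult_basis inner_commute[of "axis k 1"] inner_axis column_def)
  have d: "0 \<le> R $ k $ k" for k using nn[of "axis k 1"] by (simp add: inner_tensor e)
  have tr: "trace R = (\<Sum>k\<in>UNIV. R $ k $ k)" by (simp add: trace_def)
  have t1: "R $ i $ i \<le> trace R"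
    unfolding tr by (rule member_le_sum) (auto simp: d)
  show ?thesis
  proof (cases "i = j")
    case True
    then show ?thesis using d t1 by simp
  next
    case False
    have s: "R $ j $ i = R $ i $ j"
      using arg_cong[OF sym, of "\<lambda>A. A $ i $ j"] by (simp add: transpose_def)
    have "0 \<le> R $ i $ i + R $ j $ j + 2 * R $ i $ j"
      using nn[of "axis i 1 + axis j 1"]
      by (simp add: inner_tensor matrix_vector_right_distrib inner_add e s)
    moreover have "0 \<le> R $ i $ i + R $ j $ j - 2 * R $ i $ j"
      using nn[of "axis i 1 - axis j 1"]
      by (simp add: inner_tensor matrix_vector_mult_diff_distrib inner_diff e s)
    moreover have "R $ i $ i + R $ j $ j \<le> trace R"
    proof -
      have "(\<Sum>k\<in>{i, j}. R $ k $ k) \<le> trace R"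
        unfolding tr by (rule sum_mono2) (auto simp: d)
      then show ?thesis using False by simp
    qed
    ultimately show ?thesis by (smt (verit) d)
  qed
qed

text \<open>
  The trace is a nonnegative finite measure that dominates all entries. This one estimate gives
  both the control of the defect by its energy and the conclusion that the whole matrix measure is
  zero once the trace of its total mass is.
\<close>

lemma nonneg_sym_matrix_measure_entry_bound:
  fixes R :: "'a::topological_space set \<Rightarrow> real^'n^'n"
  assumes R: "nonneg_sym_matrix_measure_on K R" and A: "A \<in> sets (restrict_space borel K)"
  shows "\<bar>R A $ i $ j\<bar> \<le> trace (R K)"
proof -
  let ?S = "sets (restrict_space borel K)"
  have add: "(\<lambda>i. R (F i)) sums R (\<Union>i. F i)" if "range F \<subseteq> ?S" "disjoint_family F" for F :: "nat \<Rightarrow> 'a set"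
    using R that unfolding nonneg_sym_matrix_measure_on_def by blast
  have ent: "\<bar>R B $ i $ j\<bar> \<le> trace (R B)" if "B \<in> ?S" for B i j
    using R that unfolding nonneg_sym_matrix_measure_on_def by (intro nonneg_sym_matrix_entries) auto
  have K: "K \<in> ?S" by (metis sets.top space_restrict_space space_borel Int_UNIV_right)
  have e: "R {} = 0"
  proof -
    have "(\<lambda>i::nat. R {}) sums R (\<Union>i::nat. {})" by (rule add) (auto simp: disjoint_family_on_def)
    then have "summable (\<lambda>i::nat. R {})" by (rule sums_summable)
    then show ?thesis by (simp add: summable_const_iff)
  qed
  \<comment> \<open>Countable additivity yields finite additivity after padding with empty sets.\<close>
  define F where "F n = (if n = 0 then A else if n = Suc 0 then K - A else {})" for n :: nat
  have "(\<lambda>i. R (F i)) sums R (\<Union>i. F i)"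
    by (rule add) (use A K in \<open>auto simp: F_def disjoint_family_on_def\<close>)
  moreover have "(\<Union>i. F i) = K"
    using sets.sets_into_space[OF A] by (auto simp: F_def space_restrict_space split: if_splits)
  moreover have "(\<lambda>i. R (F i)) sums (\<Sum>i\<in>{0, Suc 0}. R (F i))"
    by (rule sums_finite) (auto simp: F_def e)
  ultimately have "R A + R (K - A) = R K" by (auto simp: F_def dest: sums_unique2)
  then have "trace (R A) + trace (R (K - A)) = trace (R K)" by (metis trace_add)
  moreover have "0 \<le> trace (R (K - A))"
    using ent[of "K - A" undefined undefined] A K by fastforce
  ultimately show ?thesis using ent[OF A, of i j] by linarith
qed

section \<open>Energy bound and Gronwall estimate almost everywhere\<close>

text \<open>
  Intervals to the right of distinct points of \<open>B\<close> are disjoint.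
\<close>

lemma right_isolated_set_countable:
  fixes B :: "real set"
  assumes "\<And>x. x \<in> B \<Longrightarrow> \<exists>d>0. B \<inter> {x<..<x + d} = {}"
  shows "countable B"
proof -
  obtain d where d: "\<And>x. x \<in> B \<Longrightarrow> d x > 0" "\<And>x. x \<in> B \<Longrightarrow> B \<inter> {x<..<x + d x} = {}"
    using assms by metis
  let ?I = "\<lambda>x. {x<..<x + d x}"
  have dis: "?I x \<inter> ?I y = {}" if "x \<in> B" "y \<in> B" "x < y" for x y
  proof -
    have "y \<notin> ?I x" using d(2)[OF that(1)] that(2) by blast
    then show ?thesis using that by auto
  qed
  have ne: "?I x \<noteq> {}" if "x \<in> B" for x using d(1)[OF that] by simp
  have dis': "?I x \<inter> ?I y = {}" if "x \<in> B" "y \<in> B" "x \<noteq> y" for x y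
    using dis[of x y] dis[of y x] that by (cases "x < y") (auto simp: Int_commute)
  have "countable (?I ` B)"
  proof (rule countable_disjoint_open_subsets)
    show "disjoint (?I ` B)"
      unfolding disjoint_def using dis' by blast
  qed auto
  moreover have "inj_on ?I B"
  proof (rule inj_onI, rule ccontr)
    fix x y assume xy: "x \<in> B" "y \<in> B" "?I x = ?I y" "x \<noteq> y"
    then show False using dis'[of x y] ne[of x] by simp
  qed
  ultimately show ?thesis using countable_image_inj_on by blast
qed

text \<open>
  A point where \<open>E > c + \<epsilon>\<close> has a right neighbourhood without such points, so that there are only
  countably many of them.
\<close>

lemma AE_le_of_right_limits_le:
  fixes E :: "real \<Rightarrow> real"
  assumes lim: "\<And>t. t \<in> {a<..<b} \<Longrightarrow> \<exists>l\<le>c. (E \<longlongrightarrow> l) (at_right t)"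
  shows "AE t in lebesgue_on {a<..<b}. E t \<le> c"
proof -
  define B where "B n = {t \<in> {a<..<b}. E t > c + 1 / real (Suc n)}" for n
  have "countable (B n)" for n
  proof (rule right_isolated_set_countable)
    fix t assume "t \<in> B n"
    then obtain l where l: "l \<le> c" "(E \<longlongrightarrow> l) (at_right t)" using lim by (auto simp: B_def)
    have "0 < 1 / real (Suc n)" by simp
    then have "l < c + 1 / real (Suc n)" using l(1) by linarith
    then have "\<forall>\<^sub>F s in at_right t. E s < c + 1 / real (Suc n)"
      using l(2) by (rule order_tendstoD(2)[rotated])
    then obtain b where "b > t" "\<forall>s>t. s < b \<longrightarrow> E s < c + 1 / real (Suc n)"
      unfolding eventually_at_right_field by blast
    then show "\<exists>d>0. B n \<inter> {t<..<t + d} = {}"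
      by (intro exI[of _ "b - t"]) (force simp: B_def)
  qed
  then have "countable (\<Union>n. B n)" by simp
  then have "(\<Union>n. B n) \<in> null_sets lebesgue"
    by (simp add: countable_imp_null_set_lborel null_sets_completionI)
  moreover have "{t. \<not> (t \<in> {a<..<b} \<longrightarrow> E t \<le> c)} \<subseteq> (\<Union>n. B n)"
  proof
    fix t assume "t \<in> {t. \<not> (t \<in> {a<..<b} \<longrightarrow> E t \<le> c)}"
    then have t: "t \<in> {a<..<b}" "E t - c > 0" by auto
    then obtain n where "inverse (real (Suc n)) < E t - c" using reals_Archimedean by blast
    then show "t \<in> (\<Union>n. B n)" using t by (auto simp: B_def inverse_eq_divide intro!: exI[of _ n])
  qed
  ultimately have "AE t in lebesgue. t \<in> {a<..<b} \<longrightarrow> E t \<le> c" by (intro AE_I') auto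
  then show ?thesis by (subst AE_restrict_space_iff) auto
qed

lemma AE_initial_interval:
  assumes "AE t in lebesgue_on {0<..<T}. P t" "\<tau> < T"
  shows "AE t in lebesgue_on {0..\<tau>::real}. P t"
proof -
  have "AE t in lebesgue. t \<in> {0<..<T} \<longrightarrow> P t"
    using assms(1) by (subst (asm) AE_restrict_space_iff) auto
  moreover have "AE t in lebesgue. t \<noteq> (0::real)"
    by (rule AE_I'[of "{0}"]) auto
  ultimately have "AE t in lebesgue. t \<in> {0..\<tau>} \<longrightarrow> P t"
    by eventually_elim (use assms(2) in auto)
  then show ?thesis by (subst AE_restrict_space_iff) auto
qed

lemma LINT_power_interval:
  fixes \<tau> :: real
  assumes "0 \<le> \<tau>"
  shows "(LINT t|lebesgue_on {0..\<tau>}. t ^ k) = \<tau> ^ Suc k / real (Suc k)"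
proof -
  have "((\<lambda>t. t ^ k) has_integral (\<tau> ^ Suc k / real (Suc k) - 0 ^ Suc k / real (Suc k))) {0..\<tau>}"
  proof (rule fundamental_theorem_of_calculus[OF assms])
    fix t :: real
    show "((\<lambda>t. t ^ Suc k / real (Suc k)) has_vector_derivative t ^ k) (at t within {0..\<tau>})"
      unfolding has_real_derivative_iff_has_vector_derivative[symmetric]
      by (rule derivative_eq_intros refl | simp)+
  qed
  then show ?thesis
    by (subst LINT_eq_integral_interval) (auto intro!: continuous_intros integral_unique)
qed

text \<open>
  Inserting the bound \<open>D t \<le> M (C t)\<^sup>k / k!\<close> into the right-hand side improves it to \<open>k + 1\<close>, and
  these bounds tend to zero. Only the explicit majorants are integrated, which avoids any
  question about the measurability of the defect energy in time.
\<close>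

lemma gronwall_AE:
  fixes D X :: "real \<Rightarrow> real"
  assumes C: "0 \<le> C" and M: "AE t in lebesgue_on {0<..<T}. D t \<le> M"
    and D: "AE \<tau> in lebesgue_on {0<..<T}. D \<tau> \<le> - (LINT t|lebesgue_on {0..\<tau>}. X t)"
    and X: "AE t in lebesgue_on {0<..<T}. \<bar>X t\<bar> \<le> C * D t"
  shows "AE t in lebesgue_on {0<..<T}. D t \<le> 0"
proof -
  have it: "AE t in lebesgue_on {0<..<T}. D t \<le> M * (C * t) ^ k / fact k" for k
  proof (induction k)
    case 0
    then show ?case using M by simp
  next
    case (Suc k)
    have *: "AE t in lebesgue_on {0<..<T}. \<bar>X t\<bar> \<le> M * C ^ Suc k / fact k * t ^ k"
      using Suc X
    proof eventually_elim
      case (elim t)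
      have "C * D t \<le> C * (M * (C * t) ^ k / fact k)" using elim C by (intro mult_left_mono)
      also have "\<dots> = M * C ^ Suc k / fact k * t ^ k" by (simp add: power_mult_distrib)
      finally show ?case using elim by linarith
    qed
    have bd: "- (LINT t|lebesgue_on {0..\<tau>}. X t) \<le> M * (C * \<tau>) ^ Suc k / fact (Suc k)"
      if \<tau>: "\<tau> \<in> {0<..<T}" for \<tau>
    proof -
      have int: "integrable (lebesgue_on {0..\<tau>}) (\<lambda>t. M * C ^ Suc k / fact k * t ^ k)"
        by (intro continuous_imp_integrable_real continuous_intros)
      have "- (LINT t|lebesgue_on {0..\<tau>}. X t) \<le> (LINT t|lebesgue_on {0..\<tau>}. norm (X t))"
        using integral_norm_bound[of "lebesgue_on {0..\<tau>}" X] unfolding real_norm_def by linarith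
      also have "\<dots> \<le> (LINT t|lebesgue_on {0..\<tau>}. M * C ^ Suc k / fact k * t ^ k)"
        by (rule integral_mono_AE'[OF int]) (use AE_initial_interval[OF *, of \<tau>] \<tau> in auto)
      also have "\<dots> = M * C ^ Suc k / fact k * (\<tau> ^ Suc k / real (Suc k))"
        using LINT_power_interval[of \<tau> k] \<tau> by simp
      also have "\<dots> = M * (C * \<tau>) ^ Suc k / fact (Suc k)"
        by (simp add: power_mult_distrib mult_ac)
      finally show ?thesis .
    qed
    have "AE \<tau> in lebesgue_on {0<..<T}. \<tau> \<in> {0<..<T}" by (rule AE_I2) (simp add: space_restrict_space)
    with D show ?case
      by eventually_elim (use bd in force)
  qed
  have "AE t in lebesgue_on {0<..<T}. \<forall>k. D t \<le> M * (C * t) ^ k / fact k"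
    using it by (simp add: AE_all_countable)
  then show ?thesis
  proof eventually_elim
    case (elim t)
    have "(\<lambda>k. (C * t) ^ k / fact k) \<longlonglongrightarrow> 0"
      using summable_exp[of "C * t"] by (intro summable_LIMSEQ_zero) (simp add: field_simps)
    then have "(\<lambda>k. M * ((C * t) ^ k / fact k)) \<longlonglongrightarrow> M * 0" by (rule tendsto_mult_left)
    then show ?case using elim by (intro LIMSEQ_le_const) auto
  qed
qed

section \<open>The continuity equation\<close>

lemma interior_space_time_has_derivative:
  fixes f :: "real \<times> 'a::euclidean_space \<Rightarrow> 'b::real_normed_vector"
  assumes f: "C1_deriv_on ({0..<T} \<times> closure \<Omega>) f f'" and \<Omega>: "open \<Omega>" and tx: "0 < t" "t < T" "x \<in> \<Omega>"
  shows "(f has_derivative f' (t, x)) (at (t, x))"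
    and "((\<lambda>y. f (t, y)) has_derivative (\<lambda>v. f' (t, x) (0, v))) (at x)"
proof -
  have "{0<..<T} \<times> \<Omega> \<subseteq> interior ({0..<T} \<times> closure \<Omega>)"
    using \<Omega> closure_subset[of \<Omega>] by (intro interior_maximal open_Times) auto
  then have "(t, x) \<in> interior ({0..<T} \<times> closure \<Omega>)" using tx by auto
  moreover from this have "(t, x) \<in> {0..<T} \<times> closure \<Omega>" using interior_subset by blast
  ultimately show 1: "(f has_derivative f' (t, x)) (at (t, x))"
    using C1_deriv_onD(1)[OF f, of "(t, x)"] at_within_interior by metis
  have 2: "((\<lambda>y. (t, y)) has_derivative (\<lambda>v. (0, v))) (at x)" by (auto intro!: derivative_eq_intros)
  show "((\<lambda>y. f (t, y)) has_derivative (\<lambda>v. f' (t, x) (0, v))) (at x)"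
    by (rule has_derivative_compose[OF 2 1])
qed

text \<open>
  In the time-integrated identity both sides are differentiable in \<open>\<tau>\<close>; this localises the
  weak equations to a fixed time. The initial datum enters only through the constant \<open>c\<close>.
\<close>

lemma weak_identity_differentiated:
  fixes f g :: "real \<times> 'a::euclidean_space \<Rightarrow> real"
  assumes \<Omega>: "open \<Omega>" "bounded \<Omega>" and f: "C1_deriv_on ({0..<T} \<times> closure \<Omega>) f f'"
    and g: "continuous_on ({0..<T} \<times> closure \<Omega>) g"
    and eq: "\<And>\<tau>. 0 < \<tau> \<Longrightarrow> \<tau> < T \<Longrightarrow>
      (LINT x|lebesgue_on \<Omega>. f (\<tau>, x)) - c = (LINT t|lebesgue_on {0..\<tau>}. LINT x|lebesgue_on \<Omega>. g (t, x))"
    and t: "0 < t" "t < T"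
  shows "(LINT x|lebesgue_on \<Omega>. f' (t, x) (1, 0) - g (t, x)) = 0"
proof -
  let ?G = "\<lambda>t. LINT x|lebesgue_on \<Omega>. g (t, x)"
  have "((\<lambda>\<tau>. LINT t|lebesgue_on {0..\<tau>}. ?G t) has_real_derivative ?G t) (at t)"
    by (rule LINT_has_upper_limit_derivative[OF continuous_on_parameter_integral[OF \<Omega> g] t])
  moreover have "((\<lambda>\<tau>. (LINT x|lebesgue_on \<Omega>. f (\<tau>, x)) - c) has_real_derivative
      (LINT x|lebesgue_on \<Omega>. f' (t, x) (1, 0)) - 0) (at t)"
    by (intro DERIV_diff integral_has_time_derivative[OF \<Omega> f t] DERIV_const)
  then have "((\<lambda>\<tau>. LINT t|lebesgue_on {0..\<tau>}. ?G t) has_real_derivative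
      (LINT x|lebesgue_on \<Omega>. f' (t, x) (1, 0)) - 0) (at t)"
    by (rule has_field_derivative_transform_within_open[of _ _ _ "{0<..<T}"]) (use t eq in auto)
  ultimately have "?G t = (LINT x|lebesgue_on \<Omega>. f' (t, x) (1, 0)) - 0" by (rule DERIV_unique)
  moreover have "integrable (lebesgue_on \<Omega>) (\<lambda>x. f' (t, x) (1, 0))"
    using t by (intro integrable_slice[OF \<Omega>, of "{0..<T}" "\<lambda>z. f' z (1, 0)"] continuous_intros C1_deriv_onD(2)[OF f]) auto
  moreover have "integrable (lebesgue_on \<Omega>) (\<lambda>x. g (t, x))"
    using t by (intro integrable_slice[OF \<Omega> g]) auto
  ultimately show ?thesis by simp
qed

text \<open>
  Of the derivative of \<open>\<integral> \<rho> \<phi>\<close>, the part with \<open>\<partial>\<^sub>t \<phi>\<close> cancels. As \<open>\<partial>\<^sub>t \<rho> = - div m\<close>, this is the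
  divergence theorem for the vector field \<open>\<phi> m\<close> without boundary term, for all \<open>\<phi>\<close> that are smooth
  up to the boundary; it replaces the Gauss theorem in all that follows.
\<close>

lemma continuity_equation_instant:
  fixes \<rho> :: "real \<Rightarrow> real^'n \<Rightarrow> real" and m :: "real \<Rightarrow> real^'n \<Rightarrow> real^'n"
  assumes \<Omega>: "open \<Omega>" "bounded \<Omega>" and weak: "continuity_equation_weak T \<Omega> \<rho>\<^sub>0 \<rho> m"
    and \<rho>: "C1_deriv_on ({0..<T} \<times> closure \<Omega>) (\<lambda>(t, x). \<rho> t x) \<rho>'"
    and m: "continuous_on ({0..<T} \<times> closure \<Omega>) (\<lambda>(t, x). m t x)"
    and \<phi>: "C1_deriv_on ({0..<T} \<times> closure \<Omega>) \<phi> \<phi>'" and t: "0 < t" "t < T"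
  shows "(LINT x|lebesgue_on \<Omega>. \<rho>' (t, x) (1, 0) * \<phi> (t, x) - \<phi>' (t, x) (0, m t x)) = 0"
proof -
  let ?S = "{0..<T} \<times> closure \<Omega>"
  have K: "compact (closure \<Omega>)" using \<Omega> by (simp add: compact_closure)
  have sp: "x \<in> closure \<Omega>" if "x \<in> \<Omega>" for x using that closure_subset by auto
  obtain f' where f': "C1_deriv_on ?S (\<lambda>z. (case z of (t, x) \<Rightarrow> \<rho> t x) * \<phi> z) f'"
    and f'v: "\<And>z v. z \<in> ?S \<Longrightarrow> f' z v = (case z of (t, x) \<Rightarrow> \<rho> t x) * \<phi>' z v + \<rho>' z v * \<phi> z"
    using C1_deriv_on_bilinear[OF bounded_bilinear_mult \<rho> \<phi>] by blast
  let ?g = "\<lambda>z. (case z of (t, x) \<Rightarrow> \<rho> t x) * \<phi>' z (1, 0) + \<phi>' z (0, case z of (t, x) \<Rightarrow> m t x)"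
  have "(LINT x|lebesgue_on \<Omega>. f' (t, x) (1, 0) - ?g (t, x)) = 0"
  proof (rule weak_identity_differentiated[OF \<Omega> f' _ _ t])
    show "continuous_on ?S ?g"
      by (intro continuous_intros blinfun.continuous_on m C1_deriv_onD(2,3)[OF \<phi>] C1_deriv_onD(3)[OF \<rho>])
    fix \<tau> assume \<tau>: "0 < \<tau>" "\<tau> < T"
    obtain \<psi> \<psi>' where \<psi>: "C1c_deriv_on ?S \<psi> \<psi>'"
      "\<And>t x. t \<in> {0..\<tau>} \<Longrightarrow> x \<in> closure \<Omega> \<Longrightarrow> \<psi> (t, x) = \<phi> (t, x) \<and> \<psi>' (t, x) = \<phi>' (t, x)"
      using C1_time_cutoff[OF K \<phi> \<tau>] by metis
    have "(LINT x|lebesgue_on \<Omega>. \<rho> \<tau> x * \<psi> (\<tau>, x)) - (LINT x|lebesgue_on \<Omega>. \<rho>\<^sub>0 x * \<psi> (0, x)) =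
        (LINT t|lebesgue_on {0..\<tau>}. LINT x|lebesgue_on \<Omega>.
           \<rho> t x * dt (\<psi>' (t, x)) + m t x \<bullet> grad (\<psi>' (t, x)))"
      using weak \<psi>(1) \<tau> unfolding continuity_equation_weak_def by blast
    also have "(LINT x|lebesgue_on \<Omega>. \<rho> \<tau> x * \<psi> (\<tau>, x)) = (LINT x|lebesgue_on \<Omega>. \<rho> \<tau> x * \<phi> (\<tau>, x))"
      using \<tau> by (intro Bochner_Integration.integral_cong) (auto simp: \<psi>(2) sp space_restrict_space)
    also have "(LINT x|lebesgue_on \<Omega>. \<rho>\<^sub>0 x * \<psi> (0, x)) = (LINT x|lebesgue_on \<Omega>. \<rho>\<^sub>0 x * \<phi> (0, x))"
      using \<tau> by (intro Bochner_Integration.integral_cong) (auto simp: \<psi>(2) sp space_restrict_space)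
    also have "(LINT t|lebesgue_on {0..\<tau>}. LINT x|lebesgue_on \<Omega>.
           \<rho> t x * dt (\<psi>' (t, x)) + m t x \<bullet> grad (\<psi>' (t, x))) =
        (LINT t|lebesgue_on {0..\<tau>}. LINT x|lebesgue_on \<Omega>. ?g (t, x))"
      by (intro Bochner_Integration.integral_cong refl)
        (auto simp: \<psi>(2) sp space_restrict_space dt_def inner_grad[OF blinfun.bounded_linear_right])
    finally show "(LINT x|lebesgue_on \<Omega>. (case (\<tau>, x) of (t, x) \<Rightarrow> \<rho> t x) * \<phi> (\<tau>, x)) -
        (LINT x|lebesgue_on \<Omega>. \<rho>\<^sub>0 x * \<phi> (0, x)) =
        (LINT t|lebesgue_on {0..\<tau>}. LINT x|lebesgue_on \<Omega>. ?g (t, x))" by simp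
  qed
  also have "(LINT x|lebesgue_on \<Omega>. f' (t, x) (1, 0) - ?g (t, x)) =
      (LINT x|lebesgue_on \<Omega>. \<rho>' (t, x) (1, 0) * \<phi> (t, x) - \<phi>' (t, x) (0, m t x))"
    using t by (intro Bochner_Integration.integral_cong) (auto simp: f'v sp space_restrict_space)
  finally show ?thesis .
qed

lemma bump_C1_deriv_on:
  obtains b' where "C1_deriv_on S (bump p r) b'" "\<And>x v. x \<in> S \<Longrightarrow> b' x v = bump_deriv p r x (v :: 'a::euclidean_space)"
  using C1_deriv_on_Blinfun[of S "bump p r" "bump_deriv p r",
      OF has_derivative_at_withinI[OF bump_has_derivative] continuous_on_bump_deriv[OF continuous_on_const]]
  by metis

lemma continuity_equation_pointwise:
  fixes \<rho> :: "real \<Rightarrow> real^'n \<Rightarrow> real" and m :: "real \<Rightarrow> real^'n \<Rightarrow> real^'n"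
  assumes \<Omega>: "open \<Omega>" "bounded \<Omega>" and weak: "continuity_equation_weak T \<Omega> \<rho>\<^sub>0 \<rho> m"
    and \<rho>: "C1_deriv_on ({0..<T} \<times> closure \<Omega>) (\<lambda>(t, x). \<rho> t x) \<rho>'"
    and m: "C1_deriv_on ({0..<T} \<times> closure \<Omega>) (\<lambda>(t, x). m t x) m'"
    and tx: "0 < t" "t < T" "x \<in> \<Omega>"
  shows "dt (\<rho>' (t, x)) + vdiv (m' (t, x)) = 0"
proof -
  let ?S = "{0..<T} \<times> closure \<Omega>"
  have sp: "x \<in> closure \<Omega>" if "x \<in> \<Omega>" for x using that closure_subset by auto
  have c: "continuous_on \<Omega> (\<lambda>x. k (t, x))" if "continuous_on ?S k" for k :: "real \<times> (real^'n) \<Rightarrow> 'b::topological_space"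
    by (rule continuous_on_subset[OF continuous_on_slice[OF that] closure_subset]) (use tx in auto)
  have "\<rho>' (t, x) (1, 0) + (\<Sum>j\<in>UNIV. m' (t, x) (0, axis j 1) $ j) = 0"
  proof (rule weak_divergence_pointwise[OF \<Omega>(1) tx(3)])
    show "continuous_on \<Omega> (\<lambda>x. \<rho>' (t, x) (1, 0))"
      by (rule c) (intro continuous_intros C1_deriv_onD(2)[OF \<rho>])
    show "(m t has_derivative (\<lambda>v. m' (t, x) (0, v))) (at x)" if "x \<in> \<Omega>" for x
      using interior_space_time_has_derivative(2)[OF m \<Omega>(1) tx(1,2) that] by simp
    show "continuous_on \<Omega> (\<lambda>x. m' (t, x) (0, v))" for v
      by (rule c) (intro continuous_intros C1_deriv_onD(2)[OF m])
    fix r :: real assume r: "r > 0" "cball x r \<subseteq> \<Omega>"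
    obtain b' where b': "C1_deriv_on (closure \<Omega>) (bump x r) b'"
      "\<And>y v. y \<in> closure \<Omega> \<Longrightarrow> b' y v = bump_deriv x r y v"
      using bump_C1_deriv_on[of "closure \<Omega>" x r] by metis
    obtain \<psi>' where \<psi>': "C1_deriv_on ?S (\<lambda>z. bump x r (snd z)) \<psi>'"
      "\<And>z v. z \<in> ?S \<Longrightarrow> \<psi>' z v = b' (snd z) (snd v)"
      using C1_deriv_on_space_function[OF b'(1), of "{0..<T}"] by metis
    have mc: "continuous_on \<Omega> (m t)" using c[OF C1_deriv_onD(3)[OF m]] by simp
    have bc: "continuous_on \<Omega> (bump x r)"
      by (rule has_derivative_continuous_on[OF has_derivative_at_withinI[OF bump_has_derivative]])
    have "(LINT y|lebesgue_on \<Omega>. \<rho>' (t, y) (1, 0) * bump x r (snd (t, y)) - \<psi>' (t, y) (0, m t y)) = 0"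
      by (rule continuity_equation_instant[OF \<Omega> weak \<rho> C1_deriv_onD(3)[OF m] \<psi>'(1) tx(1,2)])
    also have "(LINT y|lebesgue_on \<Omega>. \<rho>' (t, y) (1, 0) * bump x r (snd (t, y)) - \<psi>' (t, y) (0, m t y)) =
        (LINT y|lebesgue_on \<Omega>. \<rho>' (t, y) (1, 0) * bump x r y - bump_deriv x r y (m t y))"
      using tx by (intro Bochner_Integration.integral_cong) (auto simp: \<psi>'(2) b'(2) sp space_restrict_space)
    also have "\<dots> = (LINT y|lebesgue_on \<Omega>. \<rho>' (t, y) (1, 0) * bump x r y) -
        (LINT y|lebesgue_on \<Omega>. bump_deriv x r y (m t y))"
    proof (rule Bochner_Integration.integral_diff)
      show "integrable (lebesgue_on \<Omega>) (\<lambda>y. \<rho>' (t, y) (1, 0) * bump x r y)"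
        by (rule integral_compact_support(2)[OF \<Omega>(1) _ r(2)])
          (auto intro!: continuous_on_mult bc c continuous_intros C1_deriv_onD(2)[OF \<rho>] simp: bump_outside[OF _ r(1)])
      show "integrable (lebesgue_on \<Omega>) (\<lambda>y. bump_deriv x r y (m t y))"
        by (rule integral_compact_support(2)[OF \<Omega>(1) _ r(2)])
          (auto intro!: continuous_on_bump_deriv mc simp: bump_outside[OF _ r(1)])
    qed
    finally show "(LINT y|lebesgue_on \<Omega>. \<rho>' (t, y) (1, 0) * bump x r y) =
        (LINT y|lebesgue_on \<Omega>. bump_deriv x r y (m t y))" by simp
  qed
  then show ?thesis by (simp add: dt_def vdiv_def)
qed

text \<open>
  For \<open>t > 0\<close> the continuity equation at the fixed time \<open>t\<close> says that \<open>m t\<close> has no normal trace; \<open>t = 0\<close> follows by continuity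
  in time. This makes the velocity an admissible test function in the momentum equation.
\<close>

lemma impermeable_boundary:
  fixes \<rho> :: "real \<Rightarrow> real^'n \<Rightarrow> real" and m :: "real \<Rightarrow> real^'n \<Rightarrow> real^'n"
  assumes \<Omega>: "open \<Omega>" "bounded \<Omega>" and weak: "continuity_equation_weak T \<Omega> \<rho>\<^sub>0 \<rho> m"
    and \<rho>: "C1_deriv_on ({0..<T} \<times> closure \<Omega>) (\<lambda>(t, x). \<rho> t x) \<rho>'"
    and m: "continuous_on ({0..<T} \<times> closure \<Omega>) (\<lambda>(t, x). m t x)"
    and t: "0 \<le> t" "t < T" and x: "x \<in> frontier \<Omega>" "outer_normal \<Omega> x n"
  shows "m t x \<bullet> n = 0"
proof -
  let ?S = "{0..<T} \<times> closure \<Omega>"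
  have sp: "x \<in> closure \<Omega>" if "x \<in> \<Omega>" for x using that closure_subset by auto
  have xC: "x \<in> closure \<Omega>" using x by (auto simp: frontier_def)
  obtain e g r h where ch: "graph_chart \<Omega> x e g r"
    and h: "GDERIV (\<lambda>y. y \<bullet> e - g (y - (y \<bullet> e) *\<^sub>R e)) x :> h" and n: "n = h /\<^sub>R norm h"
    using x(2) unfolding outer_normal_def by blast
  have pos: "m s x \<bullet> h = 0" if s: "0 < s" "s < T" for s
  proof (rule normal_trace_zero[OF \<Omega> x(1) ch h])
    have c: "continuous_on (closure \<Omega>) (\<lambda>x. k (s, x))" if "continuous_on ?S k" for k :: "real \<times> (real^'n) \<Rightarrow> 'b::topological_space"
      by (rule continuous_on_slice[OF that]) (use s in auto)
    show "continuous_on (closure \<Omega>) (m s)" using c[OF m] by simp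
    show "continuous_on (closure \<Omega>) (\<lambda>x. \<rho>' (s, x) (1, 0))"
      by (rule c) (intro continuous_intros C1_deriv_onD(2)[OF \<rho>])
    fix \<phi> :: "real^'n \<Rightarrow> real" and \<phi>' assume \<phi>: "C1_deriv_on (closure \<Omega>) \<phi> \<phi>'"
    obtain \<psi>' where \<psi>': "C1_deriv_on ?S (\<lambda>z. \<phi> (snd z)) \<psi>'"
      "\<And>z v. z \<in> ?S \<Longrightarrow> \<psi>' z v = \<phi>' (snd z) (snd v)"
      using C1_deriv_on_space_function[OF \<phi>, of "{0..<T}"] by metis
    have "(LINT y|lebesgue_on \<Omega>. \<rho>' (s, y) (1, 0) * \<phi> (snd (s, y)) - \<psi>' (s, y) (0, m s y)) = 0"
      by (rule continuity_equation_instant[OF \<Omega> weak \<rho> m \<psi>'(1) s])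
    also have "(LINT y|lebesgue_on \<Omega>. \<rho>' (s, y) (1, 0) * \<phi> (snd (s, y)) - \<psi>' (s, y) (0, m s y)) =
        (LINT y|lebesgue_on \<Omega>. \<rho>' (s, y) (1, 0) * \<phi> y - \<phi>' y (m s y))"
      using s by (intro Bochner_Integration.integral_cong) (auto simp: \<psi>'(2) sp space_restrict_space)
    finally show "(LINT y|lebesgue_on \<Omega>. \<rho>' (s, y) (1, 0) * \<phi> y - \<phi>' y (m s y)) = 0" .
  qed
  have "m t x \<bullet> h = 0"
  proof (cases "t = 0")
    case True
    have "continuous_on {0..<T} (\<lambda>s. (case (s, x) of (t, x) \<Rightarrow> m t x) \<bullet> h)"
      by (intro continuous_on_inner continuous_on_const continuous_on_compose2[OF m])
        (auto intro!: continuous_intros simp: xC)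
    then have "continuous_on {0..<T} (\<lambda>s. m s x \<bullet> h)" by simp
    then have "((\<lambda>s. m s x \<bullet> h) \<longlongrightarrow> m 0 x \<bullet> h) (at 0 within {0..<T})"
      using t unfolding continuous_on_def by auto
    then have "((\<lambda>s. m s x \<bullet> h) \<longlongrightarrow> m 0 x \<bullet> h) (at 0 within {0<..<T})"
      by (rule tendsto_within_subset) auto
    moreover have "at 0 within {0<..<T} = at_right 0"
      by (rule at_within_nhd[of _ "{-1<..<T}"]) (use t in auto)
    ultimately have "((\<lambda>s. m s x \<bullet> h) \<longlongrightarrow> m 0 x \<bullet> h) (at_right 0)" by simp
    moreover have "\<forall>\<^sub>F s in at_right 0. m s x \<bullet> h = 0"
      using t by (intro eventually_at_rightI[of 0 T]) (auto simp: pos)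
    then have "((\<lambda>s. m s x \<bullet> h) \<longlongrightarrow> 0) (at_right 0)" by (rule tendsto_eventually)
    ultimately show ?thesis using True tendsto_unique[OF trivial_limit_at_right_real] by blast
  qed (use pos t in auto)
  then show ?thesis by (simp add: n)
qed

section \<open>The momentum equation and the energy balance\<close>

lemma complete_measure_lebesgue_on:
  assumes "\<Omega> \<in> sets lebesgue"
  shows "complete_measure (lebesgue_on \<Omega>)"
proof
  fix A B :: "'a set"
  assume AB: "B \<subseteq> A" "A \<in> null_sets (lebesgue_on \<Omega>)"
  then have "A \<in> null_sets lebesgue" "A \<subseteq> \<Omega>"
    using assms by (auto simp: null_sets_restrict_space)
  then have "B \<in> sets lebesgue" using AB(1) by (metis completion.complete2 null_setsD2)
  then show "B \<in> sets (lebesgue_on \<Omega>)"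
    using AB(1) \<open>A \<subseteq> \<Omega>\<close> assms by (auto simp: sets_restrict_space_iff)
qed

text \<open>
  By completeness of Lebesgue measure, measurability of \<open>g\<close> follows from that of \<open>f\<close>. This is
  applied to the initial momentum, which is only known to agree with \<open>m 0\<close> almost everywhere.
\<close>

lemma integral_lebesgue_on_cong_AE:
  fixes f g :: "'a::euclidean_space \<Rightarrow> 'b::euclidean_space"
  assumes \<Omega>: "\<Omega> \<in> sets lebesgue" and f: "f \<in> borel_measurable (lebesgue_on \<Omega>)"
    and eq: "AE x in lebesgue_on \<Omega>. f x = g x"
  shows "(LINT x|lebesgue_on \<Omega>. f x) = (LINT x|lebesgue_on \<Omega>. g x)"
proof (rule integral_cong_AE[OF f _ eq])
  interpret complete_measure "lebesgue_on \<Omega>" by (rule complete_measure_lebesgue_on[OF \<Omega>])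
  show "g \<in> borel_measurable (lebesgue_on \<Omega>)"
  proof (rule measurableI)
    fix A :: "'b set" assume A: "A \<in> sets borel"
    show "g -` A \<inter> space (lebesgue_on \<Omega>) \<in> sets (lebesgue_on \<Omega>)"
    proof (rule in_sets_AE)
      show "f -` A \<inter> space (lebesgue_on \<Omega>) \<in> sets (lebesgue_on \<Omega>)" using f A by (rule measurable_sets)
      show "AE x in lebesgue_on \<Omega>. (x \<in> f -` A \<inter> space (lebesgue_on \<Omega>)) =
          (x \<in> g -` A \<inter> space (lebesgue_on \<Omega>))"
        using eq by eventually_elim auto
    qed simp
  qed simp
qed

lemma matrix_vector_vgrad:
  assumes "bounded_linear L"
  shows "vgrad L *v w = L (0, w)"
  using linear_vec_expansion[OF linear_spatial[OF assms], of w]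
  by (simp add: vec_eq_iff matrix_vector_mult_def vgrad_def mult.commute)

lemma tensor_inner_vgrad:
  assumes "bounded_linear L"
  shows "(v \<otimes>\<^sub>t w) \<bullet> vgrad L = v \<bullet> L (0, w)"
  by (metis inner_commute inner_tensor matrix_vector_vgrad[OF assms])

lemma matrix_integral_cong:
  assumes "\<And>x. x \<in> K \<Longrightarrow> F x = G x"
  shows "matrix_integral K R F = matrix_integral K R G"
proof -
  have "space (pos_variation K \<nu>) = K" for \<nu> by (simp add: pos_variation_def space_measure_of_conv)
  then have "(LINT x|pos_variation K \<nu>. F x $ i $ j) = (LINT x|pos_variation K \<nu>. G x $ i $ j)" for \<nu> i j
    using assms by (intro Bochner_Integration.integral_cong) auto
  then show ?thesis by (simp add: matrix_integral_def signed_integral_def neg_variation_def)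
qed

text \<open>
  The velocity does not vanish near time \<open>T\<close>, so the time cutoff is applied here once and for all.
  The differential operators become directional derivatives: \<open>m \<otimes> m : \<nabla>\<phi> = m \<bullet> D\<phi> (0, m)\<close>.
\<close>

lemma momentum_equation_weak_uncut:
  fixes \<rho> :: "real \<Rightarrow> real^'n \<Rightarrow> real" and m :: "real \<Rightarrow> real^'n \<Rightarrow> real^'n"
  assumes \<Omega>: "open \<Omega>" "bounded \<Omega>" and weak: "momentum_equation_weak a \<gamma> T \<Omega> m\<^sub>0 \<rho> m Rv Rp"
    and \<phi>: "C1_deriv_on ({0..<T} \<times> closure \<Omega>) \<phi> \<phi>'"
    and bc: "\<And>t x n. t \<in> {0..<T} \<Longrightarrow> x \<in> frontier \<Omega> \<Longrightarrow> outer_normal \<Omega> x n \<Longrightarrow> \<phi> (t, x) \<bullet> n = 0"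
    and \<tau>: "0 < \<tau>" "\<tau> < T"
  shows "(LINT x|lebesgue_on \<Omega>. m \<tau> x \<bullet> \<phi> (\<tau>, x)) - (LINT x|lebesgue_on \<Omega>. m\<^sub>0 x \<bullet> \<phi> (0, x)) =
        (LINT t|lebesgue_on {0..\<tau>}. LINT x|lebesgue_on \<Omega>.
           m t x \<bullet> \<phi>' (t, x) (1, 0) + inverse (\<rho> t x) * (m t x \<bullet> \<phi>' (t, x) (0, m t x)) +
           pressure a \<gamma> (\<rho> t x) * vdiv (\<phi>' (t, x))) +
        (LINT t|lebesgue_on {0..\<tau>}.
           matrix_integral (closure \<Omega>) (\<lambda>A. Rv t A + measure (Rp t) A *\<^sub>R mat 1)
             (\<lambda>x. vgrad (\<phi>' (t, x))))"
proof -
  let ?S = "{0..<T} \<times> closure \<Omega>"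
  have K: "compact (closure \<Omega>)" using \<Omega> by (simp add: compact_closure)
  have sp: "x \<in> closure \<Omega>" if "x \<in> \<Omega>" for x using that closure_subset by auto
  obtain \<psi> \<psi>' where \<psi>: "C1c_deriv_on ?S \<psi> \<psi>'"
      "\<And>t x. t \<in> {0..\<tau>} \<Longrightarrow> x \<in> closure \<Omega> \<Longrightarrow> \<psi> (t, x) = \<phi> (t, x) \<and> \<psi>' (t, x) = \<phi>' (t, x)"
    and sc: "\<And>z. \<exists>c::real. \<psi> z = c *\<^sub>R \<phi> z"
    using C1_time_cutoff[OF K \<phi> \<tau>] by metis
  have bc': "\<forall>t\<in>{0..<T}. \<forall>x\<in>frontier \<Omega>. \<forall>n. outer_normal \<Omega> x n \<longrightarrow> \<psi> (t, x) \<bullet> n = 0"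
  proof (intro ballI allI impI)
    fix t x n assume *: "t \<in> {0..<T}" "x \<in> frontier \<Omega>" "outer_normal \<Omega> x n"
    obtain c where "\<psi> (t, x) = c *\<^sub>R \<phi> (t, x)" using sc by blast
    then show "\<psi> (t, x) \<bullet> n = 0" using bc[OF *] by simp
  qed
  have "(LINT x|lebesgue_on \<Omega>. m \<tau> x \<bullet> \<psi> (\<tau>, x)) - (LINT x|lebesgue_on \<Omega>. m\<^sub>0 x \<bullet> \<psi> (0, x)) =
        (LINT t|lebesgue_on {0..\<tau>}. LINT x|lebesgue_on \<Omega>.
           m t x \<bullet> dt (\<psi>' (t, x)) +
           ((m t x \<otimes>\<^sub>t m t x) /\<^sub>R \<rho> t x) \<bullet> vgrad (\<psi>' (t, x)) +
           pressure a \<gamma> (\<rho> t x) * vdiv (\<psi>' (t, x))) +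
        (LINT t|lebesgue_on {0..\<tau>}.
           matrix_integral (closure \<Omega>) (\<lambda>A. Rv t A + measure (Rp t) A *\<^sub>R mat 1)
             (\<lambda>x. vgrad (\<psi>' (t, x))))"
    using weak \<psi>(1) bc' \<tau> unfolding momentum_equation_weak_def by blast
  also have "(LINT x|lebesgue_on \<Omega>. m \<tau> x \<bullet> \<psi> (\<tau>, x)) = (LINT x|lebesgue_on \<Omega>. m \<tau> x \<bullet> \<phi> (\<tau>, x))"
    using \<tau> by (intro Bochner_Integration.integral_cong) (auto simp: \<psi>(2) sp space_restrict_space)
  also have "(LINT x|lebesgue_on \<Omega>. m\<^sub>0 x \<bullet> \<psi> (0, x)) = (LINT x|lebesgue_on \<Omega>. m\<^sub>0 x \<bullet> \<phi> (0, x))"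
    using \<tau> by (intro Bochner_Integration.integral_cong) (auto simp: \<psi>(2) sp space_restrict_space)
  also have "(LINT t|lebesgue_on {0..\<tau>}. LINT x|lebesgue_on \<Omega>.
           m t x \<bullet> dt (\<psi>' (t, x)) +
           ((m t x \<otimes>\<^sub>t m t x) /\<^sub>R \<rho> t x) \<bullet> vgrad (\<psi>' (t, x)) +
           pressure a \<gamma> (\<rho> t x) * vdiv (\<psi>' (t, x))) =
       (LINT t|lebesgue_on {0..\<tau>}. LINT x|lebesgue_on \<Omega>.
           m t x \<bullet> \<phi>' (t, x) (1, 0) + inverse (\<rho> t x) * (m t x \<bullet> \<phi>' (t, x) (0, m t x)) +
           pressure a \<gamma> (\<rho> t x) * vdiv (\<phi>' (t, x)))"
    by (intro Bochner_Integration.integral_cong refl)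
      (auto simp: \<psi>(2) sp space_restrict_space dt_def tensor_inner_vgrad[OF blinfun.bounded_linear_right])
  also have "(LINT t|lebesgue_on {0..\<tau>}.
           matrix_integral (closure \<Omega>) (\<lambda>A. Rv t A + measure (Rp t) A *\<^sub>R mat 1)
             (\<lambda>x. vgrad (\<psi>' (t, x)))) =
       (LINT t|lebesgue_on {0..\<tau>}.
           matrix_integral (closure \<Omega>) (\<lambda>A. Rv t A + measure (Rp t) A *\<^sub>R mat 1)
             (\<lambda>x. vgrad (\<phi>' (t, x))))"
    by (intro Bochner_Integration.integral_cong refl matrix_integral_cong) (auto simp: \<psi>(2) space_restrict_space)
  finally show ?thesis .
qed

text \<open>
  Agrees with \<open>mean_energy\<close> for positive densities; being real-valued, it can be subtracted.
\<close>

definition energy ::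
  "real \<Rightarrow> real \<Rightarrow> (real^'n) set \<Rightarrow> (real^'n \<Rightarrow> real) \<Rightarrow> (real^'n \<Rightarrow> real^'n) \<Rightarrow> real" where
  "energy a \<gamma> \<Omega> r w =
     (LINT x|lebesgue_on \<Omega>. 1/2 * ((norm (w x))\<^sup>2 / r x) + pressure_potential a \<gamma> (r x))"

text \<open>
  Pointwise algebra behind the energy balance, in terms of the values \<open>r\<close>, \<open>u\<close> of density and velocity
  and of their derivatives \<open>L\<close>, \<open>V\<close>. The left-hand side is \<open>\<partial>\<^sub>t (m \<bullet> u)\<close> minus the integrand of the
  momentum equation with test function \<open>u\<close>, minus \<open>\<partial>\<^sub>t\<close> of the energy density
  \<open>r |u|\<^sup>2 / 2 + P r\<close>. The right-hand side is the integrand of the continuity equation with test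
  function \<open>|u|\<^sup>2 / 2 - P r / r\<close>. The term in \<open>P\<close> is where the law \<open>P = p / (\<gamma> - 1)\<close> enters, through
  \<open>r (P r / r)' = p r / r\<close>.
\<close>

lemma energy_flux_identity:
  fixes L :: "(real \<times> (real^'n)) \<Rightarrow>\<^sub>L real" and V :: "(real \<times> (real^'n))  \<Rightarrow>\<^sub>L (real^'n)"
    and a \<gamma> r :: real and u :: "real^'n"
  assumes r: "r > 0" and \<gamma>: "\<gamma> > 1" and mass: "L (1, 0) + (r * vdiv V + L (0, u)) = 0"
  defines "\<kappa> \<equiv> a / (\<gamma> - 1)"
  shows "(r * (2 * (u \<bullet> V (1, 0))) + L (1, 0) * (u \<bullet> u))
     - ((r *\<^sub>R u) \<bullet> V (1, 0) + inverse r * ((r *\<^sub>R u) \<bullet> V (0, r *\<^sub>R u)) + pressure a \<gamma> r * vdiv V)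
     - (1/2 * (r * (2 * (u \<bullet> V (1, 0))) + L (1, 0) * (u \<bullet> u)) + \<kappa> * (\<gamma> * r powr (\<gamma> - 1)) * L (1, 0))
   = L (1, 0) * (1/2 * (u \<bullet> u) + - \<kappa> * r powr (\<gamma> - 1))
     - (1/2 * (2 * (u \<bullet> V (0, r *\<^sub>R u))) + - \<kappa> * ((\<gamma> - 1) * r powr (\<gamma> - 1 - 1)) * L (0, r *\<^sub>R u))"
proof -
  define q where "q = r powr (\<gamma> - 1)"
  have q1: "r powr \<gamma> = q * r" using r by (simp add: q_def powr_diff)
  have q2: "r powr (\<gamma> - 1 - 1) = q / r" using r by (simp add: q_def powr_diff power2_eq_square)
  have Lr: "L (0, r *\<^sub>R u) = r * L (0, u)"
    using blinfun.scaleR_right[of L r "(0, u)"] by simp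
  have Vr: "V (0, r *\<^sub>R u) = r *\<^sub>R V (0, u)"
    using blinfun.scaleR_right[of V r "(0, u)"] by simp
  have k: "\<kappa> * (\<gamma> - 1) = a" using \<gamma> by (simp add: \<kappa>_def)
  have Lu: "L (0, u) = - L (1, 0) - r * vdiv V" using mass by simp
  have t1: "\<kappa> * (\<gamma> * q) * L (1, 0) = (a * q + \<kappa> * q) * L (1, 0)"
    unfolding k[symmetric] by (simp add: algebra_simps)
  have t2: "- \<kappa> * ((\<gamma> - 1) * (q / r)) * (r * L (0, u)) = - a * q * L (0, u)"
    unfolding k[symmetric] using r by (simp add: field_simps)
  have t3: "inverse r * ((r *\<^sub>R u) \<bullet> (r *\<^sub>R V (0, u))) = r * (u \<bullet> V (0, u))"
    using r by simp
  show ?thesis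
    unfolding q1 q2 q_def[symmetric] Lr Vr pressure_def
    unfolding t1 t2 t3
    unfolding Lu by (simp add: algebra_simps)
qed

text \<open>
  Take \<open>u = m / \<rho>\<close> as test function in the momentum equation. By the flux identity and the
  continuity equation, everything except the defect term integrates to the increment of the energy;
  \<open>V\<close> is the derivative of \<open>u\<close>.
\<close>

lemma energy_balance:
  fixes \<rho> :: "real \<Rightarrow> real^'n \<Rightarrow> real" and m :: "real \<Rightarrow> real^'n \<Rightarrow> real^'n"
  assumes \<Omega>: "open \<Omega>" "bounded \<Omega>" and \<gamma>: "\<gamma> > 1"
    and cont: "continuity_equation_weak T \<Omega> \<rho>\<^sub>0 \<rho> m"
    and mom: "momentum_equation_weak a \<gamma> T \<Omega> m\<^sub>0 \<rho> m Rv Rp"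
    and \<rho>: "C1_deriv_on ({0..<T} \<times> closure \<Omega>) (\<lambda>(t, x). \<rho> t x) \<rho>'"
    and m: "C1_deriv_on ({0..<T} \<times> closure \<Omega>) (\<lambda>(t, x). m t x) m'"
    and pos: "\<And>t x. t \<in> {0..<T} \<Longrightarrow> x \<in> closure \<Omega> \<Longrightarrow> \<rho> t x > 0"
    and ini: "AE x in lebesgue_on \<Omega>. m 0 x = m\<^sub>0 x"
  obtains V where "continuous_on ({0..<T} \<times> closure \<Omega>) V"
    and "\<And>\<tau>. 0 < \<tau> \<Longrightarrow> \<tau> < T \<Longrightarrow>
      energy a \<gamma> \<Omega> (\<rho> \<tau>) (m \<tau>) - energy a \<gamma> \<Omega> (\<rho> 0) (m 0) =
      (LINT t|lebesgue_on {0..\<tau>}.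
         matrix_integral (closure \<Omega>) (\<lambda>A. Rv t A + measure (Rp t) A *\<^sub>R mat 1)
           (\<lambda>x. vgrad (blinfun_apply (V (t, x)))))"
proof -
  let ?S = "{0..<T} \<times> closure \<Omega>"
  define \<kappa> where "\<kappa> = a / (\<gamma> - 1)"
  define r where "r = (\<lambda>(t, x). \<rho> t x)"
  define w where "w = (\<lambda>(t, x). m t x)"
  have r: "C1_deriv_on ?S r \<rho>'" and w: "C1_deriv_on ?S w m'"
    using \<rho> m by (simp_all add: r_def w_def)
  have rp: "r z > 0" if "z \<in> ?S" for z using that pos by (auto simp: r_def)
  have sp: "x \<in> closure \<Omega>" if "x \<in> \<Omega>" for x using that closure_subset by auto
  obtain i' where i': "C1_deriv_on ?S (\<lambda>z. 1 * r z powr (- 1)) i'"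
    using C1_deriv_on_powr[OF r rp, of 1 "-1"] by blast
  \<comment> \<open>The velocity; \<open>r powr - 1\<close> stands for \<open>1 / r\<close>, so that the power rule applies.\<close>
  define u where "u z = (1 * r z powr (- 1)) *\<^sub>R w z" for z
  obtain V where V: "C1_deriv_on ?S u V"
    using C1_deriv_on_bilinear[OF bounded_bilinear_scaleR i' w] unfolding u_def by blast
  have wu: "w z = r z *\<^sub>R u z" if "z \<in> ?S" for z
    using rp[OF that] by (simp add: u_def powr_minus)
  \<comment> \<open>The derivative of \<open>m\<close> expressed through those of density and velocity.\<close>
  obtain W where "C1_deriv_on ?S (\<lambda>z. r z *\<^sub>R u z) W"
    and W: "\<And>z v. z \<in> ?S \<Longrightarrow> W z v = r z *\<^sub>R V z v + \<rho>' z v *\<^sub>R u z"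
    using C1_deriv_on_bilinear[OF bounded_bilinear_scaleR r V] by blast
  then have "C1_deriv_on ?S w W" using wu by (intro C1_deriv_on_cong[of _ _ W w]) auto
  then have mW: "C1_deriv_on ?S (\<lambda>(t, x). m t x) W" by (simp add: w_def)
  obtain s' where s': "C1_deriv_on ?S (\<lambda>z. u z \<bullet> u z) s'"
    and s'v: "\<And>z v. z \<in> ?S \<Longrightarrow> s' z v = u z \<bullet> V z v + V z v \<bullet> u z"
    using C1_deriv_on_bilinear[OF bounded_bilinear_inner V V] by blast
  obtain f' where f': "C1_deriv_on ?S (\<lambda>z. r z * (u z \<bullet> u z)) f'"
    and f'v: "\<And>z v. z \<in> ?S \<Longrightarrow> f' z v = r z * s' z v + \<rho>' z v * (u z \<bullet> u z)"
    using C1_deriv_on_bilinear[OF bounded_bilinear_mult r s'] by blast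
  obtain P' where P': "C1_deriv_on ?S (\<lambda>z. \<kappa> * r z powr \<gamma>) P'"
    and P'v: "\<And>z v. z \<in> ?S \<Longrightarrow> P' z v = \<kappa> * (\<gamma> * r z powr (\<gamma> - 1)) * \<rho>' z v"
    using C1_deriv_on_powr[OF r rp, of \<kappa> \<gamma>] by blast
  obtain Q' where Q': "C1_deriv_on ?S (\<lambda>z. - \<kappa> * r z powr (\<gamma> - 1)) Q'"
    and Q'v: "\<And>z v. z \<in> ?S \<Longrightarrow> Q' z v = - \<kappa> * ((\<gamma> - 1) * r z powr (\<gamma> - 1 - 1)) * \<rho>' z v"
    using C1_deriv_on_powr[OF r rp, of "-\<kappa>" "\<gamma> - 1"] by blast
  define e where "e z = (1/2) *\<^sub>R (r z * (u z \<bullet> u z)) + \<kappa> * r z powr \<gamma>" for z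
  define e' where "e' z = (1/2) *\<^sub>R f' z + P' z" for z
  have e: "C1_deriv_on ?S e e'"
    unfolding e_def[abs_def] e'_def[abs_def] by (intro C1_deriv_on_add C1_deriv_on_scaleR f' P')
  \<comment> \<open>This is \<open>|u|\<^sup>2 / 2 - P r / r\<close>.\<close>
  define \<phi> where "\<phi> z = (1/2) *\<^sub>R (u z \<bullet> u z) + - \<kappa> * r z powr (\<gamma> - 1)" for z
  define \<phi>' where "\<phi>' z = (1/2) *\<^sub>R s' z + Q' z" for z
  have \<phi>: "C1_deriv_on ?S \<phi> \<phi>'"
    unfolding \<phi>_def[abs_def] \<phi>'_def[abs_def] by (intro C1_deriv_on_add C1_deriv_on_scaleR s' Q')
  define g where "g z = w z \<bullet> V z (1, 0) + inverse (r z) * (w z \<bullet> V z (0, w z)) + pressure a \<gamma> (r z) * vdiv (V z)" for z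
  have gc: "continuous_on ?S g"
    unfolding g_def pressure_def vdiv_def
    by (intro continuous_intros blinfun.continuous_on C1_deriv_onD(2,3)[OF V] C1_deriv_onD(3)[OF w] C1_deriv_onD(3)[OF r])
      (use rp in force)+
  have identity: "f' (t, x) (1, 0) - g (t, x) - e' (t, x) (1, 0) =
      \<rho>' (t, x) (1, 0) * \<phi> (t, x) - \<phi>' (t, x) (0, m t x)"
    if tx: "0 < t" "t < T" "x \<in> \<Omega>" for t x
  proof -
    have z: "(t, x) \<in> ?S" using tx sp by auto
    have "dt (\<rho>' (t, x)) + vdiv (W (t, x)) = 0"
      by (rule continuity_equation_pointwise[OF \<Omega> cont \<rho> mW tx])
    moreover have "vdiv (W (t, x)) = r (t, x) * vdiv (V (t, x)) + \<rho>' (t, x) (0, u (t, x))"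
    proof -
      have "vdiv (W (t, x)) = (\<Sum>j\<in>UNIV. r (t, x) * V (t, x) (0, axis j 1) $ j) +
          (\<Sum>j\<in>UNIV. u (t, x) $ j * \<rho>' (t, x) (0, axis j 1))"
        by (simp add: vdiv_def W[OF z] sum.distrib mult.commute)
      also have "(\<Sum>j\<in>UNIV. u (t, x) $ j * \<rho>' (t, x) (0, axis j 1)) = \<rho>' (t, x) (0, u (t, x))"
        using linear_vec_expansion[OF linear_spatial[OF blinfun.bounded_linear_right[of "\<rho>' (t, x)"]], of "u (t, x)"] by simp
      finally show ?thesis by (simp add: vdiv_def sum_distrib_left)
    qed
    ultimately have mass: "\<rho>' (t, x) (1, 0) + (r (t, x) * vdiv (V (t, x)) + \<rho>' (t, x) (0, u (t, x))) = 0"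
      by (simp add: dt_def)
    have mw: "m t x = r (t, x) *\<^sub>R u (t, x)" using wu[OF z] by (simp add: w_def)
    have s'2: "s' (t, x) v = 2 * (u (t, x) \<bullet> V (t, x) v)" for v
      by (simp add: s'v[OF z] inner_commute)
    show ?thesis
      using energy_flux_identity[OF rp[OF z] \<gamma> mass, of a]
      by (simp add: f'v[OF z] g_def e'_def \<phi>_def \<phi>'_def P'v[OF z] Q'v[OF z] s'2 wu[OF z] mw
          blinfun.add_left blinfun.scaleR_left \<kappa>_def)
  qed
  have edens: "1/2 * ((norm (m t x))\<^sup>2 / \<rho> t x) + pressure_potential a \<gamma> (\<rho> t x) = e (t, x)"
    if "t \<in> {0..<T}" "x \<in> closure \<Omega>" for t x
  proof -
    have z: "(t, x) \<in> ?S" using that by auto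
    have mw: "m t x = r (t, x) *\<^sub>R u (t, x)" using wu[OF z] by (simp add: w_def)
    have "(norm (m t x))\<^sup>2 / r (t, x) = r (t, x) * (u (t, x) \<bullet> u (t, x))"
      using rp[OF z] by (simp add: mw dot_square_norm power2_eq_square)
    then show ?thesis by (simp add: e_def pressure_potential_def \<kappa>_def r_def)
  qed
  let ?en = "\<lambda>t. LINT x|lebesgue_on \<Omega>. e (t, x)"
  have en: "energy a \<gamma> \<Omega> (\<rho> t) (m t) = ?en t" if "t \<in> {0..<T}" for t
    unfolding energy_def
    by (intro Bochner_Integration.integral_cong refl edens that sp) (simp add: space_restrict_space)
  let ?M = "\<lambda>t. LINT x|lebesgue_on \<Omega>. r (t, x) * (u (t, x) \<bullet> u (t, x))"
  let ?G = "\<lambda>t. LINT x|lebesgue_on \<Omega>. g (t, x)"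
  \<comment> \<open>By the flux identity and the continuity equation, \<open>?G\<close> is the time derivative of \<open>?M - ?en\<close>.\<close>
  have Gint: "(LINT t|lebesgue_on {0..\<tau>}. ?G t) = (?M \<tau> - ?en \<tau>) - (?M 0 - ?en 0)"
    if \<tau>: "0 < \<tau>" "\<tau> < T" for \<tau>
  proof -
    have sub: "{0..\<tau>} \<subseteq> {0..<T}" using \<tau> by auto
    have "(?G has_integral (?M \<tau> - ?en \<tau>) - (?M 0 - ?en 0)) {0..\<tau>}"
    proof (rule fundamental_theorem_of_calculus_interior)
      show "continuous_on {0..\<tau>} (\<lambda>t. ?M t - ?en t)"
        by (intro continuous_on_diff continuous_on_subset[OF continuous_on_parameter_integral[OF \<Omega>, of "{0..<T}" "\<lambda>z. r z * (u z \<bullet> u z)"] sub]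
            continuous_on_subset[OF continuous_on_parameter_integral[OF \<Omega>] sub] C1_deriv_onD(3)[OF f'] C1_deriv_onD(3)[OF e])
      fix t assume "t \<in> {0<..<\<tau>}"
      then have t: "0 < t" "t < T" using \<tau> by auto
      have ts: "t \<in> {0..<T}" using t by auto
      have i1: "integrable (lebesgue_on \<Omega>) (\<lambda>x. f' (t, x) (1, 0))"
        by (rule integrable_slice[OF \<Omega> _ ts, of "\<lambda>z. f' z (1, 0)"]) (intro continuous_intros C1_deriv_onD(2)[OF f'])
      have i2: "integrable (lebesgue_on \<Omega>) (\<lambda>x. e' (t, x) (1, 0))"
        by (rule integrable_slice[OF \<Omega> _ ts, of "\<lambda>z. e' z (1, 0)"]) (intro continuous_intros C1_deriv_onD(2)[OF e])
      have i3: "integrable (lebesgue_on \<Omega>) (\<lambda>x. g (t, x))"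
        by (rule integrable_slice[OF \<Omega> gc ts])
      have "(LINT x|lebesgue_on \<Omega>. f' (t, x) (1, 0) - g (t, x) - e' (t, x) (1, 0)) =
          (LINT x|lebesgue_on \<Omega>. \<rho>' (t, x) (1, 0) * \<phi> (t, x) - \<phi>' (t, x) (0, m t x))"
        using t by (intro Bochner_Integration.integral_cong) (auto simp: identity space_restrict_space)
      also have "\<dots> = 0"
        by (rule continuity_equation_instant[OF \<Omega> cont \<rho> C1_deriv_onD(3)[OF m] \<phi> t])
      finally have "(LINT x|lebesgue_on \<Omega>. f' (t, x) (1, 0)) - (LINT x|lebesgue_on \<Omega>. e' (t, x) (1, 0)) = ?G t"
        using i1 i2 i3 by simp
      moreover have "((\<lambda>t. ?M t - ?en t) has_real_derivative
          (LINT x|lebesgue_on \<Omega>. f' (t, x) (1, 0)) - (LINT x|lebesgue_on \<Omega>. e' (t, x) (1, 0))) (at t)"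
        by (intro DERIV_diff integral_has_time_derivative[OF \<Omega> _ t] f' e)
      ultimately show "((\<lambda>t. ?M t - ?en t) has_vector_derivative ?G t) (at t)"
        by (simp add: has_real_derivative_iff_has_vector_derivative)
    qed (use \<tau> in simp)
    moreover have "continuous_on {0..\<tau>} ?G"
      by (rule continuous_on_subset[OF continuous_on_parameter_integral[OF \<Omega> gc] sub])
    ultimately show ?thesis by (simp add: LINT_eq_integral_interval integral_unique)
  qed
  show ?thesis
  proof (rule that[of V])
    show "continuous_on ?S V" by (rule C1_deriv_onD(2)[OF V])
    fix \<tau> assume \<tau>: "0 < \<tau>" "\<tau> < T"
    let ?X = "LINT t|lebesgue_on {0..\<tau>}.
         matrix_integral (closure \<Omega>) (\<lambda>A. Rv t A + measure (Rp t) A *\<^sub>R mat 1)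
           (\<lambda>x. vgrad (blinfun_apply (V (t, x))))"
    have "u (t, x) \<bullet> n = 0" if "t \<in> {0..<T}" "x \<in> frontier \<Omega>" "outer_normal \<Omega> x n" for t x n
      using impermeable_boundary[OF \<Omega> cont \<rho> C1_deriv_onD(3)[OF m], of t x n] that by (simp add: u_def w_def)
    from momentum_equation_weak_uncut[OF \<Omega> mom V this \<tau>]
    have "(LINT x|lebesgue_on \<Omega>. m \<tau> x \<bullet> u (\<tau>, x)) - (LINT x|lebesgue_on \<Omega>. m\<^sub>0 x \<bullet> u (0, x)) =
        (LINT t|lebesgue_on {0..\<tau>}. ?G t) + ?X"
      by (simp add: g_def w_def r_def)
    moreover have M: "(LINT x|lebesgue_on \<Omega>. m t x \<bullet> u (t, x)) = ?M t" if "t \<in> {0..<T}" for t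
    proof (intro Bochner_Integration.integral_cong refl)
      fix x assume "x \<in> space (lebesgue_on \<Omega>)"
      then have "(t, x) \<in> ?S" using that sp by (auto simp: space_restrict_space)
      from wu[OF this] show "m t x \<bullet> u (t, x) = r (t, x) * (u (t, x) \<bullet> u (t, x))" by (simp add: w_def)
    qed
    moreover have "(LINT x|lebesgue_on \<Omega>. m\<^sub>0 x \<bullet> u (0, x)) = (LINT x|lebesgue_on \<Omega>. m 0 x \<bullet> u (0, x))"
    proof (rule sym, rule integral_lebesgue_on_cong_AE)
      have "continuous_on ?S (\<lambda>z. w z \<bullet> u z)"
        by (intro continuous_intros C1_deriv_onD(3)[OF w] C1_deriv_onD(3)[OF V])
      then have "integrable (lebesgue_on \<Omega>) (\<lambda>x. w (0, x) \<bullet> u (0, x))"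
        using \<tau> by (intro integrable_slice[OF \<Omega>, of "{0..<T}" "\<lambda>z. w z \<bullet> u z"]) auto
      then show "(\<lambda>x. m 0 x \<bullet> u (0, x)) \<in> borel_measurable (lebesgue_on \<Omega>)" by (simp add: w_def)
      show "AE x in lebesgue_on \<Omega>. m 0 x \<bullet> u (0, x) = m\<^sub>0 x \<bullet> u (0, x)"
        using ini by eventually_elim simp
    qed (use \<Omega> in auto)
    ultimately show "energy a \<gamma> \<Omega> (\<rho> \<tau>) (m \<tau>) - energy a \<gamma> \<Omega> (\<rho> 0) (m 0) = ?X"
      using \<tau> Gint[OF \<tau>] en[of \<tau>] en[of 0] M[of \<tau>] M[of 0] by simp
  qed
qed

section \<open>Vanishing of the defect\<close>

text \<open>
  Choose a test function that is \<open>1\<close> on \<open>[0,t]\<close>; then the right-hand side of the energy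
  inequality vanishes.
\<close>

lemma energy_inequality_right_limit:
  assumes E: "energy_inequality T E0 E" and t: "0 \<le> t" "t < T"
  shows "\<exists>l\<le>E0. (E \<longlongrightarrow> l) (at_right t)"
proof -
  obtain l where l: "(E \<longlongrightarrow> l) (at_right t)"
    using E t unfolding energy_inequality_def by fastforce
  define a b where "a = (2 * t + T) / 3" and "b = (t + 2 * T) / 3"
  have ab: "t < a" "a < b" "b < T" using t by (auto simp: a_def b_def)
  obtain \<eta> \<eta>' where \<eta>: "\<And>t. (\<eta> has_real_derivative \<eta>' t) (at t)" "continuous_on UNIV \<eta>'"
    "\<And>t. 0 \<le> \<eta> t" "\<And>t. t \<le> a \<Longrightarrow> \<eta> t = 1 \<and> \<eta>' t = 0" "\<And>t. b \<le> t \<Longrightarrow> \<eta> t = 0"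
    using time_cutoff_exists[OF ab(2)] by metis
  have d: "(\<eta> has_derivative (\<lambda>h. \<eta>' s * h)) (at s within {0..<T})" for s
    using \<eta>(1)[of s] by (simp add: has_field_derivative_def has_derivative_at_withinI)
  have c: "continuous_on {0..<T} (\<lambda>s. \<eta>' s * v)" for v
    by (intro continuous_intros continuous_on_subset[OF \<eta>(2)]) simp
  let ?\<psi>' = "\<lambda>s. Blinfun (\<lambda>h. \<eta>' s * h)"
  have \<psi>: "C1c_deriv_on {0..<T} \<eta> ?\<psi>'"
    unfolding C1c_deriv_on_def
  proof (intro conjI C1_deriv_on_Blinfun(1) d c exI[of _ "{0..b}"])
    show "\<forall>z\<in>{0..<T} - {0..b}. \<eta> z = 0" using \<eta>(5) by auto
  qed (use ab in auto)
  have "\<And>\<tau>1 \<tau>2 \<psi> \<psi>'. 0 \<le> \<tau>1 \<and> \<tau>1 \<le> \<tau>2 \<and> \<tau>2 < T \<and>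
        C1c_deriv_on {0..<T} \<psi> \<psi>' \<and> (\<forall>t\<in>{0..<T}. 0 \<le> \<psi> t) \<Longrightarrow>
        \<psi> \<tau>2 * Lim (at_right \<tau>2) E - \<psi> \<tau>1 * (if \<tau>1 = 0 then E0 else Lim (at_left \<tau>1) E)
          \<le> (LINT t|lebesgue_on {\<tau>1..\<tau>2}. blinfun_apply (\<psi>' t) 1 * E t)"
    using E unfolding energy_inequality_def by blast
  from this[of 0 t \<eta> ?\<psi>'] have "\<eta> t * Lim (at_right t) E - \<eta> 0 * E0
      \<le> (LINT s|lebesgue_on {0..t}. blinfun_apply (?\<psi>' s) 1 * E s)"
    using \<psi> t \<eta>(3) by simp
  also have "\<dots> = (LINT s|lebesgue_on {0..t}. 0)"
  proof (intro Bochner_Integration.integral_cong refl)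
    fix s assume "s \<in> space (lebesgue_on {0..t})"
    then have "s \<in> {0..<T}" "\<eta>' s = 0" using ab \<eta>(4)[of s] by (auto simp: space_restrict_space)
    then show "blinfun_apply (?\<psi>' s) 1 * E s = 0"
      using C1_deriv_on_Blinfun(2)[of "{0..<T}" \<eta> "\<lambda>s h. \<eta>' s * h" s] d c by simp
  qed
  finally have "Lim (at_right t) E \<le> E0" using \<eta>(4)[of t] \<eta>(4)[of 0] ab t by simp
  moreover have "Lim (at_right t) E = l" using l by (intro tendsto_Lim) auto
  ultimately show ?thesis using l by blast
qed

lemma space_in_restrict_borel: "K \<in> sets (restrict_space borel K)"
  by (metis sets.top space_restrict_space space_borel Int_UNIV_right)

lemma nonneg_measure_on_space: "nonneg_measure_on K \<mu> \<Longrightarrow> space \<mu> = K"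
  unfolding nonneg_measure_on_def using sets_eq_imp_space_eq[of \<mu> "restrict_space borel K"]
  by (simp add: space_restrict_space)

lemma trace_nonneg_matrix_measure:
  assumes "nonneg_sym_matrix_measure_on K R"
  shows "0 \<le> trace (R K)"
  using nonneg_sym_matrix_measure_entry_bound[OF assms space_in_restrict_borel, of undefined undefined] by linarith

text \<open>
  This is the key estimate: the work of the defect is controlled by the defect energy.
\<close>

lemma defect_integral_bound:
  fixes R :: "'a::topological_space set \<Rightarrow> real^'n^'n"
  assumes R: "nonneg_sym_matrix_measure_on K R" and \<mu>: "nonneg_measure_on K \<mu>"
    and G: "\<And>x i j. x \<in> K \<Longrightarrow> \<bar>G x $ i $ j\<bar> \<le> F" and F: "0 \<le> F"
  shows "\<bar>matrix_integral K (\<lambda>A. R A + measure \<mu> A *\<^sub>R mat 1) G\<bar>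
    \<le> 2 * F * (real CARD('n))\<^sup>2 * (trace (R K) + measure \<mu> K)"
proof (rule matrix_integral_bound[OF _ _ G F])
  interpret finite_measure \<mu> using \<mu> by (simp add: nonneg_measure_on_def)
  show "0 \<le> trace (R K) + measure \<mu> K" using trace_nonneg_matrix_measure[OF R] by simp
  fix B i j assume B: "B \<in> sets (restrict_space borel K)"
  have "\<bar>(R B + measure \<mu> B *\<^sub>R mat 1) $ i $ j\<bar> \<le> \<bar>R B $ i $ j\<bar> + \<bar>measure \<mu> B * (mat 1 :: real^'n^'n) $ i $ j\<bar>"
    by (simp add: abs_triangle_ineq)
  also have "\<dots> \<le> trace (R K) + measure \<mu> K"
  proof (rule add_mono)
    show "\<bar>R B $ i $ j\<bar> \<le> trace (R K)" by (rule nonneg_sym_matrix_measure_entry_bound[OF R B])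
    show "\<bar>measure \<mu> B * (mat 1 :: real^'n^'n) $ i $ j\<bar> \<le> measure \<mu> K"
      using bounded_measure[of B] nonneg_measure_on_space[OF \<mu>] by (simp add: mat_def)
  qed
  finally show "\<bar>(R B + measure \<mu> B *\<^sub>R mat 1) $ i $ j\<bar> \<le> trace (R K) + measure \<mu> K" .
qed

lemma vgrad_entry_bound:
  fixes L :: "(real \<times> (real^'n)) \<Rightarrow>\<^sub>L (real^'n)"
  shows "\<bar>vgrad (blinfun_apply L) $ i $ j\<bar> \<le> norm L"
proof -
  have "\<bar>L (0, axis j 1) $ i\<bar> \<le> norm (L (0, axis j 1))" by (rule component_le_norm_cart)
  also have "\<dots> \<le> norm L * norm (0 :: real, axis j 1 :: real^'n)" by (rule norm_blinfun)
  finally show ?thesis by (simp add: vgrad_def norm_Pair)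
qed

lemma mean_energy_eq_energy:
  assumes \<Omega>: "open \<Omega>" "bounded \<Omega>" and \<gamma>: "\<gamma> > 1" and a: "a > 0"
    and r: "continuous_on (closure \<Omega>) r" and w: "continuous_on (closure \<Omega>) w"
    and pos: "\<And>x. x \<in> closure \<Omega> \<Longrightarrow> r x > 0"
  shows "mean_energy a \<gamma> \<Omega> r w = ennreal (energy a \<gamma> \<Omega> r w)" and "0 \<le> energy a \<gamma> \<Omega> r w"
proof -
  let ?e = "\<lambda>x. 1/2 * ((norm (w x))\<^sup>2 / r x) + pressure_potential a \<gamma> (r x)"
  have sp: "x \<in> closure \<Omega>" if "x \<in> \<Omega>" for x using that closure_subset by auto
  have nn: "0 \<le> pressure_potential a \<gamma> y" for y using a \<gamma> by (simp add: pressure_potential_def)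
  have e0: "0 \<le> ?e x" if "x \<in> \<Omega>" for x using pos[OF sp[OF that]] nn by simp
  have "continuous_on (closure \<Omega>) ?e"
    unfolding pressure_potential_def by (intro continuous_intros r w) (use pos in force)+
  then have int: "integrable (lebesgue_on \<Omega>) ?e" by (rule integrable_up_to_boundary[OF \<Omega>])
  have "mean_energy a \<gamma> \<Omega> r w = (\<integral>\<^sup>+ x. ennreal (?e x) \<partial>lebesgue_on \<Omega>)"
    unfolding mean_energy_def
  proof (rule nn_integral_cong)
    fix x assume "x \<in> space (lebesgue_on \<Omega>)"
    then have x: "r x > 0" using pos sp by (auto simp: space_restrict_space)
    then have k: "kinetic (r x) (w x) = ennreal ((norm (w x))\<^sup>2 / r x)" by (simp add: kinetic_def)
    have "ennreal (1/2) * kinetic (r x) (w x) = ennreal (1/2 * ((norm (w x))\<^sup>2 / r x))"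
      unfolding k using x by (subst ennreal_mult) auto
    then show "ennreal (1/2) * kinetic (r x) (w x) + ennreal (pressure_potential a \<gamma> (r x)) = ennreal (?e x)"
      using x nn by (subst ennreal_plus) auto
  qed
  also have "\<dots> = ennreal (energy a \<gamma> \<Omega> r w)"
    unfolding energy_def by (intro nn_integral_eq_integral int AE_I2 e0) (simp add: space_restrict_space)
  finally show "mean_energy a \<gamma> \<Omega> r w = ennreal (energy a \<gamma> \<Omega> r w)" .
  show "0 \<le> energy a \<gamma> \<Omega> r w"
    unfolding energy_def by (intro integral_nonneg_AE AE_I2 e0) (simp add: space_restrict_space)
qed

text \<open>
  Let \<open>D\<close> be the defect energy. The energy inequality gives \<open>D t \<le> energy 0 - energy t\<close> for almost
  every \<open>t\<close>, and by the energy balance the right-hand side is minus the work of the defect over \<open>[0,t]\<close>.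
  On \<open>[0,T1]\<close> with \<open>T1 < T\<close> the gradient of the velocity is bounded, so this work is at most a
  constant times the integral of \<open>D\<close>, and Gronwall applies. The bound may blow up at \<open>T\<close>, which is why
  \<open>(0,T)\<close> is exhausted by smaller intervals.
\<close>

lemma defects_vanish:
  fixes \<rho> :: "real \<Rightarrow> real^'n \<Rightarrow> real" and m :: "real \<Rightarrow> real^'n \<Rightarrow> real^'n"
  assumes \<Omega>: "open \<Omega>" "bounded \<Omega>" and \<gamma>: "\<gamma> > 1" and a: "a > 0"
    and ds: "dissipative_solution a \<gamma> T \<Omega> \<rho>\<^sub>0 m\<^sub>0 \<rho> m Rv Rp"
    and \<rho>: "C1_deriv_on ({0..<T} \<times> closure \<Omega>) (\<lambda>(t, x). \<rho> t x) \<rho>'"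
    and m: "C1_deriv_on ({0..<T} \<times> closure \<Omega>) (\<lambda>(t, x). m t x) m'"
    and pos: "\<And>t x. t \<in> {0..<T} \<Longrightarrow> x \<in> closure \<Omega> \<Longrightarrow> \<rho> t x > 0"
  shows "AE t in lebesgue_on {0<..<T}. trace (Rv t (closure \<Omega>)) = 0 \<and> measure (Rp t) (closure \<Omega>) = 0"
proof -
  let ?K = "closure \<Omega>"
  let ?S = "{0..<T} \<times> ?K"
  have K: "compact ?K" using \<Omega> by (simp add: compact_closure)
  have cont: "continuity_equation_weak T \<Omega> \<rho>\<^sub>0 \<rho> m"
    and mom: "momentum_equation_weak a \<gamma> T \<Omega> m\<^sub>0 \<rho> m Rv Rp"
    and ini: "AE x in lebesgue_on \<Omega>. \<rho> 0 x = \<rho>\<^sub>0 x" "AE x in lebesgue_on \<Omega>. m 0 x = m\<^sub>0 x"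
    and Rv: "\<And>t. t \<in> {0<..<T} \<Longrightarrow> nonneg_sym_matrix_measure_on ?K (Rv t)"
    and Rp: "\<And>t. t \<in> {0<..<T} \<Longrightarrow> nonneg_measure_on ?K (Rp t)"
    using ds unfolding dissipative_solution_def Linf_matrix_measures_def Linf_measures_def by blast+
  obtain E where E: "AE t in lebesgue_on {0<..<T}. E t = enn2real (total_energy a \<gamma> \<Omega> \<rho> m Rv Rp t)"
    and ineq: "energy_inequality T (enn2real (mean_energy a \<gamma> \<Omega> \<rho>\<^sub>0 m\<^sub>0)) E"
    using ds unfolding dissipative_solution_def by (auto simp: AE_conj_iff)
  define en where "en t = energy a \<gamma> \<Omega> (\<rho> t) (m t)" for t
  \<comment> \<open>The defect part of the total energy.\<close>
  define D where "D t = 1/2 * trace (Rv t ?K) + 1 / (\<gamma> - 1) * measure (Rp t) ?K" for t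
  have D_nn: "0 \<le> trace (Rv t ?K)" "0 \<le> 1 / (\<gamma> - 1) * measure (Rp t) ?K" if "t \<in> {0<..<T}" for t
    using trace_nonneg_matrix_measure[OF Rv[OF that]] \<gamma> by auto
  have men: "mean_energy a \<gamma> \<Omega> (\<rho> t) (m t) = ennreal (en t)" "0 \<le> en t" if t: "t \<in> {0..<T}" for t
  proof -
    have "continuous_on ?K (\<rho> t)" "continuous_on ?K (m t)"
      using continuous_on_slice[OF C1_deriv_onD(3)[OF \<rho>] t] continuous_on_slice[OF C1_deriv_onD(3)[OF m] t] by simp_all
    then show "mean_energy a \<gamma> \<Omega> (\<rho> t) (m t) = ennreal (en t)" "0 \<le> en t"
      using mean_energy_eq_energy[OF \<Omega> \<gamma> a] pos[OF t] unfolding en_def by blast+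
  qed
  have E0: "enn2real (mean_energy a \<gamma> \<Omega> \<rho>\<^sub>0 m\<^sub>0) = en 0" if "0 < T"
  proof -
    have "mean_energy a \<gamma> \<Omega> \<rho>\<^sub>0 m\<^sub>0 = mean_energy a \<gamma> \<Omega> (\<rho> 0) (m 0)"
      unfolding mean_energy_def by (rule nn_integral_cong_AE) (use ini in \<open>eventually_elim; simp\<close>)
    then show ?thesis using men[of 0] that by simp
  qed
  have te: "enn2real (total_energy a \<gamma> \<Omega> \<rho> m Rv Rp t) = en t + D t" if "t \<in> {0<..<T}" for t
  proof -
    have "total_energy a \<gamma> \<Omega> \<rho> m Rv Rp t = ennreal (en t + D t)"
      unfolding total_energy_def D_def using men[of t] D_nn[OF that] that by (simp add: ennreal_plus add.assoc)
    moreover have "0 \<le> en t + D t" using men[of t] D_nn[OF that] that by (simp add: D_def)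
    ultimately show ?thesis by simp
  qed
  have memb: "AE t in lebesgue_on {0<..<T}. t \<in> {0<..<T}" for T :: real
    by (rule AE_I2) (simp add: space_restrict_space)
  have Dle: "AE t in lebesgue_on {0<..<T}. D t \<le> en 0 - en t"
  proof -
    have "AE t in lebesgue_on {0<..<T}. E t \<le> enn2real (mean_energy a \<gamma> \<Omega> \<rho>\<^sub>0 m\<^sub>0)"
      by (rule AE_le_of_right_limits_le) (use energy_inequality_right_limit[OF ineq] in auto)
    with E memb show ?thesis
    proof eventually_elim
      case (elim t)
      then show ?case using te[of t] E0 by auto
    qed
  qed
  obtain V where V: "continuous_on ?S V" and bal: "\<And>\<tau>. 0 < \<tau> \<Longrightarrow> \<tau> < T \<Longrightarrow>
      energy a \<gamma> \<Omega> (\<rho> \<tau>) (m \<tau>) - energy a \<gamma> \<Omega> (\<rho> 0) (m 0) = (LINT t|lebesgue_on {0..\<tau>}.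
         matrix_integral ?K (\<lambda>A. Rv t A + measure (Rp t) A *\<^sub>R mat 1)
           (\<lambda>x. vgrad (blinfun_apply (V (t, x)))))"
  proof (rule energy_balance[OF \<Omega> \<gamma> cont mom \<rho> m pos ini(2)])
  qed (assumption | rule that)+
  note bal = bal[folded en_def]
  let ?X = "\<lambda>t. matrix_integral ?K (\<lambda>A. Rv t A + measure (Rp t) A *\<^sub>R mat 1)
           (\<lambda>x. vgrad (blinfun_apply (V (t, x))))"
  have restrict: "AE t in lebesgue_on {0<..<T1}. P t" if "AE t in lebesgue_on {0<..<T}. P t" "T1 \<le> T" for T1 P
  proof -
    have "AE t in lebesgue. t \<in> {0<..<T} \<longrightarrow> P t" using that(1) by (subst (asm) AE_restrict_space_iff) auto
    then have "AE t in lebesgue. t \<in> {0<..<T1} \<longrightarrow> P t" by eventually_elim (use that(2) in auto)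
    then show ?thesis by (subst AE_restrict_space_iff) auto
  qed
  have D0: "AE t in lebesgue_on {0<..<T1}. D t \<le> 0" if T1: "T1 < T" for T1
  proof -
    have "compact ({0..T1} \<times> ?K)" using K by (intro compact_Times) auto
    moreover have "continuous_on ({0..T1} \<times> ?K) V"
      by (rule continuous_on_subset[OF V]) (use T1 in auto)
    ultimately obtain F where F: "F > 0" "\<And>z. z \<in> {0..T1} \<times> ?K \<Longrightarrow> norm (V z) \<le> F"
      by (rule bounded_on_compact) blast
    define c where "c = 2 * F * (real CARD('n))\<^sup>2"
    have c: "c \<ge> 0" using F by (simp add: c_def)
    have X: "\<bar>?X t\<bar> \<le> c * (2 + (\<gamma> - 1)) * D t" if t: "t \<in> {0<..<T1}" for t
    proof -
      have t': "t \<in> {0<..<T}" using t T1 by auto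
      have "\<bar>?X t\<bar> \<le> c * (trace (Rv t ?K) + measure (Rp t) ?K)"
        unfolding c_def
      proof (rule defect_integral_bound[OF Rv[OF t'] Rp[OF t']])
        fix x i j assume "x \<in> ?K"
        then show "\<bar>vgrad (blinfun_apply (V (t, x))) $ i $ j\<bar> \<le> F"
          using F(2)[of "(t, x)"] vgrad_entry_bound[of "V (t, x)" i j] t by force
      qed (use F in simp)
      also have "\<dots> \<le> c * ((2 + (\<gamma> - 1)) * D t)"
      proof (rule mult_left_mono[OF _ c])
        have "(2 + (\<gamma> - 1)) * D t = trace (Rv t ?K) + measure (Rp t) ?K
            + (\<gamma> - 1) * (1/2 * trace (Rv t ?K)) + 2 * (1 / (\<gamma> - 1) * measure (Rp t) ?K)"
          using \<gamma> by (simp add: D_def field_simps)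
        moreover have "0 \<le> (\<gamma> - 1) * (1/2 * trace (Rv t ?K))" using D_nn[OF t'] \<gamma> by simp
        ultimately show "trace (Rv t ?K) + measure (Rp t) ?K \<le> (2 + (\<gamma> - 1)) * D t"
          using D_nn[OF t'] by linarith
      qed
      finally show ?thesis by (simp add: mult.assoc)
    qed
    show ?thesis
    proof (rule gronwall_AE[where X = ?X and C = "c * (2 + (\<gamma> - 1))" and M = "en 0"])
      show "0 \<le> c * (2 + (\<gamma> - 1))" using c \<gamma> by simp
      note Dle' = restrict[OF Dle less_imp_le[OF T1]]
      show "AE t in lebesgue_on {0<..<T1}. D t \<le> en 0"
        using Dle' memb
      proof eventually_elim
        case (elim t)
        then have "0 \<le> en t" using T1 by (intro men(2)) auto
        with elim show ?case by simp
      qed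
      show "AE \<tau> in lebesgue_on {0<..<T1}. D \<tau> \<le> - (LINT t|lebesgue_on {0..\<tau>}. ?X t)"
        using Dle' memb
      proof eventually_elim
        case (elim \<tau>)
        then show ?case using bal[of \<tau>] T1 by simp
      qed
      show "AE t in lebesgue_on {0<..<T1}. \<bar>?X t\<bar> \<le> c * (2 + (\<gamma> - 1)) * D t"
        using memb by eventually_elim (rule X)
    qed
  qed
  have "AE t in lebesgue. \<forall>n. t \<in> {0<..<T - 1 / real (Suc n)} \<longrightarrow> D t \<le> 0"
  proof (subst AE_all_countable, intro allI)
    fix n
    have "AE t in lebesgue_on {0<..<T - 1 / real (Suc n)}. D t \<le> 0" by (rule D0) simp
    then show "AE t in lebesgue. t \<in> {0<..<T - 1 / real (Suc n)} \<longrightarrow> D t \<le> 0"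
      by (subst (asm) AE_restrict_space_iff) auto
  qed
  then have "AE t in lebesgue. t \<in> {0<..<T} \<longrightarrow> trace (Rv t ?K) = 0 \<and> measure (Rp t) ?K = 0"
  proof eventually_elim
    case (elim t)
    show ?case
    proof
      assume t: "t \<in> {0<..<T}"
      then obtain n where "inverse (real (Suc n)) < T - t" using reals_Archimedean[of "T - t"] by auto
      then have "t \<in> {0<..<T - 1 / real (Suc n)}" using t by (auto simp: inverse_eq_divide)
      then have "D t \<le> 0" using elim by blast
      then have "trace (Rv t ?K) = 0" "1 / (\<gamma> - 1) * measure (Rp t) ?K = 0"
        using D_nn[OF t] unfolding D_def by linarith+
      then show "trace (Rv t ?K) = 0 \<and> measure (Rp t) ?K = 0" using \<gamma> by simp
    qed
  qed
  then show ?thesis by (subst AE_restrict_space_iff) auto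
qed

section \<open>The momentum equation without defect\<close>

lemma bounded_bilinear_tensor: "bounded_bilinear (\<otimes>\<^sub>t)"
  unfolding bilinear_conv_bounded_bilinear[symmetric] bilinear_def
  by (auto intro!: linearI simp: tensor_def vec_eq_iff algebra_simps)

text \<open>
  Test the equation for the \<open>i\<close>-th component with a bump times the \<open>i\<close>-th unit vector; the flux of this
  component is the \<open>i\<close>-th row of \<open>m \<otimes> m / \<rho>\<close> plus \<open>p e\<^sub>i\<close>.
\<close>

lemma momentum_equation_pointwise:
  fixes \<rho> :: "real \<Rightarrow> real^'n \<Rightarrow> real" and m :: "real \<Rightarrow> real^'n \<Rightarrow> real^'n"
  assumes \<Omega>: "open \<Omega>" "bounded \<Omega>"
    and mom: "momentum_equation_weak a \<gamma> T \<Omega> m\<^sub>0 \<rho> m Rv Rp"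
    and Rv: "\<And>t. t \<in> {0<..<T} \<Longrightarrow> nonneg_sym_matrix_measure_on (closure \<Omega>) (Rv t)"
    and Rp: "\<And>t. t \<in> {0<..<T} \<Longrightarrow> nonneg_measure_on (closure \<Omega>) (Rp t)"
    and no_defect: "AE t in lebesgue_on {0<..<T}. trace (Rv t (closure \<Omega>)) = 0 \<and> measure (Rp t) (closure \<Omega>) = 0"
    and \<rho>: "C1_deriv_on ({0..<T} \<times> closure \<Omega>) (\<lambda>(t, x). \<rho> t x) \<rho>'"
    and m: "C1_deriv_on ({0..<T} \<times> closure \<Omega>) (\<lambda>(t, x). m t x) m'"
    and W: "C1_deriv_on ({0..<T} \<times> closure \<Omega>) (\<lambda>(t, x). (m t x \<otimes>\<^sub>t m t x) /\<^sub>R \<rho> t x) W'"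
    and P: "C1_deriv_on ({0..<T} \<times> closure \<Omega>) (\<lambda>(t, x). pressure a \<gamma> (\<rho> t x)) P'"
    and tx: "0 < t" "t < T" "x \<in> \<Omega>"
  shows "dt (m' (t, x)) + mdiv (W' (t, x)) + grad (P' (t, x)) = 0"
proof -
  let ?K = "closure \<Omega>"
  let ?S = "{0..<T} \<times> ?K"
  have K: "compact ?K" using \<Omega> by (simp add: compact_closure)
  have sp: "x \<in> ?K" if "x \<in> \<Omega>" for x using that closure_subset by auto
  have ts: "t \<in> {0..<T}" using tx by auto
  define w where "w = (\<lambda>(t, x). m t x)"
  define A where "A = (\<lambda>(t, x). (m t x \<otimes>\<^sub>t m t x) /\<^sub>R \<rho> t x)"
  define p where "p = (\<lambda>(t, x). pressure a \<gamma> (\<rho> t x))"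
  have w: "C1_deriv_on ?S w m'" and A: "C1_deriv_on ?S A W'" and p: "C1_deriv_on ?S p P'"
    using m W P by (simp_all add: w_def A_def p_def)
  have c: "continuous_on \<Omega> (\<lambda>x. k (t, x))" if "continuous_on ?S k" for k :: "real \<times> (real^'n) \<Rightarrow> 'b::topological_space"
    by (rule continuous_on_subset[OF continuous_on_slice[OF that ts] closure_subset])
  have comp: "m' (t, x) (1, 0) $ i + (\<Sum>j\<in>UNIV. (W' (t, x) (0, axis j 1) $ i
      + P' (t, x) (0, axis j 1) *\<^sub>R axis i 1) $ j) = 0" for i
  proof (rule weak_divergence_pointwise[OF \<Omega>(1) tx(3), where g = "\<lambda>x. m' (t, x) (1, 0) $ i"
        and F = "\<lambda>x. A (t, x) $ i + p (t, x) *\<^sub>R axis i 1"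
        and F' = "\<lambda>x v. W' (t, x) (0, v) $ i + P' (t, x) (0, v) *\<^sub>R axis i 1"])
    show gc: "continuous_on \<Omega> (\<lambda>x. m' (t, x) (1, 0) $ i)"
      by (rule c) (intro continuous_intros C1_deriv_onD(2)[OF w])
    show "((\<lambda>x. A (t, x) $ i + p (t, x) *\<^sub>R axis i 1) has_derivative
        (\<lambda>v. W' (t, y) (0, v) $ i + P' (t, y) (0, v) *\<^sub>R axis i 1)) (at y)" if "y \<in> \<Omega>" for y
      by (intro has_derivative_add bounded_linear.has_derivative[OF bounded_linear_vec_nth]
          has_derivative_scaleR_left interior_space_time_has_derivative(2)[OF _ \<Omega>(1) tx(1,2) that] A p)
    show "continuous_on \<Omega> (\<lambda>x. W' (t, x) (0, v) $ i + P' (t, x) (0, v) *\<^sub>R axis i 1)" for v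
      by (intro continuous_intros c[of "\<lambda>z. W' z (0, v)"] c[of "\<lambda>z. P' z (0, v)"]
          C1_deriv_onD(2)[OF A] C1_deriv_onD(2)[OF p])
    fix r :: real assume r: "r > 0" "cball x r \<subseteq> \<Omega>"
    let ?b = "bump x r" and ?b' = "bump_deriv x r"
    obtain b' where b': "C1_deriv_on ?K ?b b'" "\<And>y v. y \<in> ?K \<Longrightarrow> b' y v = ?b' y v"
      using bump_C1_deriv_on[of ?K x r] by metis
    obtain q where q: "C1_deriv_on ?S (\<lambda>z. ?b (snd z)) q"
      "\<And>z v. z \<in> ?S \<Longrightarrow> q z v = b' (snd z) (snd v)"
      using C1_deriv_on_space_function[OF b'(1), of "{0..<T}"] by metis
    have qv: "q (s, y) v = ?b' y (snd v)" if "s \<in> {0..<T}" "y \<in> ?K" for s y v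
      using q(2)[of "(s, y)" v] b'(2)[of y "snd v"] that by simp
    have const: "C1_deriv_on ?S (\<lambda>z. axis i 1 :: real^'n) (\<lambda>z. 0)"
      by (simp add: C1_deriv_on_def zero_blinfun.rep_eq)
    define \<phi> where "\<phi> z = ?b (snd z) *\<^sub>R (axis i 1 :: real^'n)" for z :: "real \<times> (real^'n)"
    obtain \<phi>' where \<phi>': "C1_deriv_on ?S \<phi> \<phi>'" "\<And>z v. z \<in> ?S \<Longrightarrow> \<phi>' z v = q z v *\<^sub>R axis i 1"
      using C1_deriv_on_bilinear[OF bounded_bilinear_scaleR q(1) const] unfolding \<phi>_def
      by (auto simp: zero_blinfun.rep_eq)
    have \<phi>'v: "\<phi>' (s, y) v = ?b' y (snd v) *\<^sub>R axis i 1" if "s \<in> {0..<T}" "y \<in> ?K" for s y v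
      using \<phi>'(2)[of "(s, y)" v] qv[OF that] that by simp
    have b'lin: "linear (?b' y)" for y by (rule has_derivative_linear[OF bump_has_derivative])
    define F where "F z = A z $ i + p z *\<^sub>R axis i 1" for z
    have integrand: "m s y \<bullet> \<phi>' (s, y) (1, 0) + inverse (\<rho> s y) * (m s y \<bullet> \<phi>' (s, y) (0, m s y)) +
        pressure a \<gamma> (\<rho> s y) * vdiv (\<phi>' (s, y)) = ?b' y (F (s, y))"
      if "s \<in> {0..<T}" "y \<in> ?K" for s y
    proof -
      have "A (s, y) $ i = (inverse (\<rho> s y) * m s y $ i) *\<^sub>R m s y"
        by (simp add: A_def tensor_def vec_eq_iff)
      then have "?b' y (F (s, y)) = inverse (\<rho> s y) * m s y $ i * ?b' y (m s y) + pressure a \<gamma> (\<rho> s y) * ?b' y (axis i 1)"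
        by (simp add: F_def p_def linear_add[OF b'lin] linear_scale[OF b'lin])
      moreover have "vdiv (\<phi>' (s, y)) = ?b' y (axis i 1)"
      proof -
        have "vdiv (\<phi>' (s, y)) = (\<Sum>j\<in>UNIV. if j = i then ?b' y (axis j 1) else 0)"
          unfolding vdiv_def by (rule sum.cong) (auto simp: \<phi>'v[OF that] axis_def)
        then show ?thesis by simp
      qed
      ultimately show ?thesis
        by (simp add: \<phi>'v[OF that] linear_0[OF b'lin] inner_axis)
    qed
    obtain f' where f': "C1_deriv_on ?S (\<lambda>z. w z \<bullet> \<phi> z) f'"
      "\<And>z v. z \<in> ?S \<Longrightarrow> f' z v = w z \<bullet> \<phi>' z v + m' z v \<bullet> \<phi> z"
      using C1_deriv_on_bilinear[OF bounded_bilinear_inner w \<phi>'(1)] by blast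
    have Fc: "continuous_on ?S F" unfolding F_def
      by (intro continuous_intros C1_deriv_onD(3)[OF A] C1_deriv_onD(3)[OF p])
    have "(LINT y|lebesgue_on \<Omega>. f' (t, y) (1, 0) - ?b' (snd (t, y)) (F (t, y))) = 0"
    proof (rule weak_identity_differentiated[OF \<Omega> f'(1) _ _ tx(1,2), where g = "\<lambda>z. ?b' (snd z) (F z)"
          and c = "LINT y|lebesgue_on \<Omega>. m\<^sub>0 y \<bullet> \<phi> (0, y)"])
      show "continuous_on ?S (\<lambda>z. ?b' (snd z) (F z))"
        unfolding bump_deriv_def by (intro continuous_intros Fc)
      fix \<tau> assume \<tau>: "0 < \<tau>" "\<tau> < T"
      let ?X = "\<lambda>s. matrix_integral ?K (\<lambda>A. Rv s A + measure (Rp s) A *\<^sub>R mat 1)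
           (\<lambda>x. vgrad (\<phi>' (s, x)))"
      have bc: "\<phi> (s, y) \<bullet> n = 0" if "y \<in> frontier \<Omega>" for s y n
      proof -
        have "y \<notin> cball x r" using that r(2) \<Omega>(1) by (auto simp: frontier_def interior_open)
        then show ?thesis by (simp add: \<phi>_def bump_outside(1)[OF _ r(1)])
      qed
      have "(LINT s|lebesgue_on {0..\<tau>}. ?X s) = 0"
      proof (rule integral_eq_zero_AE)
        have "AE s in lebesgue_on {0<..<T}. s \<in> {0<..<T}" by (rule AE_I2) (simp add: space_restrict_space)
        with no_defect have "AE s in lebesgue_on {0<..<T}. ?X s = 0"
        proof eventually_elim
          case (elim s)
          then have s: "s \<in> {0..<T}" by auto
          have "continuous_on ?K (\<lambda>y. \<phi>' (s, y))"
            by (rule continuous_on_slice[OF C1_deriv_onD(2)[OF \<phi>'(1)] s])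
          with K obtain B where B: "B > 0" "\<And>y. y \<in> ?K \<Longrightarrow> norm (\<phi>' (s, y)) \<le> B"
            by (rule bounded_on_compact) blast
          have "\<bar>?X s\<bar> \<le> 2 * B * (real CARD('n))\<^sup>2 * (trace (Rv s ?K) + measure (Rp s) ?K)"
          proof (rule defect_integral_bound[OF Rv Rp])
            show "\<bar>vgrad (\<phi>' (s, y)) $ k $ j\<bar> \<le> B" if "y \<in> ?K" for y k j
              using B(2)[OF that] vgrad_entry_bound[of "\<phi>' (s, y)" k j] by linarith
          qed (use elim B in auto)
          then show ?case using elim by simp
        qed
        then show "AE s in lebesgue_on {0..\<tau>}. ?X s = 0" by (rule AE_initial_interval[OF _ \<tau>(2)])
      qed
      moreover have "(LINT s|lebesgue_on {0..\<tau>}. LINT y|lebesgue_on \<Omega>.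
           m s y \<bullet> \<phi>' (s, y) (1, 0) + inverse (\<rho> s y) * (m s y \<bullet> \<phi>' (s, y) (0, m s y)) +
           pressure a \<gamma> (\<rho> s y) * vdiv (\<phi>' (s, y))) =
         (LINT s|lebesgue_on {0..\<tau>}. LINT y|lebesgue_on \<Omega>. ?b' (snd (s, y)) (F (s, y)))"
      proof (intro Bochner_Integration.integral_cong refl)
        fix s y assume "s \<in> space (lebesgue_on {0..\<tau>})" "y \<in> space (lebesgue_on \<Omega>)"
        then have "s \<in> {0..<T}" "y \<in> ?K" using \<tau> sp by (auto simp: space_restrict_space)
        from integrand[OF this]
        show "m s y \<bullet> \<phi>' (s, y) (1, 0) + inverse (\<rho> s y) * (m s y \<bullet> \<phi>' (s, y) (0, m s y)) +
           pressure a \<gamma> (\<rho> s y) * vdiv (\<phi>' (s, y)) = ?b' (snd (s, y)) (F (s, y))" by simp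
      qed
      ultimately show "(LINT y|lebesgue_on \<Omega>. w (\<tau>, y) \<bullet> \<phi> (\<tau>, y)) - (LINT y|lebesgue_on \<Omega>. m\<^sub>0 y \<bullet> \<phi> (0, y)) =
          (LINT s|lebesgue_on {0..\<tau>}. LINT y|lebesgue_on \<Omega>. ?b' (snd (s, y)) (F (s, y)))"
        using momentum_equation_weak_uncut[OF \<Omega> mom \<phi>'(1) bc \<tau>] by (simp add: w_def)
    qed
    also have "(LINT y|lebesgue_on \<Omega>. f' (t, y) (1, 0) - ?b' (snd (t, y)) (F (t, y))) =
        (LINT y|lebesgue_on \<Omega>. m' (t, y) (1, 0) $ i * ?b y - ?b' y (F (t, y)))"
    proof (intro Bochner_Integration.integral_cong refl)
      fix y assume "y \<in> space (lebesgue_on \<Omega>)"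
      then have y: "y \<in> ?K" using sp by (auto simp: space_restrict_space)
      then have "(t, y) \<in> ?S" using ts by auto
      from f'(2)[OF this] show "f' (t, y) (1, 0) - ?b' (snd (t, y)) (F (t, y)) = m' (t, y) (1, 0) $ i * ?b y - ?b' y (F (t, y))"
        by (simp add: \<phi>'v[OF ts y] linear_0[OF b'lin] \<phi>_def inner_axis mult.commute)
    qed
    also have "\<dots> = (LINT y|lebesgue_on \<Omega>. m' (t, y) (1, 0) $ i * ?b y) - (LINT y|lebesgue_on \<Omega>. ?b' y (F (t, y)))"
    proof (rule Bochner_Integration.integral_diff)
      have bc: "continuous_on \<Omega> ?b"
        by (rule has_derivative_continuous_on[OF has_derivative_at_withinI[OF bump_has_derivative]])
      show "integrable (lebesgue_on \<Omega>) (\<lambda>y. m' (t, y) (1, 0) $ i * ?b y)"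
        by (rule integral_compact_support(2)[OF \<Omega>(1) _ r(2)])
          (auto intro!: continuous_on_mult bc gc simp: bump_outside[OF _ r(1)])
      show "integrable (lebesgue_on \<Omega>) (\<lambda>y. ?b' y (F (t, y)))"
        by (rule integral_compact_support(2)[OF \<Omega>(1) _ r(2)])
          (auto intro!: continuous_on_bump_deriv c Fc simp: bump_outside[OF _ r(1)])
    qed
    finally show "(LINT y|lebesgue_on \<Omega>. m' (t, y) (1, 0) $ i * ?b y) =
        (LINT y|lebesgue_on \<Omega>. ?b' y (A (t, y) $ i + p (t, y) *\<^sub>R axis i 1))" by (simp add: F_def)
  qed
  have "(dt (m' (t, x)) + mdiv (W' (t, x)) + grad (P' (t, x))) $ i = 0" for i
  proof -
    have "(\<Sum>j\<in>UNIV. P' (t, x) (0, axis j 1) * (axis i 1 :: real^'n) $ j) =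
        (\<Sum>j\<in>UNIV. if j = i then P' (t, x) (0, axis j 1) else 0)"
      by (rule sum.cong) (auto simp: axis_def)
    then show ?thesis
      using comp[of i] by (simp add: dt_def mdiv_def grad_def sum.distrib)
  qed
  then show ?thesis by (simp add: vec_eq_iff)
qed

section \<open>Regular dissipative solutions are classical\<close>

theorem theorem4p3:
  fixes a \<gamma> T \<rho>low :: real
    and \<Omega> :: "(real^'n) set"
    and \<rho>\<^sub>0 :: "real^'n \<Rightarrow> real" and m\<^sub>0 :: "real^'n \<Rightarrow> real^'n"
    and \<rho> :: "real \<Rightarrow> real^'n \<Rightarrow> real" and m :: "real \<Rightarrow> real^'n \<Rightarrow> real^'n"
    and Rv :: "real \<Rightarrow> (real^'n) set \<Rightarrow> real^'n^'n" and Rp :: "real \<Rightarrow> (real^'n) measure"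
  assumes "CARD('n) = 2 \<or> CARD('n) = 3"
    and "a > 0" and "\<gamma> > 1" and "T > 0"
    and "bounded_C1_domain \<Omega>"
    and "dissipative_solution a \<gamma> T \<Omega> \<rho>\<^sub>0 m\<^sub>0 \<rho> m Rv Rp"
    and "C1_on ({0..<T} \<times> closure \<Omega>) (\<lambda>(t, x). \<rho> t x)"
    and "C1_on ({0..<T} \<times> closure \<Omega>) (\<lambda>(t, x). m t x)"
    and "\<rho>low > 0" and "\<And>t x. t \<in> {0..<T} \<Longrightarrow> x \<in> closure \<Omega> \<Longrightarrow> \<rho> t x \<ge> \<rho>low"
  shows "(AE t in lebesgue_on {0<..<T}. \<forall>A\<in>sets (restrict_space borel (closure \<Omega>)). Rv t A = 0)
    \<and> (AE t in lebesgue_on {0<..<T}. Rp t = null_measure (restrict_space borel (closure \<Omega>)))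
    \<and> (\<exists>\<rho>\<^sub>0' m\<^sub>0'. (AE x in lebesgue_on \<Omega>. \<rho>\<^sub>0' x = \<rho>\<^sub>0 x) \<and> (AE x in lebesgue_on \<Omega>. m\<^sub>0' x = m\<^sub>0 x)
         \<and> classical_solution a \<gamma> T \<Omega> \<rho>\<^sub>0' m\<^sub>0' \<rho> m)"
proof -
  note ds = assms(6)
  let ?K = "closure \<Omega>"
  let ?S = "{0..<T} \<times> ?K"
  have \<Omega>: "open \<Omega>" "bounded \<Omega>" using assms(5) by (auto simp: bounded_C1_domain_def)
  have sp: "x \<in> ?K" if "x \<in> \<Omega>" for x using that closure_subset by auto
  obtain \<rho>' m' where \<rho>: "C1_deriv_on ?S (\<lambda>(t, x). \<rho> t x) \<rho>'" and m: "C1_deriv_on ?S (\<lambda>(t, x). m t x) m'"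
    using assms(7,8) unfolding C1_on_def by blast
  have pos: "\<rho> t x > 0" if "t \<in> {0..<T}" "x \<in> ?K" for t x
    using assms(10)[OF that] assms(9) by linarith
  have cont: "continuity_equation_weak T \<Omega> \<rho>\<^sub>0 \<rho> m"
    and mom: "momentum_equation_weak a \<gamma> T \<Omega> m\<^sub>0 \<rho> m Rv Rp"
    and ini: "AE x in lebesgue_on \<Omega>. \<rho> 0 x = \<rho>\<^sub>0 x" "AE x in lebesgue_on \<Omega>. m 0 x = m\<^sub>0 x"
    and Rv: "\<And>t. t \<in> {0<..<T} \<Longrightarrow> nonneg_sym_matrix_measure_on ?K (Rv t)"
    and Rp: "\<And>t. t \<in> {0<..<T} \<Longrightarrow> nonneg_measure_on ?K (Rp t)"
    using ds unfolding dissipative_solution_def Linf_matrix_measures_def Linf_measures_def by blast+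
  have nd: "AE t in lebesgue_on {0<..<T}. trace (Rv t ?K) = 0 \<and> measure (Rp t) ?K = 0"
    by (rule defects_vanish[OF \<Omega> assms(3,2) ds \<rho> m pos])
  have memb: "AE t in lebesgue_on {0<..<T}. t \<in> {0<..<T}"
    by (rule AE_I2) (simp add: space_restrict_space)
  have 1: "AE t in lebesgue_on {0<..<T}. \<forall>A\<in>sets (restrict_space borel ?K). Rv t A = 0"
    using nd memb
  proof eventually_elim
    case (elim t)
    then show ?case
      using nonneg_sym_matrix_measure_entry_bound[OF Rv[of t]] by (force simp: vec_eq_iff)
  qed
  have 2: "AE t in lebesgue_on {0<..<T}. Rp t = null_measure (restrict_space borel ?K)"
    using nd memb
  proof eventually_elim
    case (elim t)
    interpret finite_measure "Rp t" using Rp[of t] elim by (simp add: nonneg_measure_on_def)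
    have s: "sets (Rp t) = sets (restrict_space borel ?K)" "space (Rp t) = ?K"
      using Rp[of t] nonneg_measure_on_space[OF Rp[of t]] elim by (auto simp: nonneg_measure_on_def)
    show ?case
    proof (rule measure_eqI)
      fix A
      have "measure (Rp t) A \<le> measure (Rp t) (space (Rp t))" by (rule bounded_measure)
      then have "measure (Rp t) A = 0" using elim s(2) by (simp add: measure_le_0_iff)
      then show "emeasure (Rp t) A = emeasure (null_measure (restrict_space borel ?K)) A"
        by (simp add: emeasure_eq_measure)
    qed (simp add: s)
  qed
  have "classical_solution a \<gamma> T \<Omega> (\<rho> 0) (m 0) \<rho> m"
    unfolding classical_solution_def
  proof (intro conjI ballI allI impI refl)
    show "C1_on ?S (\<lambda>(t, x). \<rho> t x)" "C1_on ?S (\<lambda>(t, x). m t x)" by fact+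
    show "0 < \<rho> t x" if "t \<in> {0..<T}" "x \<in> ?K" for t x using pos[OF that] .
    show "(m t x /\<^sub>R \<rho> t x) \<bullet> n = 0" if "t \<in> {0..<T}" "x \<in> frontier \<Omega>" "outer_normal \<Omega> x n" for t x n
      using impermeable_boundary[OF \<Omega> cont \<rho> C1_deriv_onD(3)[OF m], of t x n] that by simp
    fix t x assume t: "t \<in> {0<..<T}" and x: "x \<in> \<Omega>"
    then have tx: "0 < t" "t < T" "x \<in> \<Omega>" by auto
    have fd: "frechet_derivative f (at (t, x)) = blinfun_apply (f' (t, x))"
      if "C1_deriv_on ?S f f'" for f :: "real \<times> (real^'n) \<Rightarrow> 'b::real_normed_vector" and f'
      using frechet_derivative_at[OF interior_space_time_has_derivative(1)[OF that \<Omega>(1) tx]] by simp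
    show "dt (frechet_derivative (\<lambda>(s, y). \<rho> s y) (at (t, x))) +
        vdiv (frechet_derivative (\<lambda>(s, y). m s y) (at (t, x))) = 0"
      unfolding fd[OF \<rho>] fd[OF m] by (rule continuity_equation_pointwise[OF \<Omega> cont \<rho> m tx])
    define r where "r = (\<lambda>(t, x). \<rho> t x)"
    have r: "C1_deriv_on ?S r \<rho>'" using \<rho> by (simp add: r_def)
    have rp: "r z > 0" if "z \<in> ?S" for z using that pos by (auto simp: r_def)
    obtain i' where i': "C1_deriv_on ?S (\<lambda>z. 1 * r z powr (- 1)) i'"
      using C1_deriv_on_powr[OF r rp, of 1 "-1"] by blast
    obtain P0 where "C1_deriv_on ?S (\<lambda>z. a * r z powr \<gamma>) P0"
      using C1_deriv_on_powr[OF r rp, of a \<gamma>] by blast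
    then have P: "C1_deriv_on ?S (\<lambda>(t, x). pressure a \<gamma> (\<rho> t x)) P0"
      by (rule C1_deriv_on_cong) (auto simp: r_def pressure_def)
    obtain M where M: "C1_deriv_on ?S (\<lambda>z. (case z of (t, x) \<Rightarrow> m t x) \<otimes>\<^sub>t (case z of (t, x) \<Rightarrow> m t x)) M"
      using C1_deriv_on_bilinear[OF bounded_bilinear_tensor m m] by blast
    obtain W0 where "C1_deriv_on ?S (\<lambda>z. (1 * r z powr (- 1)) *\<^sub>R
        ((case z of (t, x) \<Rightarrow> m t x) \<otimes>\<^sub>t (case z of (t, x) \<Rightarrow> m t x))) W0"
      using C1_deriv_on_bilinear[OF bounded_bilinear_scaleR i' M] by blast
    then have W: "C1_deriv_on ?S (\<lambda>(t, x). (m t x \<otimes>\<^sub>t m t x) /\<^sub>R \<rho> t x) W0"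
    proof (rule C1_deriv_on_cong)
      fix z assume "z \<in> ?S"
      from rp[OF this] show "(1 * r z powr (- 1)) *\<^sub>R
        ((case z of (t, x) \<Rightarrow> m t x) \<otimes>\<^sub>t (case z of (t, x) \<Rightarrow> m t x)) =
        (case z of (t, x) \<Rightarrow> (m t x \<otimes>\<^sub>t m t x) /\<^sub>R \<rho> t x)"
        by (cases z) (simp add: r_def powr_minus)
    qed
    show "dt (frechet_derivative (\<lambda>(s, y). m s y) (at (t, x))) +
        mdiv (frechet_derivative (\<lambda>(s, y). (m s y \<otimes>\<^sub>t m s y) /\<^sub>R \<rho> s y) (at (t, x))) +
        grad (frechet_derivative (\<lambda>(s, y). pressure a \<gamma> (\<rho> s y)) (at (t, x))) = 0"
      unfolding fd[OF m] fd[OF W] fd[OF P]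
      by (rule momentum_equation_pointwise[OF \<Omega> mom Rv Rp nd \<rho> m W P tx])
  qed
  then show ?thesis using 1 2 ini by blast
qed

end
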